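(* Let $\alpha>1$ and let $Q$ be as in the context. For $\varepsilon\in(0,1]$ let $\nu_\varepsilon$ be the unique invariant probability measure on $H$ of the stochastic Navier-Stokes equation on the two-dimensional torus $$du(t)+Au(t)\,dt+B(u(t),u(t))\,dt=\sqrt{\varepsilon}\,dw(t),\qquad u(0)=x .$$ Then for any $s>0$ there exist $\varepsilon_s>0$ and $R_s>0$ such that $$\nu_\varepsilon\big(\{x\in H:\ |x|_H\ge R_s\}\big)\le\exp\Big(-\frac{s}{\varepsilon}\Big)\qquad\text{for all }\varepsilon\in(0,1]\text{ with }\varepsilon\le\varepsilon_s .$$
   Context: **Spaces and operators.** Fix $L>0$ and let $\mathbb{T}^2=(\mathbb{R}/L\mathbb{Z})^2$. $H$ is the closed subspace of $L^2(\mathbb{T}^2,\mathbb{R}^2)$ of vector fields with zero mean and zero divergence (in the distributional sense, with periodic boundary conditions), with the $L^2$ norm $|\cdot|_H$. $P:L^2(\mathbb{T}^2,\mathbb{R}^2)\to H$ is the orthogonal (Leray-Helmholtz) projection. $A=-P\Delta$, $D(A)=H\cap H^{2,2}(\mathbb{T}^2,\mathbb{R}^2)$, is the Stokes operator, positive self-adjoint in $H$; $V=D(A^{1/2})$. For $\theta\ge 0$, $D(A^\theta)$ carries the norm $|A^\theta x|_H$. $b(u,v,w)=\sum_{i,j=1}^2\int_{\mathbb{T}^2}u_i\frac{\partial v_j}{\partial x_i}w_j\,dx$, and $B(u,v)\in V'$ is defined by $\langle B(u,v),w\rangle=b(u,v,w)$. **Noise and invariant measure.** $\alpha>1$ and $Q$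 is a positive self-adjoint bounded operator on $H$ which is an isomorphism of $H$ onto $D(A^{\alpha/2})$ (so $C=Q^2=QQ^\star$ is trace class in $H$). $w$ is an $H$-valued Wiener process with covariance operator $C$ on a filtered probability space. For every $x\in H$ and $\varepsilon\in(0,1]$ the equation has a unique solution $u^x_\varepsilon$ with paths in $C([0,T];H)\cap L^2(0,T;V)$ for every $T>0$ (i.e. adapted and a.s. $\langle u(t),\phi\rangle_H+\int_0^t\langle u(s),A\phi\rangle_H ds-\int_0^t b(u(s),\phi,u(s))\,ds=\langle x,\phi\rangle_H+\sqrt\varepsilon\langle w(t),\phi\rangle_H$ for all $t\geq 0$, $\phi\in D(A)$). $\nu_\varepsilon$ is the unique Borel probability measure on $H$ with $\int_H\mathbb{E}\varphi(u^x_\varepsilon(t))\,\nu_\varepsilon(dx)=\int_H\varphi\,d\nu_\varepsilon$ for all bounded continuous $\varphi:H\to\mathbb{R}$ and $t\ge0$. It is known that it exists, is unique and is ergodic; in particular $\int_H\varphi\,d\nu_\varepsilon=\lim_{T\to\infty}\frac1T\int_0^T\mathbb{E}\varphi(u^0_\varepsilon(t))\,dt$ for every bounded Borel $\varphi:H\to\mathbb{R}$. *)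

theory Defs
  imports "HOL-Probability.Probability"
begin

section \<open>Vector fields on the plane modulo equality almost everywhere\<close>

text \<open>
  Functions on the torus \<open>(\<real>/L\<int>)\<^sup>2\<close> are represented by \<open>L\<close>-periodic functions on the plane, and the
  elements of \<open>L\<^sup>2\<close> by classes of Borel functions modulo Lebesgue-null sets.  All notions
  below that mention a representative \<open>fld u\<close> do so inside an integral or an almost-everywhere
  quantifier, so that they do not depend on which representative is chosen.
\<close>

definition ae_eq :: "(real^2 \<Rightarrow> real^2) \<Rightarrow> (real^2 \<Rightarrow> real^2) \<Rightarrow> bool" where
  "ae_eq f g \<longleftrightarrow> f \<in> borel_measurable borel \<and> g \<in> borel_measurable borel \<and> (AE x in lborel. f x = g x)"

lemma ae_eq_part_equivp: "part_equivp ae_eq"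
proof (rule part_equivpI)
  show "\<exists>x. ae_eq x x"
    by (rule exI[of _ "\<lambda>_. 0"]) (simp add: ae_eq_def)
  show "symp ae_eq"
    by (auto simp: symp_def ae_eq_def eq_commute)
  show "transp ae_eq"
    unfolding transp_def ae_eq_def by (auto elim: AE_mp)
qed

quotient_type vfield = "real^2 \<Rightarrow> real^2" / partial: ae_eq
  morphisms fld vfield_of
  by (rule ae_eq_part_equivp)

instantiation vfield :: real_vector
begin

lift_definition zero_vfield :: vfield is "\<lambda>_. 0"
  by (simp add: ae_eq_def)

lift_definition plus_vfield :: "vfield \<Rightarrow> vfield \<Rightarrow> vfield" is "\<lambda>f g x. f x + g x"
  unfolding ae_eq_def by auto

lift_definition uminus_vfield :: "vfield \<Rightarrow> vfield" is "\<lambda>f x. - f x"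
  unfolding ae_eq_def by auto

lift_definition minus_vfield :: "vfield \<Rightarrow> vfield \<Rightarrow> vfield" is "\<lambda>f g x. f x - g x"
  unfolding ae_eq_def by auto

lift_definition scaleR_vfield :: "real \<Rightarrow> vfield \<Rightarrow> vfield" is "\<lambda>c f x. c *\<^sub>R f x"
  unfolding ae_eq_def by auto

instance
  by standard (transfer; simp add: ae_eq_def algebra_simps)+

end

lemma ae_eq_fld: "ae_eq (fld u) (fld u)"
  by (rule Quotient_rep_reflp[OF Quotient_vfield])

lemma fld_measurable [measurable]: "fld u \<in> borel_measurable borel"
  using ae_eq_fld[of u] by (simp add: ae_eq_def)

lemma fld_vfield_of: "f \<in> borel_measurable borel \<Longrightarrow> AE x in lborel. fld (vfield_of f) x = f x"
  using Quotient_rep_abs[OF Quotient_vfield, of f] by (simp add: ae_eq_def)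

lemma vfield_eq_iff: "u = v \<longleftrightarrow> (AE x in lborel. fld u x = fld v x)"
  using Quotient_rel_rep[OF Quotient_vfield, of u v] by (auto simp: ae_eq_def)

section \<open>The spaces \<open>L\<^sup>2\<close> and \<open>H\<close>\<close>

definition cell :: "real \<Rightarrow> (real^2) set" where
  "cell L = cbox 0 (\<chi> i. L)"

definition periodic :: "real \<Rightarrow> vfield \<Rightarrow> bool" where
  "periodic L u \<longleftrightarrow> (\<forall>i. AE x in lborel. fld u (x + L *\<^sub>R axis i 1) = fld u x)"

definition L2 :: "real \<Rightarrow> vfield set" where
  "L2 L = {u. periodic L u \<and> set_integrable lborel (cell L) (\<lambda>x. (norm (fld u x))\<^sup>2)}"

definition hinner :: "real \<Rightarrow> vfield \<Rightarrow> vfield \<Rightarrow> real" where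
  "hinner L u v = (LINT x:cell L|lborel. fld u x \<bullet> fld v x)"

definition hnorm :: "real \<Rightarrow> vfield \<Rightarrow> real" where
  "hnorm L u = sqrt (hinner L u u)"

definition pdiff :: "2 \<Rightarrow> (real^2 \<Rightarrow> real) \<Rightarrow> real^2 \<Rightarrow> real" where
  "pdiff i \<phi> x = frechet_derivative \<phi> (at x) (axis i 1)"

primrec times_differentiable :: "nat \<Rightarrow> (real^2 \<Rightarrow> real) \<Rightarrow> bool" where
  "times_differentiable 0 \<phi> \<longleftrightarrow> continuous_on UNIV \<phi>"
| "times_differentiable (Suc k) \<phi> \<longleftrightarrow>
     (\<forall>x. \<phi> differentiable (at x)) \<and> (\<forall>i. times_differentiable k (pdiff i \<phi>))"

text \<open>Smooth functions on the torus, the test functions for distributional derivatives.\<close>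

definition test_functions :: "real \<Rightarrow> (real^2 \<Rightarrow> real) set" where
  "test_functions L =
     {\<phi>. (\<forall>k. times_differentiable k \<phi>) \<and> (\<forall>i x. \<phi> (x + L *\<^sub>R axis i 1) = \<phi> x)}"

definition div_free :: "real \<Rightarrow> vfield \<Rightarrow> bool" where
  "div_free L u \<longleftrightarrow>
     (\<forall>\<phi>\<in>test_functions L. (LINT x:cell L|lborel. fld u x \<bullet> (\<chi> i. pdiff i \<phi> x)) = 0)"

definition H :: "real \<Rightarrow> vfield set" where
  "H L = {u \<in> L2 L. (LINT x:cell L|lborel. fld u x) = 0 \<and> div_free L u}"

lemma fld_diff: "AE x in lborel. fld (u - v) x = fld u x - fld v x"
proof -
  have "u - v = vfield_of (\<lambda>x. fld u x - fld v x)"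
    by (simp add: minus_vfield_def)
  then show ?thesis using fld_vfield_of[of "\<lambda>x. fld u x - fld v x"] by simp
qed

lemma AE_lborel_translation:
  fixes c :: "'a::euclidean_space"
  assumes "AE x in lborel. P x"
  shows "AE x in lborel. P (x + c)"
proof -
  have "AE x in distr lborel borel ((+) c). P x"
    using assms unfolding lborel_distr_plus .
  from AE_distrD[OF _ this] show ?thesis by (simp add: add.commute)
qed

lemma hinner_nonneg: "0 \<le> hinner L u u"
  unfolding hinner_def set_lebesgue_integral_def by (intro integral_nonneg_AE) (simp add: indicator_def)

lemma hnorm_commute: "hnorm L (u - v) = hnorm L (v - u)"
proof -
  have "hinner L (u-v) (u-v) = hinner L (v-u) (v-u)"
    unfolding hinner_def set_lebesgue_integral_def
  proof (rule integral_cong_AE)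
    show "AE x in lborel. indicat_real (cell L) x *\<^sub>R (fld (u - v) x \<bullet> fld (u - v) x) =
        indicat_real (cell L) x *\<^sub>R (fld (v - u) x \<bullet> fld (v - u) x)"
      using fld_diff[of u v] fld_diff[of v u]
      by eventually_elim (simp add: inner_diff_left inner_diff_right inner_commute)
  qed (auto simp: cell_def)
  then show ?thesis by (simp add: hnorm_def)
qed

lemma periodic_diff:
  assumes "periodic L u" "periodic L v" shows "periodic L (u - v)"
  unfolding periodic_def
proof
  fix i :: 2
  show "AE x in lborel. fld (u - v) (x + L *\<^sub>R axis i 1) = fld (u - v) x"
    using assms[unfolded periodic_def, rule_format, of i] fld_diff[of u v]
      AE_lborel_translation[OF fld_diff[of u v], of "L *\<^sub>R axis i 1"]
    by eventually_elim simp
qed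

lemma periodic_int_multiple:
  assumes "periodic L u"
  shows "AE x in lborel. fld u (x + (of_int k * L) *\<^sub>R axis i 1) = fld u x"
proof (induction k rule: int_induct[where k=0])
  case base then show ?case by simp
next
  case (step1 k)
  have "AE x in lborel. fld u (x + L *\<^sub>R axis i 1) = fld u x" using assms by (simp add: periodic_def)
  from AE_lborel_translation[OF this, of "(of_int k * L) *\<^sub>R axis i 1"] step1(2)
  show ?case by eventually_elim (simp add: algebra_simps)
next
  case (step2 k)
  have "AE x in lborel. fld u (x + L *\<^sub>R axis i 1) = fld u x" using assms by (simp add: periodic_def)
  from AE_lborel_translation[OF this, of "(of_int (k - 1) * L) *\<^sub>R axis i 1"] step2(2)
  show ?case by eventually_elim (simp add: algebra_simps)
qed

lemma periodic_zero:
  assumes L: "L > 0" and p: "periodic L u" and z: "AE x in lborel. x \<in> cell L \<longrightarrow> fld u x = 0"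
  shows "u = 0"
proof -
  define sh :: "int \<Rightarrow> int \<Rightarrow> real^2" where
    "sh = (\<lambda>k l. (of_int k * L) *\<^sub>R axis 1 1 + (of_int l * L) *\<^sub>R axis 2 1)"
  have per: "AE x in lborel. fld u (x + sh k l) = fld u x" for k l
    using AE_lborel_translation[OF periodic_int_multiple[OF p, of l 2], of "(of_int k * L) *\<^sub>R axis 1 1"]
      periodic_int_multiple[OF p, of k 1]
    by eventually_elim (simp add: sh_def algebra_simps)
  have "AE x in lborel. \<forall>k l. fld u (x + sh k l) = fld u x \<and> (x + sh k l \<in> cell L \<longrightarrow> fld u (x + sh k l) = 0)"
    using per AE_lborel_translation[OF z] by (simp add: AE_all_countable AE_conj_iff)
  then have "AE x in lborel. fld u x = 0"
  proof eventually_elim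
    case (elim x)
    define k where "k = (\<lambda>i. - \<lfloor>x $ i / L\<rfloor>)"
    have "0 \<le> x $ i + of_int (k i) * L \<and> x $ i + of_int (k i) * L \<le> L" for i
      using L floor_divide_lower[of L "x $ i"] floor_divide_upper[of L "x $ i"]
      by (simp add: k_def algebra_simps)
    then have "x + sh (k 1) (k 2) \<in> cell L"
      by (simp add: cell_def sh_def mem_box_cart forall_2 axis_def)
    then show ?case using elim by metis
  qed
  moreover have "AE x in lborel. fld 0 x = 0"
    using fld_vfield_of[of "\<lambda>_. 0"] by (simp add: zero_vfield_def)
  ultimately have "AE x in lborel. fld u x = fld 0 x" by eventually_elim simp
  then show ?thesis by (simp add: vfield_eq_iff)
qed

lemma hinner_integrable:
  assumes "u \<in> L2 L" "v \<in> L2 L"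
  shows "set_integrable lborel (cell L) (\<lambda>x. fld u x \<bullet> fld v x)"
proof -
  have c: "cell L \<in> sets borel" by (simp add: cell_def)
  have "set_integrable lborel (cell L) (\<lambda>x. (norm (fld u x))\<^sup>2 + (norm (fld v x))\<^sup>2)"
    using assms by (intro set_integral_add) (auto simp: L2_def)
  then show ?thesis
    unfolding set_integrable_def
  proof (rule Bochner_Integration.integrable_bound)
    show "(\<lambda>x. indicat_real (cell L) x *\<^sub>R (fld u x \<bullet> fld v x)) \<in> borel_measurable lborel"
      using c by measurable
    have "\<bar>a \<bullet> b\<bar> \<le> (norm a)\<^sup>2 + (norm b)\<^sup>2" for a b :: "real^2"
      using Cauchy_Schwarz_ineq2[of a b] sum_squares_bound[of "norm a" "norm b"]
        mult_nonneg_nonneg[OF norm_ge_zero[of a] norm_ge_zero[of b]] by linarith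
    then show "AE x in lborel. norm (indicat_real (cell L) x *\<^sub>R (fld u x \<bullet> fld v x))
        \<le> norm (indicat_real (cell L) x *\<^sub>R ((norm (fld u x))\<^sup>2 + (norm (fld v x))\<^sup>2))"
      by (intro AE_I2) (auto simp: indicator_def)
  qed
qed

lemma L2_diff:
  assumes "u \<in> L2 L" "v \<in> L2 L"
  shows "u - v \<in> L2 L"
proof -
  have c: "cell L \<in> sets borel" by (simp add: cell_def)
  have "set_integrable lborel (cell L) (\<lambda>x. 2 * ((norm (fld u x))\<^sup>2 + (norm (fld v x))\<^sup>2))"
    using assms by (intro set_integral_add set_integrable_mult_right) (auto simp: L2_def)
  then have "set_integrable lborel (cell L) (\<lambda>x. (norm (fld (u - v) x))\<^sup>2)"
    unfolding set_integrable_def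
  proof (rule Bochner_Integration.integrable_bound)
    show "(\<lambda>x. indicat_real (cell L) x *\<^sub>R (norm (fld (u - v) x))\<^sup>2) \<in> borel_measurable lborel"
      using c by measurable
    have bound: "(norm (a - b))\<^sup>2 \<le> 2 * ((norm a)\<^sup>2 + (norm b)\<^sup>2)" for a b :: "real^2"
      using power_mono[OF norm_triangle_ineq4[of a b], of 2] sum_squares_bound[of "norm a" "norm b"]
      by (simp add: power2_sum)
    show "AE x in lborel. norm (indicat_real (cell L) x *\<^sub>R (norm (fld (u - v) x))\<^sup>2)
        \<le> norm (indicat_real (cell L) x *\<^sub>R (2 * ((norm (fld u x))\<^sup>2 + (norm (fld v x))\<^sup>2)))"
      using fld_diff[of u v] by eventually_elim (use bound in \<open>auto simp: indicator_def\<close>)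
  qed
  then show ?thesis using assms periodic_diff by (auto simp: L2_def)
qed

lemma hnorm_diff_zero_iff:
  assumes "L > 0" "u \<in> L2 L" "v \<in> L2 L"
  shows "hnorm L (u - v) = 0 \<longleftrightarrow> u = v"
proof
  assume "hnorm L (u - v) = 0"
  then have "(LINT x:cell L|lborel. fld (u-v) x \<bullet> fld (u-v) x) = 0"
    by (simp add: hnorm_def hinner_def)
  moreover have "set_integrable lborel (cell L) (\<lambda>x. fld (u-v) x \<bullet> fld (u-v) x)"
    using L2_diff[OF assms(2,3)] by (intro hinner_integrable)
  ultimately have "AE x in lborel. indicat_real (cell L) x *\<^sub>R (fld (u-v) x \<bullet> fld (u-v) x) = 0"
    unfolding set_lebesgue_integral_def set_integrable_def
    by (subst (asm) integral_nonneg_eq_0_iff_AE) (auto simp: indicator_def)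
  then have "AE x in lborel. x \<in> cell L \<longrightarrow> fld (u-v) x = 0"
    by eventually_elim (auto simp: indicator_def)
  then have "u - v = 0"
    using assms periodic_diff[of L u v] by (intro periodic_zero[OF assms(1)]) (auto simp: L2_def)
  then show "u = v" by simp
next
  assume "u = v"
  have "AE x in lborel. fld 0 x = 0"
    using fld_vfield_of[of "\<lambda>_. 0"] by (simp add: zero_vfield_def)
  then have "AE x in lborel. indicat_real (cell L) x *\<^sub>R (fld 0 x \<bullet> fld 0 x) = 0"
    by eventually_elim simp
  then have "hinner L 0 0 = 0"
    unfolding hinner_def set_lebesgue_integral_def
    by (rule integral_eq_zero_AE)
  then show "hnorm L (u - v) = 0" using \<open>u = v\<close> by (simp add: hnorm_def)
qed

lemma hinner_square_le:
  assumes u: "u \<in> L2 L" and v: "v \<in> L2 L"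
  shows "(hinner L u v)\<^sup>2 \<le> hinner L u u * hinner L v v"
proof -
  let ?I = "\<lambda>f. LINT x:cell L|lborel. f x"
  have quad: "0 \<le> a\<^sup>2 * hinner L u u + 2 * a * b * hinner L u v + b\<^sup>2 * hinner L v v" for a b :: real
  proof -
    have "0 \<le> ?I (\<lambda>x. (a *\<^sub>R fld u x + b *\<^sub>R fld v x) \<bullet> (a *\<^sub>R fld u x + b *\<^sub>R fld v x))"
      unfolding set_lebesgue_integral_def by (intro integral_nonneg_AE) (simp add: indicator_def)
    also have "\<dots> = ?I (\<lambda>x. a\<^sup>2 * (fld u x \<bullet> fld u x) + 2*a*b * (fld u x \<bullet> fld v x) + b\<^sup>2 * (fld v x \<bullet> fld v x))"
      by (intro arg_cong[where f="?I"] ext)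
         (simp add: inner_add_left inner_add_right inner_commute power2_eq_square algebra_simps)
    also have "\<dots> = a\<^sup>2 * hinner L u u + 2*a*b * hinner L u v + b\<^sup>2 * hinner L v v"
      unfolding hinner_def
      using hinner_integrable[OF u u] hinner_integrable[OF u v] hinner_integrable[OF v v]
      by (simp add: set_integral_add set_integrable_mult_right)
    finally show ?thesis .
  qed
  show ?thesis
  proof (cases "hinner L v v = 0")
    case True
    have "hinner L u v = 0"
    proof (rule ccontr)
      assume n: "hinner L u v \<noteq> 0"
      have "0 \<le> hinner L u u + 2 * b * hinner L u v" for b
        using quad[of 1 b] True by simp
      from this[of "- (hinner L u u + 1) / (2 * hinner L u v)"] n show False
        by (simp add: field_simps)
    qed
    then show ?thesis using True by simp
  next
    case False
    then have pos: "hinner L v v > 0" using hinner_nonneg[of L v] by simp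
    have "0 \<le> hinner L v v * (hinner L u u * hinner L v v - (hinner L u v)\<^sup>2)"
      using quad[of "hinner L v v" "- hinner L u v"] by (simp add: algebra_simps power2_eq_square)
    then show ?thesis using pos by (simp add: zero_le_mult_iff)
  qed
qed

lemma hnorm_triangle:
  assumes u: "u \<in> L2 L" and v: "v \<in> L2 L" and w: "w \<in> L2 L"
  shows "hnorm L (u - w) \<le> hnorm L (u - v) + hnorm L (v - w)"
proof -
  let ?a = "u - v" and ?b = "v - w"
  have a: "?a \<in> L2 L" and b: "?b \<in> L2 L" using assms L2_diff by auto
  let ?I = "\<lambda>f. LINT x:cell L|lborel. f x"
  have "hinner L (u - w) (u - w) =
      ?I (\<lambda>x. (fld ?a x \<bullet> fld ?a x) + 2 * (fld ?a x \<bullet> fld ?b x) + (fld ?b x \<bullet> fld ?b x))"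
    unfolding hinner_def set_lebesgue_integral_def
  proof (rule integral_cong_AE)
    show "AE x in lborel. indicat_real (cell L) x *\<^sub>R (fld (u - w) x \<bullet> fld (u - w) x) =
       indicat_real (cell L) x *\<^sub>R ((fld ?a x \<bullet> fld ?a x) + 2 * (fld ?a x \<bullet> fld ?b x) + (fld ?b x \<bullet> fld ?b x))"
      using fld_diff[of u w] fld_diff[of u v] fld_diff[of v w]
    proof eventually_elim
      case (elim x)
      then have "fld (u - w) x = fld ?a x + fld ?b x" by simp
      then show ?case by (simp add: inner_add_left inner_add_right inner_commute)
    qed
  qed (auto simp: cell_def)
  also have "\<dots> = hinner L ?a ?a + 2 * hinner L ?a ?b + hinner L ?b ?b"
    unfolding hinner_def
    using hinner_integrable[OF a a] hinner_integrable[OF a b] hinner_integrable[OF b b]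
    by (simp add: set_integral_add set_integrable_mult_right)
  also have "\<dots> \<le> (hnorm L ?a + hnorm L ?b)\<^sup>2"
    using real_le_rsqrt[OF hinner_square_le[OF a b]] hinner_nonneg[of L ?a] hinner_nonneg[of L ?b]
    by (simp add: hnorm_def power2_sum real_sqrt_mult)
  finally have "(hnorm L (u - w))\<^sup>2 \<le> (hnorm L ?a + hnorm L ?b)\<^sup>2"
    using hinner_nonneg[of L "u - w"] by (simp add: hnorm_def)
  then show ?thesis
    by (rule power2_le_imp_le) (simp add: hnorm_def hinner_nonneg)
qed

lemma Metric_space_H:
  assumes "L > 0"
  shows "Metric_space (H L) (\<lambda>u v. hnorm L (u - v))"
proof
  show "0 \<le> hnorm L (u - v)" for u v by (simp add: hnorm_def hinner_nonneg)
  show "hnorm L (u - v) = hnorm L (v - u)" for u v by (rule hnorm_commute)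
  show "hnorm L (u - v) = 0 \<longleftrightarrow> u = v" if "u \<in> H L" "v \<in> H L" for u v
    using that assms by (intro hnorm_diff_zero_iff) (auto simp: H_def)
  show "hnorm L (u - w) \<le> hnorm L (u - v) + hnorm L (v - w)"
    if "u \<in> H L" "v \<in> H L" "w \<in> H L" for u v w
    using that by (intro hnorm_triangle) (auto simp: H_def)
qed

definition H_topology :: "real \<Rightarrow> vfield topology" where
  "H_topology L = Metric_space.mtopology (H L) (\<lambda>u v. hnorm L (u - v))"

definition borelH :: "real \<Rightarrow> vfield measure" where
  "borelH L = sigma (H L) {U. openin (H_topology L) U}"

lemma topspace_H_topology: "L > 0 \<Longrightarrow> topspace (H_topology L) = H L"
  using Metric_space.topspace_mtopology[OF Metric_space_H] by (simp add: H_topology_def)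

lemma space_borelH: "L > 0 \<Longrightarrow> space (borelH L) = H L"
  using openin_subset[of "H_topology L"] topspace_H_topology[of L]
  by (auto simp: borelH_def space_measure_of_conv)

section \<open>Leray projection, Stokes operator and its powers\<close>

definition orth_proj :: "real \<Rightarrow> vfield set \<Rightarrow> vfield \<Rightarrow> vfield" where
  "orth_proj L S x = (THE y. y \<in> S \<and> (\<forall>h\<in>S. hinner L (x - y) h = 0))"

definition leray :: "real \<Rightarrow> vfield \<Rightarrow> vfield" where
  "leray L = orth_proj L (H L)"

definition has_weak_pdiff :: "real \<Rightarrow> 2 \<Rightarrow> vfield \<Rightarrow> vfield \<Rightarrow> bool" where
  "has_weak_pdiff L i u g \<longleftrightarrow> g \<in> L2 L \<and>
     (\<forall>\<phi>\<in>test_functions L.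
        (LINT x:cell L|lborel. pdiff i \<phi> x *\<^sub>R fld u x) = - (LINT x:cell L|lborel. \<phi> x *\<^sub>R fld g x))"

definition weak_pdiff :: "real \<Rightarrow> 2 \<Rightarrow> vfield \<Rightarrow> vfield" where
  "weak_pdiff L i u = (THE g. has_weak_pdiff L i u g)"

text \<open>\<open>sobolev L k\<close> is the Sobolev space \<open>H\<^bsup>k,2\<^esup>\<close> of vector fields on the torus.\<close>

primrec sobolev :: "real \<Rightarrow> nat \<Rightarrow> vfield set" where
  "sobolev L 0 = L2 L"
| "sobolev L (Suc k) = {u \<in> L2 L. \<forall>i. \<exists>g. has_weak_pdiff L i u g \<and> g \<in> sobolev L k}"

definition laplacian :: "real \<Rightarrow> vfield \<Rightarrow> vfield" where
  "laplacian L u = (\<Sum>i\<in>UNIV. weak_pdiff L i (weak_pdiff L i u))"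

definition stokes_dom :: "real \<Rightarrow> vfield set" where
  "stokes_dom L = H L \<inter> sobolev L 2"

definition stokes :: "real \<Rightarrow> vfield \<Rightarrow> vfield" where
  "stokes L u = - leray L (laplacian L u)"

text \<open>
  The Stokes operator has compact resolvent, hence pure point spectrum; its powers are given by
  spectral calculus, i.e. by \<open>A\<^sup>\<theta> x = \<Sum>\<^sub>\<mu> \<mu>\<^sup>\<theta> E\<^sub>\<mu> x\<close>, where \<open>\<mu>\<close> ranges over the (positive) eigenvalues
  and \<open>E\<^sub>\<mu>\<close> is the orthogonal projection onto the eigenspace of \<open>\<mu>\<close>.
\<close>

definition stokes_eigenspace :: "real \<Rightarrow> real \<Rightarrow> vfield set" where
  "stokes_eigenspace L \<mu> = {e \<in> stokes_dom L. stokes L e = \<mu> *\<^sub>R e}"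

definition stokes_eigenvalues :: "real \<Rightarrow> real set" where
  "stokes_eigenvalues L = {\<mu>. \<exists>e\<in>stokes_eigenspace L \<mu>. e \<noteq> 0}"

definition stokes_proj :: "real \<Rightarrow> real \<Rightarrow> vfield \<Rightarrow> vfield" where
  "stokes_proj L \<mu> = orth_proj L (stokes_eigenspace L \<mu>)"

definition stokes_pow_dom :: "real \<Rightarrow> real \<Rightarrow> vfield set" where
  "stokes_pow_dom L \<theta> =
     {x \<in> H L. (\<lambda>\<mu>. \<mu> powr (2 * \<theta>) * (hnorm L (stokes_proj L \<mu> x))\<^sup>2) summable_on stokes_eigenvalues L}"

text \<open>The element of \<open>H\<close> whose spectral components are \<open>\<mu>\<^sup>\<theta> E\<^sub>\<mu> x\<close>.\<close>

definition stokes_pow :: "real \<Rightarrow> real \<Rightarrow> vfield \<Rightarrow> vfield" where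
  "stokes_pow L \<theta> x = (THE y. y \<in> H L \<and>
     (\<forall>\<mu>\<in>stokes_eigenvalues L. stokes_proj L \<mu> y = \<mu> powr \<theta> *\<^sub>R stokes_proj L \<mu> x))"

definition V :: "real \<Rightarrow> vfield set" where
  "V L = stokes_pow_dom L (1/2)"

definition tri :: "real \<Rightarrow> vfield \<Rightarrow> vfield \<Rightarrow> vfield \<Rightarrow> real" where
  "tri L u v w = (\<Sum>i\<in>UNIV. \<Sum>j\<in>UNIV.
     (LINT x:cell L|lborel. fld u x $ i * fld (weak_pdiff L i v) x $ j * fld w x $ j))"

section \<open>The noise\<close>

definition linear_in_H :: "real \<Rightarrow> (vfield \<Rightarrow> vfield) \<Rightarrow> bool" where
  "linear_in_H L Q \<longleftrightarrow> Q \<in> H L \<rightarrow> H L \<and>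
     (\<forall>x\<in>H L. \<forall>y\<in>H L. Q (x + y) = Q x + Q y) \<and> (\<forall>c. \<forall>x\<in>H L. Q (c *\<^sub>R x) = c *\<^sub>R Q x)"

definition bounded_in_H :: "real \<Rightarrow> (vfield \<Rightarrow> vfield) \<Rightarrow> bool" where
  "bounded_in_H L Q \<longleftrightarrow> linear_in_H L Q \<and> (\<exists>K. \<forall>x\<in>H L. hnorm L (Q x) \<le> K * hnorm L x)"

definition positive_selfadjoint :: "real \<Rightarrow> (vfield \<Rightarrow> vfield) \<Rightarrow> bool" where
  "positive_selfadjoint L Q \<longleftrightarrow> bounded_in_H L Q \<and>
     (\<forall>x\<in>H L. \<forall>y\<in>H L. hinner L (Q x) y = hinner L x (Q y)) \<and> (\<forall>x\<in>H L. 0 \<le> hinner L (Q x) x)"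

definition isomorphism_onto_pow_dom :: "real \<Rightarrow> real \<Rightarrow> (vfield \<Rightarrow> vfield) \<Rightarrow> bool" where
  "isomorphism_onto_pow_dom L \<theta> Q \<longleftrightarrow>
     linear_in_H L Q \<and> bij_betw Q (H L) (stokes_pow_dom L \<theta>) \<and>
     (\<exists>K>0. \<forall>x\<in>H L. hnorm L (stokes_pow L \<theta> (Q x)) \<le> K * hnorm L x) \<and>
     (\<exists>K>0. \<forall>x\<in>H L. hnorm L x \<le> K * hnorm L (stokes_pow L \<theta> (Q x)))"

text \<open>Centred normal law of variance \<open>v\<close>, including the degenerate case \<open>v = 0\<close>.\<close>

definition centered_normal :: "'a measure \<Rightarrow> ('a \<Rightarrow> real) \<Rightarrow> real \<Rightarrow> bool" where
  "centered_normal M X v \<longleftrightarrow> X \<in> borel_measurable M \<and>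
     (if v = 0 then AE \<omega> in M. X \<omega> = 0 else distributed M lborel X (normal_density 0 (sqrt v)))"

definition wiener_process ::
    "real \<Rightarrow> 'a measure \<Rightarrow> (real \<Rightarrow> 'a measure) \<Rightarrow> (vfield \<Rightarrow> vfield) \<Rightarrow> (real \<Rightarrow> 'a \<Rightarrow> vfield) \<Rightarrow> bool" where
  "wiener_process L M F C w \<longleftrightarrow>
     (\<forall>t\<ge>0. w t \<in> measurable (F t) (borelH L)) \<and>
     (AE \<omega> in M. w 0 \<omega> = 0) \<and>
     (AE \<omega> in M. continuous_map (top_of_set {0..}) (H_topology L) (\<lambda>t. w t \<omega>)) \<and>
     (\<forall>s\<ge>0. \<forall>t>s.
        prob_space.indep_set M (sets (F s))
          (sets (vimage_algebra (space M) (\<lambda>\<omega>. w t \<omega> - w s \<omega>) (borelH L))) \<and>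
        (\<forall>h\<in>H L. centered_normal M (\<lambda>\<omega>. hinner L (w t \<omega> - w s \<omega>) h) ((t - s) * hinner L (C h) h)))"

text \<open>
  Only \<open>F t\<close> with \<open>t \<ge> 0\<close> is ever used; a filtration indexed by \<open>[0,\<infinity>)\<close> is put into the form
  required by the library by setting \<open>F t = F 0\<close> for \<open>t < 0\<close>.
\<close>

definition filtered_prob_space :: "'a measure \<Rightarrow> (real \<Rightarrow> 'a measure) \<Rightarrow> bool" where
  "filtered_prob_space M F \<longleftrightarrow> prob_space M \<and> filtration (space M) F \<and> (\<forall>t. subalgebra M (F t))"

section \<open>The stochastic Navier-Stokes equation and its invariant measure\<close>

definition navier_stokes_solution ::
    "real \<Rightarrow> 'a measure \<Rightarrow> (real \<Rightarrow> 'a measure) \<Rightarrow> (real \<Rightarrow> 'a \<Rightarrow> vfield) \<Rightarrow> real \<Rightarrow> vfield \<Rightarrow>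
     (real \<Rightarrow> 'a \<Rightarrow> vfield) \<Rightarrow> bool" where
  "navier_stokes_solution L M F w \<epsilon> x u \<longleftrightarrow>
     (\<forall>t\<ge>0. u t \<in> measurable (F t) (borelH L)) \<and>
     (AE \<omega> in M.
        continuous_map (top_of_set {0..}) (H_topology L) (\<lambda>t. u t \<omega>) \<and>
        (\<forall>T>0. (AE t in lborel. t \<in> {0..T} \<longrightarrow> u t \<omega> \<in> V L) \<and>
               set_integrable lborel {0..T} (\<lambda>t. (hnorm L (stokes_pow L (1/2) (u t \<omega>)))\<^sup>2)) \<and>
        (\<forall>t\<ge>0. \<forall>\<phi>\<in>stokes_dom L.
           hinner L (u t \<omega>) \<phi> + (LINT s:{0..t}|lborel. hinner L (u s \<omega>) (stokes L \<phi>))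
             - (LINT s:{0..t}|lborel. tri L (u s \<omega>) \<phi> (u s \<omega>))
           = hinner L x \<phi> + sqrt \<epsilon> * hinner L (w t \<omega>) \<phi>))"

definition invariant_measure ::
    "real \<Rightarrow> 'a measure \<Rightarrow> (vfield \<Rightarrow> real \<Rightarrow> 'a \<Rightarrow> vfield) \<Rightarrow> vfield measure \<Rightarrow> bool" where
  "invariant_measure L M u \<nu> \<longleftrightarrow> prob_space \<nu> \<and> sets \<nu> = sets (borelH L) \<and>
     (\<forall>\<phi>. continuous_map (H_topology L) euclideanreal \<phi> \<and> bounded (\<phi> ` H L) \<longrightarrow>
        (\<forall>t\<ge>0. (LINT x|\<nu>. LINT \<omega>|M. \<phi> (u x t \<omega>)) = (LINT x|\<nu>. \<phi> x)))"

definition unique_invariant_measure ::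
    "real \<Rightarrow> 'a measure \<Rightarrow> (vfield \<Rightarrow> real \<Rightarrow> 'a \<Rightarrow> vfield) \<Rightarrow> vfield measure \<Rightarrow> bool" where
  "unique_invariant_measure L M u \<nu> \<longleftrightarrow>
     invariant_measure L M u \<nu> \<and> (\<forall>\<nu>'. invariant_measure L M u \<nu>' \<longrightarrow> \<nu>' = \<nu>)"

end

theory Submission
  imports Defs
begin

text \<open>
  The heart of the matter is the bound
  \<open>E exp (\<lambda>/\<epsilon> |u(T)|\<^sup>2) \<le> exp (\<lambda>/\<epsilon> (exp (- \<mu>\<^sub>1 T) |x|\<^sup>2 + \<epsilon> Tr C / \<mu>\<^sub>1))\<close> for the solution started at \<open>x\<close>, where
  \<open>\<mu>\<^sub>1\<close> is the least eigenvalue of \<open>A\<close> and \<open>\<lambda> = \<mu>\<^sub>1 / (2 |Q|\<^sup>2)\<close>.  Integrating the bounded function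
  \<open>min 1 (exp (\<lambda>/\<epsilon> (|v|\<^sup>2 - R\<^sup>2)))\<close> against the invariant measure and letting \<open>T \<rightarrow> \<infinity>\<close> gives the tail estimate.

  The moment bound is proved without stochastic integration.  The Galerkin coefficients of the solution
  are continuous processes with continuous drift and Brownian noise, so that the discrete sums
  \<open>\<Sum> exp (- \<mu>\<^sub>1 (T - t\<^sub>i)) (2 X\<^sub>i \<Delta>B\<^sub>i + \<Delta>B\<^sub>i\<^sup>2)\<close> converge pathwise to the quantity that Ito's formula predicts.
  Independence of the increments makes the exponential of the first part, suitably compensated, a
  supermartingale; the second part converges to the trace in mean square.  Fatou's lemma passes to the
  limit, first in the mesh, then in the Galerkin truncation.  In the latter limit the energy transferred
  by the nonlinear term disappears, by Ladyzhenskaya's inequality.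
\<close>

section \<open>Integration by parts on the torus\<close>

text \<open>The obstacle is that a solution is known only as a path, continuous in H and square
  integrable in V, that satisfies the tested equation. For a truncation y of u to finitely many
  modes the energy balance does not close: the quadratic term leaves the residue b(u, y, u - y). It
  is at most 3 |u|_V^2 (|u| |u - y|)^(1/2). This is integrable in time with exactly the regularity
  available, and it tends to 0. The exponent \<open>mu1 / (2 * q^2)\<close> comes from spending the
  dissipation twice. By Poincare's inequality it is at least 2 mu1 |y|^2: one half pays for the
  derivative of the weight exp (- mu1 (T - s)), the other half for the compensator of the
  exponential supermartingale. What remains is the trace, multiplied by the integral of the weight,
  which is at most 1 / mu1 for every T; hence the bound survives T -> infinity. No moment of the
  invariant measure is known beforehand: the cut-off at 1 makes invariance applicable and also
  supplies the dominating function. Since \<epsilon> \<le> 1, the trace is absorbed by a radius that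
  does not depend on \<epsilon>.\<close>

definition vec2 :: "real \<Rightarrow> real \<Rightarrow> real^2" where
  "vec2 a b = (\<chi> i. if i = 1 then a else b)"

lemma vec2_nth [simp]: "vec2 a b $ 1 = a" "vec2 a b $ 2 = b"
  by (simp_all add: vec2_def)

lemma vec2_conv_axis: "vec2 a b = a *\<^sub>R axis 1 1 + b *\<^sub>R axis 2 1"
  by (simp add: vec_eq_iff forall_2 axis_def)

lemma inner_vec2: "vec2 a b \<bullet> x = a * x $ 1 + b * x $ 2"
  by (simp add: inner_vec_def sum_2)

lemma continuous_on_vec2 [continuous_intros]:
  "continuous_on S f \<Longrightarrow> continuous_on S g \<Longrightarrow> continuous_on S (\<lambda>x. vec2 (f x) (g x))"
  unfolding vec2_conv_axis by (intro continuous_intros)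

lemma vec2_measurable [measurable]: "(\<lambda>p. vec2 (fst p) (snd p)) \<in> borel \<rightarrow>\<^sub>M borel"
  by (intro borel_measurable_continuous_onI continuous_intros)

text \<open>Lebesgue measure is determined by its values on boxes, so the plane may be treated as a
  product space. Fubini and Tonelli on the cell both enter through this identity.\<close>

lemma lborel_vec2: "distr (lborel \<Otimes>\<^sub>M lborel) borel (\<lambda>p. vec2 (fst p) (snd p)) = lborel"
proof (rule lborel_eqI[symmetric])
  fix l u :: "real^2"
  assume le: "\<And>b. b \<in> Basis \<Longrightarrow> l \<bullet> b \<le> u \<bullet> b"
  then have le': "l $ i \<le> u $ i" for i
    using le[of "axis i 1"] by (auto simp: axis_in_Basis_iff inner_axis)
  have m: "(\<lambda>p. vec2 (fst p) (snd p)) \<in> lborel \<Otimes>\<^sub>M lborel \<rightarrow>\<^sub>M borel"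
    by (simp add: lborel_prod)
  have "(\<lambda>p. vec2 (fst p) (snd p)) -` box l u \<inter> space (lborel \<Otimes>\<^sub>M lborel) =
      {l$1<..<u$1} \<times> {l$2<..<u$2}"
    by (auto simp: mem_box_cart forall_2 space_pair_measure)
  then have "emeasure (distr (lborel \<Otimes>\<^sub>M lborel) borel (\<lambda>p. vec2 (fst p) (snd p))) (box l u)
      = ennreal ((u$1 - l$1) * (u$2 - l$2))"
    using le' by (subst emeasure_distr[OF m])
      (auto simp: lborel.emeasure_pair_measure_Times ennreal_mult)
  also have "(u$1 - l$1) * (u$2 - l$2) = (\<Prod>b\<in>Basis. (u - l) \<bullet> b)"
    by (simp add: Basis_vec_def UNIV_2 inner_axis axis_eq_axis)
  finally show "emeasure (distr (lborel \<Otimes>\<^sub>M lborel) borel (\<lambda>p. vec2 (fst p) (snd p))) (box l u)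
      = (\<Prod>b\<in>Basis. (u - l) \<bullet> b)" .
qed simp

section \<open>Iterated integrals over the period cell\<close>

lemma cell_sets [measurable]: "cell L \<in> sets borel"
  by (simp add: cell_def)

lemma compact_cell: "compact (cell L)"
  by (simp add: cell_def)

lemma vec2_in_cell: "vec2 a b \<in> cell L \<longleftrightarrow> a \<in> {0..L} \<and> b \<in> {0..L}"
  by (auto simp: cell_def mem_box_cart forall_2)

lemma nn_integral_cell:
  assumes [measurable]: "f \<in> borel_measurable borel"
  shows "(\<integral>\<^sup>+x\<in>cell L. f x \<partial>lborel) = (\<integral>\<^sup>+a\<in>{0..L}. (\<integral>\<^sup>+b\<in>{0..L}. f (vec2 a b) \<partial>lborel) \<partial>lborel)"
    and "(\<integral>\<^sup>+x\<in>cell L. f x \<partial>lborel) = (\<integral>\<^sup>+b\<in>{0..L}. (\<integral>\<^sup>+a\<in>{0..L}. f (vec2 a b) \<partial>lborel) \<partial>lborel)"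
proof -
  have m: "(\<lambda>p. vec2 (fst p) (snd p)) \<in> lborel \<Otimes>\<^sub>M lborel \<rightarrow>\<^sub>M borel"
    by (simp add: lborel_prod)
  let ?g = "\<lambda>p. f (vec2 (fst p) (snd p)) * indicator {0..L} (fst p) * indicator {0..L} (snd p)"
  have ind: "indicator (cell L) (vec2 a b) = (indicator {0..L} a * indicator {0..L} b :: ennreal)" for a b
    by (auto simp: indicator_def vec2_in_cell)
  have [measurable]: "(\<lambda>p. f (vec2 (fst p) (snd p))) \<in> borel_measurable (lborel \<Otimes>\<^sub>M lborel)"
    using m by measurable
  have mg: "?g \<in> borel_measurable (lborel \<Otimes>\<^sub>M lborel)" by measurable
  have "(\<integral>\<^sup>+x\<in>cell L. f x \<partial>lborel) = (\<integral>\<^sup>+p. ?g p \<partial>(lborel \<Otimes>\<^sub>M lborel))"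
    by (subst lborel_vec2[symmetric], subst nn_integral_distr[OF m])
       (auto simp: ind mult.assoc intro!: nn_integral_cong)
  also have "\<dots> = (\<integral>\<^sup>+a. \<integral>\<^sup>+b. ?g (a,b) \<partial>lborel \<partial>lborel)"
    by (rule lborel.nn_integral_fst[symmetric, OF mg])
  finally show "(\<integral>\<^sup>+x\<in>cell L. f x \<partial>lborel) = (\<integral>\<^sup>+a\<in>{0..L}. (\<integral>\<^sup>+b\<in>{0..L}. f (vec2 a b) \<partial>lborel) \<partial>lborel)"
    by (auto simp: indicator_def intro!: nn_integral_cong)
  have "(\<integral>\<^sup>+x\<in>cell L. f x \<partial>lborel) = (\<integral>\<^sup>+p. ?g p \<partial>(lborel \<Otimes>\<^sub>M lborel))"
    by (subst lborel_vec2[symmetric], subst nn_integral_distr[OF m])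
       (auto simp: ind mult.assoc intro!: nn_integral_cong)
  also have "\<dots> = (\<integral>\<^sup>+b. \<integral>\<^sup>+a. ?g (a,b) \<partial>lborel \<partial>lborel)"
    by (rule lborel_pair.nn_integral_snd[symmetric, OF mg])
  finally show "(\<integral>\<^sup>+x\<in>cell L. f x \<partial>lborel) = (\<integral>\<^sup>+b\<in>{0..L}. (\<integral>\<^sup>+a\<in>{0..L}. f (vec2 a b) \<partial>lborel) \<partial>lborel)"
    by (auto simp: indicator_def intro!: nn_integral_cong)
qed

text \<open>Both orders of iteration are kept because a derivative along one axis has to be
  integrated along that axis first.\<close>

lemma set_integral_cell:
  fixes f :: "real^2 \<Rightarrow> real"
  assumes [measurable]: "f \<in> borel_measurable borel" and i: "set_integrable lborel (cell L) f"
  shows "(LINT x:cell L|lborel. f x) = (LINT a:{0..L}|lborel. LINT b:{0..L}|lborel. f (vec2 a b))"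
    and "(LINT x:cell L|lborel. f x) = (LINT b:{0..L}|lborel. LINT a:{0..L}|lborel. f (vec2 a b))"
proof -
  have m: "(\<lambda>p. vec2 (fst p) (snd p)) \<in> lborel \<Otimes>\<^sub>M lborel \<rightarrow>\<^sub>M borel"
    by (simp add: lborel_prod)
  let ?g = "\<lambda>p. (indicator {0..L} (fst p) * indicator {0..L} (snd p)) *\<^sub>R f (vec2 (fst p) (snd p))"
  have ind: "indicator (cell L) (vec2 a b) = (indicator {0..L} a * indicator {0..L} b :: real)" for a b
    by (auto simp: indicator_def vec2_in_cell)
  have int: "integrable (lborel \<Otimes>\<^sub>M lborel) ?g"
    using i unfolding set_integrable_def
    by (subst (asm) lborel_vec2[symmetric], subst (asm) integrable_distr_eq[OF m]) (auto simp: ind)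
  have eq: "(LINT x:cell L|lborel. f x) = (LINT p|(lborel \<Otimes>\<^sub>M lborel). ?g p)"
    unfolding set_lebesgue_integral_def
    by (subst lborel_vec2[symmetric], subst integral_distr[OF m]) (auto simp: ind)
  show "(LINT x:cell L|lborel. f x) = (LINT a:{0..L}|lborel. LINT b:{0..L}|lborel. f (vec2 a b))"
    unfolding eq lborel_pair.integral_fst'[symmetric, OF int]
    by (simp add: mult.assoc set_lebesgue_integral_def)
  have "(LINT p|(lborel \<Otimes>\<^sub>M lborel). ?g p) = (LINT b|lborel. LINT a|lborel. ?g (a,b))"
    using lborel_pair.integral_snd[of "\<lambda>a b. ?g (a,b)"] int by (simp only: case_prod_unfold prod.collapse fst_conv snd_conv)
  then show "(LINT x:cell L|lborel. f x) = (LINT b:{0..L}|lborel. LINT a:{0..L}|lborel. f (vec2 a b))"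
    unfolding eq by (simp add: mult.left_commute mult.assoc set_lebesgue_integral_def)
qed

lemma set_integrable_cell:
  fixes f :: "real^2 \<Rightarrow> 'b::{banach, second_countable_topology}"
  assumes "continuous_on UNIV f"
  shows "set_integrable lborel (cell L) f"
  unfolding set_integrable_def
  by (rule borel_integrable_compact[OF compact_cell]) (rule continuous_on_subset[OF assms subset_UNIV])

section \<open>Partial derivatives and the fundamental theorem of calculus along an axis\<close>

lemma pdiff_eq: "(f has_derivative f') (at x) \<Longrightarrow> pdiff i f x = f' (axis i 1)"
  by (simp add: pdiff_def frechet_derivative_at[symmetric])

lemma pdiff_has_real_derivative:
  assumes "f differentiable (at (x + t *\<^sub>R axis i 1))"
  shows "((\<lambda>s. f (x + s *\<^sub>R axis i 1)) has_real_derivative pdiff i f (x + t *\<^sub>R axis i 1)) (at t)"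
proof -
  let ?x = "x + t *\<^sub>R axis i 1"
  from assms obtain f' where f': "(f has_derivative f') (at ?x)"
    unfolding differentiable_def by blast
  have "((\<lambda>s. x + s *\<^sub>R axis i (1::real)) has_derivative (\<lambda>s. s *\<^sub>R axis i 1)) (at t)"
    by (auto intro!: derivative_eq_intros)
  from has_derivative_compose[OF this f']
  have "((\<lambda>s. f (x + s *\<^sub>R axis i 1)) has_derivative (\<lambda>s. f' (s *\<^sub>R axis i 1))) (at t)" .
  moreover have "f' (s *\<^sub>R axis i 1) = pdiff i f ?x * s" for s
    using f' linear_cmul[OF has_derivative_linear[OF f']] by (simp add: pdiff_eq[OF f'])
  ultimately show ?thesis by (simp add: has_field_derivative_def)
qed

lemma set_integral_FTC_pdiff:
  assumes "\<And>x. f differentiable (at x)" "continuous_on UNIV (pdiff i f)" "a \<le> b"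
  shows "(LINT t:{a..b}|lborel. pdiff i f (x + t *\<^sub>R axis i 1)) = f (x + b *\<^sub>R axis i 1) - f (x + a *\<^sub>R axis i 1)"
proof -
  have "continuous_on UNIV (\<lambda>t. pdiff i f (x + t *\<^sub>R axis i 1))"
    by (intro continuous_on_compose2[OF assms(2)] continuous_intros) auto
  then show ?thesis
    using integral_FTC_Icc_real[OF assms(3), of "\<lambda>t. f (x + t *\<^sub>R axis i 1)" "\<lambda>t. pdiff i f (x + t *\<^sub>R axis i 1)"]
      pdiff_has_real_derivative[OF assms(1)]
    by (simp add: set_lebesgue_integral_def mult.commute continuous_on_eq_continuous_at)
qed

definition periodic_fun :: "real \<Rightarrow> (real^2 \<Rightarrow> 'b) \<Rightarrow> bool" where
  "periodic_fun L f \<longleftrightarrow> (\<forall>i x. f (x + L *\<^sub>R axis i 1) = f x)"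

text \<open>Integrating first along axis \<open>i\<close> leaves the difference of \<open>f\<close>
  between two opposite faces of the cell, and periodicity makes it vanish.\<close>

lemma integral_cell_pdiff:
  assumes L: "L > 0" and d: "\<And>x. f differentiable (at x)" and c: "continuous_on UNIV (pdiff i f)"
    and p: "periodic_fun L f"
  shows "(LINT x:cell L|lborel. pdiff i f x) = 0"
proof -
  have [measurable]: "pdiff i f \<in> borel_measurable borel" using c by (rule borel_measurable_continuous_onI)
  have 1: "vec2 a b = vec2 a 0 + b *\<^sub>R axis 2 1" "vec2 a b = vec2 0 b + a *\<^sub>R axis 1 1" for a b
    by (simp_all add: vec2_conv_axis)
  have P: "f (x + L *\<^sub>R axis i 1) - f x = 0" for x i using p by (simp add: periodic_fun_def)
  have "i = 1 \<or> i = 2" using exhaust_2 by blast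
  then show ?thesis
  proof
    assume i: "i = 1"
    have "(LINT a:{0..L}|lborel. pdiff i f (vec2 a b)) = 0" for b
      using set_integral_FTC_pdiff[OF d c, of 0 L "vec2 0 b"] L P
      by (subst 1(2)) (simp add: i)
    then show ?thesis by (subst set_integral_cell(2)) (auto intro: set_integrable_cell c)
  next
    assume i: "i = 2"
    have "(LINT b:{0..L}|lborel. pdiff i f (vec2 a b)) = 0" for a
      using set_integral_FTC_pdiff[OF d c, of 0 L "vec2 a 0"] L P
      by (subst 1(1)) (simp add: i)
    then show ?thesis by (subst set_integral_cell(1)) (auto intro: set_integrable_cell c)
  qed
qed

section \<open>Algebra of test functions and integration by parts\<close>

lemma pdiff_mult:
  assumes "f differentiable (at x)" "g differentiable (at x)"
  shows "pdiff i (\<lambda>x. f x * g x) x = f x * pdiff i g x + pdiff i f x * g x"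
  using assms unfolding differentiable_def
  by (auto simp: pdiff_eq intro!: pdiff_eq[OF has_derivative_mult, THEN trans])

lemma pdiff_add:
  assumes "f differentiable (at x)" "g differentiable (at x)"
  shows "pdiff i (\<lambda>x. f x + g x) x = pdiff i f x + pdiff i g x"
  using assms unfolding differentiable_def
  by (auto simp: pdiff_eq intro!: pdiff_eq[OF has_derivative_add, THEN trans])

lemma pdiff_cmult:
  assumes "f differentiable (at x)"
  shows "pdiff i (\<lambda>x. c * f x) x = c * pdiff i f x"
  using assms unfolding differentiable_def
  by (auto simp: pdiff_eq intro!: pdiff_eq[OF has_derivative_mult_right, THEN trans])

lemma times_differentiable_const: "times_differentiable n (\<lambda>_. c)"
proof (induction n arbitrary: c)
  case (Suc n)
  have "pdiff i (\<lambda>_. c) = (\<lambda>_. 0)" for i by (rule ext, rule pdiff_eq) (rule has_derivative_const)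
  then show ?case using Suc by simp
qed simp

lemma times_differentiable_add:
  "times_differentiable n f \<Longrightarrow> times_differentiable n g \<Longrightarrow> times_differentiable n (\<lambda>x. f x + g x)"
proof (induction n arbitrary: f g)
  case (Suc n)
  then have "pdiff i (\<lambda>x. f x + g x) = (\<lambda>x. pdiff i f x + pdiff i g x)" for i
    by (intro ext pdiff_add) auto
  then show ?case using Suc by (auto intro: derivative_intros)
qed (auto intro: continuous_intros)

lemma times_differentiable_cmult:
  "times_differentiable n f \<Longrightarrow> times_differentiable n (\<lambda>x. c * f x)"
proof (induction n arbitrary: f)
  case (Suc n)
  then have "pdiff i (\<lambda>x. c * f x) = (\<lambda>x. c * pdiff i f x)" for i
    by (intro ext pdiff_cmult) auto
  then show ?case using Suc by (auto intro: derivative_intros)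
qed (auto intro: continuous_intros)

lemma test_functions_add:
  "f \<in> test_functions L \<Longrightarrow> g \<in> test_functions L \<Longrightarrow> (\<lambda>x. f x + g x) \<in> test_functions L"
  by (auto simp: test_functions_def intro: times_differentiable_add)

lemma test_functions_cmult: "f \<in> test_functions L \<Longrightarrow> (\<lambda>x. c * f x) \<in> test_functions L"
  by (auto simp: test_functions_def intro: times_differentiable_cmult)

lemma test_functions_const: "(\<lambda>_. c) \<in> test_functions L"
  by (auto simp: test_functions_def times_differentiable_const)

lemma test_functions_sum:
  "(\<And>k. k \<in> K \<Longrightarrow> f k \<in> test_functions L) \<Longrightarrow> (\<lambda>x. \<Sum>k\<in>K. f k x) \<in> test_functions L"
  by (induction K rule: infinite_finite_induct) (auto intro: test_functions_add test_functions_const)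

lemma test_functionD:
  assumes "f \<in> test_functions L"
  shows "f differentiable (at x)" "continuous_on UNIV f" "continuous_on UNIV (pdiff i f)" "periodic_fun L f"
proof -
  have "times_differentiable (Suc 0) f" "times_differentiable 0 f"
    using assms by (auto simp: test_functions_def)
  then show "f differentiable (at x)" "continuous_on UNIV f" "continuous_on UNIV (pdiff i f)" by auto
  show "periodic_fun L f" using assms by (auto simp: test_functions_def periodic_fun_def)
qed

lemma integration_by_parts:
  assumes L: "L > 0" and f: "f \<in> test_functions L" and g: "g \<in> test_functions L"
  shows "(LINT x:cell L|lborel. pdiff i f x * g x) = - (LINT x:cell L|lborel. f x * pdiff i g x)"
proof -
  note f = test_functionD[OF f] and g = test_functionD[OF g]
  have pd: "pdiff i (\<lambda>x. f x * g x) = (\<lambda>x. f x * pdiff i g x + pdiff i f x * g x)"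
    by (intro ext pdiff_mult f g)
  have "(LINT x:cell L|lborel. f x * pdiff i g x + pdiff i f x * g x) = 0"
    unfolding pd[symmetric] using L
  proof (rule integral_cell_pdiff)
    show "continuous_on UNIV (pdiff i (\<lambda>x. f x * g x))"
      unfolding pd by (intro continuous_intros f g)
    show "periodic_fun L (\<lambda>x. f x * g x)"
      using f(4) g(4) by (simp add: periodic_fun_def)
    show "(\<lambda>x. f x * g x) differentiable (at x)" for x
      using f(1) g(1) by (rule differentiable_mult)
  qed
  then show ?thesis
    by (subst (asm) set_integral_add(2)) (auto intro!: set_integrable_cell continuous_intros f g)
qed

section \<open>The Hartley basis\<close>

text \<open>
  The functions \<open>x \<mapsto> cas (\<kappa>\<^sub>k \<bullet> x)\<close>, \<open>k \<in> \<int>\<^sup>2\<close>, form a real orthogonal basis of \<open>L\<^sup>2\<close> of the torus, so that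
  no choice between a sine and a cosine has to be made.
\<close>

definition cas :: "real \<Rightarrow> real" where
  "cas t = cos t + sin t"

text \<open>This takes the place of the product rule for complex exponentials: the span of the modes
  is an algebra. Orthogonality and the Stone-Weierstrass argument both rest on it.\<close>

lemma cas_mult: "cas a * cas b = (cas (a - b) + cas (b - a) + cas (a + b) - cas (- (a + b))) / 2"
  using cos_minus[of "a - b"] sin_minus[of "a - b"]
  by (simp add: cas_def cos_add cos_diff sin_add sin_diff algebra_simps)

lemma abs_cas_le: "\<bar>cas t\<bar> \<le> 2"
  using abs_cos_le_one[of t] abs_sin_le_one[of t] unfolding cas_def by linarith

locale torus =
  fixes L :: real
  assumes L_pos: "L > 0"
begin

definition freq :: "int \<times> int \<Rightarrow> real^2" where
  "freq k = (2 * pi / L) *\<^sub>R vec2 (of_int (fst k)) (of_int (snd k))"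

definition trig :: "int \<times> int \<Rightarrow> real^2 \<Rightarrow> real" where
  "trig k x = cas (freq k \<bullet> x)"

lemma freq_zero [simp]: "freq 0 = 0"
  by (simp add: freq_def vec_eq_iff forall_2)

lemma freq_add: "freq (k + l) = freq k + freq l"
  by (simp add: freq_def vec_eq_iff forall_2 algebra_simps add_divide_distrib)

lemma freq_minus: "freq (- k) = - freq k"
  by (simp add: freq_def vec_eq_iff forall_2)

lemma freq_diff: "freq (k - l) = freq k - freq l"
  using freq_add[of k "- l"] by (simp add: freq_minus)

lemma freq_eq_0_iff [simp]: "freq k = 0 \<longleftrightarrow> k = 0"
  using L_pos by (cases k) (auto simp: freq_def vec_eq_iff forall_2 zero_prod_def)

lemma trig_zero [simp]: "trig 0 x = 1"
  by (simp add: trig_def cas_def)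

lemma trig_mult: "trig k x * trig l x = (trig (k - l) x + trig (l - k) x + trig (k + l) x - trig (- (k + l)) x) / 2"
  unfolding trig_def freq_add freq_minus freq_diff inner_add_left inner_diff_left inner_minus_left
  by (rule cas_mult)

text \<open>The derivative of cos + sin is cos - sin, which is \<open>cas\<close> at the reflected
  argument. So differentiation sends mode \<open>k\<close> to mode \<open>- k\<close>, and no second
  family of functions appears.\<close>

lemma trig_has_derivative: "(trig k has_derivative (\<lambda>h. trig (- k) x * (freq k \<bullet> h))) (at x)"
  unfolding trig_def cas_def freq_minus
  by (auto intro!: derivative_eq_intros simp: algebra_simps)

lemma pdiff_trig: "pdiff i (trig k) = (\<lambda>x. freq k $ i * trig (- k) x)"
  by (rule ext, subst pdiff_eq[OF trig_has_derivative]) (simp add: inner_axis)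

lemma times_differentiable_trig: "times_differentiable n (trig k)"
proof (induction n arbitrary: k)
  case 0 then show ?case unfolding trig_def cas_def by (auto intro!: continuous_intros)
next
  case (Suc n) then show ?case
    using trig_has_derivative[of k] unfolding times_differentiable.simps pdiff_trig differentiable_def
    by (blast intro: times_differentiable_cmult)
qed

lemma trig_periodic: "trig k (x + L *\<^sub>R axis i 1) = trig k x"
proof -
  have "\<exists>m::int. freq k \<bullet> (L *\<^sub>R axis i 1) = 2 * pi * of_int m"
    using L_pos exhaust_2[of i] by (auto simp: freq_def inner_axis)
  then obtain m :: int where m: "freq k \<bullet> (L *\<^sub>R axis i 1) = 2 * pi * of_int m" by blast
  have "cos (t + 2 * pi * of_int m) = cos t" "sin (t + 2 * pi * of_int m) = sin t" for t
    by (simp_all add: cos_add sin_add)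
  then show ?thesis unfolding trig_def inner_add_right m by (simp add: cas_def)
qed

lemma trig_test_function: "trig k \<in> test_functions L"
  by (auto simp: test_functions_def times_differentiable_trig trig_periodic)

lemma trig_continuous: "continuous_on UNIV (trig k)"
  by (rule test_functionD[OF trig_test_function])

lemma trig_measurable [measurable]: "trig k \<in> borel_measurable borel"
  by (rule borel_measurable_continuous_onI[OF trig_continuous])

lemma abs_trig_le: "\<bar>trig k x\<bar> \<le> 2"
  by (simp add: trig_def abs_cas_le)

lemma measure_cell: "measure lborel (cell L) = L\<^sup>2"
  using L_pos unfolding cell_def
  by (subst content_cbox') (auto simp: Basis_vec_def UNIV_2 inner_axis axis_eq_axis power2_eq_square box_eq_empty)

lemma emeasure_cell: "emeasure lborel (cell L) < \<infinity>"
  unfolding cell_def by (rule emeasure_lborel_cbox_finite)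

lemma integral_trig: "(LINT x:cell L|lborel. trig k x) = (if k = 0 then L\<^sup>2 else 0)"
proof (cases "k = 0")
  case True then show ?thesis
    using measure_cell emeasure_cell by (simp add: set_lebesgue_integral_def)
next
  case False
  \<comment> \<open>Along a direction in which the wave vector does not vanish,
    \<open>trig k\<close> is a multiple of a derivative of \<open>trig (- k)\<close>, and such a
    derivative integrates to 0.\<close>
  then obtain i where i: "freq k $ i \<noteq> 0" using freq_eq_0_iff[of k] by (auto simp: vec_eq_iff)
  note t = test_functionD[OF trig_test_function]
  have "(LINT x:cell L|lborel. pdiff i (trig (- k)) x) = 0"
    by (rule integral_cell_pdiff[OF L_pos t(1) t(3) t(4)])
  moreover have "pdiff i (trig (- k)) = (\<lambda>x. (- freq k $ i) * trig k x)"
    by (simp add: pdiff_trig freq_minus)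
  ultimately have "- freq k $ i * (LINT x:cell L|lborel. trig k x) = 0"
    by (simp only: set_integral_mult_right)
  then show ?thesis using i False by simp
qed

text \<open>In the product formula the frequencies \<open>k + l\<close> and \<open>- (k + l)\<close>
  carry opposite signs, so their contributions cancel even for \<open>l = - k\<close>. This is why
  \<open>k\<close> and \<open>- k\<close> index orthogonal modes.\<close>

lemma integral_trig_mult: "(LINT x:cell L|lborel. trig k x * trig l x) = (if k = l then L\<^sup>2 else 0)"
proof -
  have i: "set_integrable lborel (cell L) (trig m)" for m by (intro set_integrable_cell trig_continuous)
  have "k - l = 0 \<longleftrightarrow> k = l" "l - k = 0 \<longleftrightarrow> k = l"
    by (auto simp: algebra_simps)
  then show ?thesis
    unfolding trig_mult using i
    by (simp add: set_integral_add set_integral_diff integral_trig del: minus_add_distrib)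
qed

end

section \<open>Completeness of the Hartley basis\<close>

lemma set_integrable_mult_bounded:
  fixes f g :: "'a \<Rightarrow> real"
  assumes f: "set_integrable M A f" and [measurable]: "A \<in> sets M" "f \<in> borel_measurable M" "g \<in> borel_measurable M"
    and B: "\<And>x. \<bar>g x\<bar> \<le> B"
  shows "set_integrable M A (\<lambda>x. f x * g x)"
proof -
  have "integrable M (\<lambda>x. B * (indicat_real A x *\<^sub>R f x))"
    using f by (intro integrable_mult_right) (simp add: set_integrable_def)
  then show ?thesis unfolding set_integrable_def
  proof (rule Bochner_Integration.integrable_bound)
    have "0 \<le> B" using B[of undefined] by linarith
    then have "\<bar>f x\<bar> * \<bar>g x\<bar> \<le> \<bar>f x\<bar> * \<bar>B\<bar>" for x using B[of x] by (intro mult_left_mono) auto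
    then show "AE x in M. norm (indicat_real A x *\<^sub>R (f x * g x)) \<le> norm (B * (indicat_real A x *\<^sub>R f x))"
      by (auto simp: indicator_def abs_mult mult.commute)
  qed measurable
qed

text \<open>The torus embedding used below glues opposite faces of the cell, so completeness is
  first proved on the open box; the faces are null.\<close>

lemma AE_cell_box: "AE x in lborel. x \<in> cell L \<longrightarrow> x \<in> box 0 (\<chi> i. L)"
proof -
  have "box (0::real^2) (\<chi> i. L) \<subseteq> cell L" by (auto simp: cell_def mem_box_cart less_imp_le)
  moreover have "emeasure lborel (cell L) = emeasure lborel (box (0::real^2) (\<chi> i. L))"
    by (simp add: cell_def emeasure_lborel_cbox_eq emeasure_lborel_box_eq)
  moreover have "emeasure lborel (cell L) < \<infinity>"
    unfolding cell_def by (rule emeasure_lborel_cbox_finite)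
  ultimately have "emeasure lborel (cell L - box (0::real^2) (\<chi> i. L)) = 0"
    by (subst emeasure_Diff) (auto simp: cell_def)
  then have "cell L - box (0::real^2) (\<chi> i. L) \<in> null_sets lborel" by (auto simp: cell_def)
  from AE_not_in[OF this] show ?thesis by eventually_elim auto
qed

text \<open>Inner regularity: up to measure \<open>e\<close>, the set where \<open>f\<close> is
  positive is a compact set \<open>T\<close>. The integral of a positive function over
  \<open>T\<close> is 0, so \<open>T\<close> is null and the positive set has measure at most
  \<open>e\<close>.\<close>

lemma AE_le_0_if_integral_compact_0:
  fixes f :: "'a::euclidean_space \<Rightarrow> real"
  assumes [measurable]: "f \<in> borel_measurable borel" and i: "set_integrable lborel A f"
    and A: "bounded A" "A \<in> sets borel"
    and z: "\<And>T. compact T \<Longrightarrow> T \<subseteq> A \<Longrightarrow> (LINT x:T|lborel. f x) = 0"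
  shows "AE x in lborel. x \<in> A \<longrightarrow> f x \<le> 0"
proof -
  note [measurable] = A(2)
  define P where "P = {x \<in> A. f x > 0}"
  have "P = A \<inter> {x \<in> space borel. f x > 0}" by (auto simp: P_def)
  then have P: "P \<in> sets borel" by simp
  have "emeasure lborel P \<le> 0 + ennreal e" if e: "e > 0" for e
  proof -
    obtain T where T: "closed T" "T \<subseteq> P" "P - T \<in> lmeasurable" "emeasure lebesgue (P - T) < ennreal e"
    proof -
      have "P \<in> sets lebesgue" using P by (simp add: sets_completionI_sets)
      from sets_lebesgue_inner_closed[OF this e] show ?thesis using that by blast
    qed
    have TA: "T \<subseteq> A" using T(2) by (auto simp: P_def)
    have "bounded T" using A(1) TA by (rule bounded_subset)
    then have "compact T" using T(1) by (simp add: compact_eq_bounded_closed)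
    have [measurable]: "T \<in> sets borel" using T(1) by simp
    have "set_integrable lborel T f" using i by (rule set_integrable_subset) (simp_all add: TA)
    then have iT: "integrable lborel (\<lambda>x. indicat_real T x *\<^sub>R f x)" by (simp add: set_integrable_def)
    have nT: "AE x in lborel. 0 \<le> indicat_real T x *\<^sub>R f x"
      using T(2) by (intro AE_I2) (auto simp: indicator_def P_def)
    have "(LINT x|lborel. indicat_real T x *\<^sub>R f x) = 0"
      using z[OF \<open>compact T\<close> TA] by (simp add: set_lebesgue_integral_def)
    then have "AE x in lborel. indicat_real T x *\<^sub>R f x = 0"
      using integral_nonneg_eq_0_iff_AE[OF iT nT] by simp
    then have "AE x in lborel. x \<notin> T"
    proof eventually_elim
      case (elim x)
      moreover have "f x > 0" if "x \<in> T" using that T(2) by (auto simp: P_def)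
      ultimately show ?case by (auto simp: indicator_def)
    qed
    then have "emeasure lborel T = 0"
      using AE_iff_null_sets[of T lborel] by auto
    moreover have "emeasure lborel (P - T) < ennreal e"
    proof -
      have "P - T \<in> sets lborel" using P by simp
      then have "emeasure lebesgue (P - T) = emeasure lborel (P - T)" by simp
      then show ?thesis using T(4) by (simp only:)
    qed
    moreover have "emeasure lborel P \<le> emeasure lborel T + emeasure lborel (P - T)"
    proof -
      have "P = T \<union> (P - T)" using T(2) by auto
      then have "emeasure lborel P = emeasure lborel (T \<union> (P - T))" by (rule arg_cong)
      then show ?thesis using emeasure_subadditive[of T lborel "P - T"] P by (simp del: Un_Diff_cancel)
    qed
    ultimately show ?thesis by (metis add.left_neutral less_imp_le order_trans)
  qed
  then have "emeasure lborel P \<le> 0"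
    by (rule ennreal_le_epsilon)
  then have "P \<in> null_sets lborel" using P by auto
  from AE_not_in[OF this] show ?thesis by eventually_elim (auto simp: P_def not_less)
qed

lemma AE_eq_0_if_integral_compact_0:
  fixes f :: "'a::euclidean_space \<Rightarrow> real"
  assumes "f \<in> borel_measurable borel" "set_integrable lborel A f" "bounded A" "A \<in> sets borel"
    and z: "\<And>T. compact T \<Longrightarrow> T \<subseteq> A \<Longrightarrow> (LINT x:T|lborel. f x) = 0"
  shows "AE x in lborel. x \<in> A \<longrightarrow> f x = 0"
proof -
  have "(LINT x:T|lborel. - f x) = 0" if "compact T" "T \<subseteq> A" for T
    using z[OF that] by (simp add: set_lebesgue_integral_def)
  then have "AE x in lborel. x \<in> A \<longrightarrow> - f x \<le> 0"
    using assms by (intro AE_le_0_if_integral_compact_0) (auto simp: set_integrable_def)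
  moreover have "AE x in lborel. x \<in> A \<longrightarrow> f x \<le> 0"
    using assms by (intro AE_le_0_if_integral_compact_0)
  ultimately show ?thesis by eventually_elim auto
qed

context torus begin

inductive trigpoly :: "(real^2 \<Rightarrow> real) \<Rightarrow> bool" where
  trig: "trigpoly (trig k)"
| add: "trigpoly f \<Longrightarrow> trigpoly g \<Longrightarrow> trigpoly (\<lambda>x. f x + g x)"
| cmult: "trigpoly f \<Longrightarrow> trigpoly (\<lambda>x. c * f x)"

lemma trigpoly_trig_mult: "trigpoly (\<lambda>x. trig k x * trig l x)"
proof -
  have "trigpoly (\<lambda>x. ((1/2) * trig (k - l) x + (1/2) * trig (l - k) x) + ((1/2) * trig (k + l) x + (-1/2) * trig (- (k + l)) x))"
    by (intro trigpoly.intros)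
  then show ?thesis by (simp only: trig_mult) (simp add: add_divide_distrib diff_divide_distrib algebra_simps)
qed

lemma trigpoly_mult: "trigpoly f \<Longrightarrow> trigpoly g \<Longrightarrow> trigpoly (\<lambda>x. f x * g x)"
proof (induction arbitrary: g rule: trigpoly.induct)
  case (trig k)
  then show ?case
  proof (induction rule: trigpoly.induct)
    case (trig l) show ?case by (rule trigpoly_trig_mult)
  next
    case (add f g) then show ?case by (auto simp: distrib_left intro: trigpoly.add)
  next
    case (cmult f c) from trigpoly.cmult[OF this(2), of c] show ?case by (simp add: mult.left_commute)
  qed
next
  case (add f h)
  from trigpoly.add[OF add.IH(1)[OF add.prems] add.IH(2)[OF add.prems]]
  show ?case by (simp add: distrib_right)
next
  case (cmult f c)
  from trigpoly.cmult[OF cmult.IH[OF cmult.prems], of c] show ?case by (simp add: mult.assoc)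
qed

text \<open>Realises the torus as a product of two circles inside a Euclidean space, where
  polynomials approximate continuous functions uniformly on compact sets.\<close>

definition torus_embed :: "real^2 \<Rightarrow> complex \<times> complex" where
  "torus_embed x = (cis (freq (1, 0) \<bullet> x), cis (freq (0, 1) \<bullet> x))"

lemma torus_embed_continuous: "continuous_on S torus_embed"
  unfolding torus_embed_def by (intro continuous_intros continuous_on_cis)

lemma torus_embed_in: "torus_embed x \<in> sphere 0 1 \<times> sphere 0 1"
  by (simp add: torus_embed_def)

text \<open>One of the two points has to avoid the glued faces. Then corresponding coordinates
  differ by an integer multiple of \<open>L\<close> that is smaller than \<open>L\<close> in
  absolute value.\<close>

lemma torus_embed_inj:
  assumes x: "x \<in> cell L" and y: "y \<in> box 0 (\<chi> i. L)" and e: "torus_embed x = torus_embed y"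
  shows "x = y"
proof -
  have *: "a = b" if "cis (2 * pi / L * a) = cis (2 * pi / L * b)" "0 \<le> a" "a \<le> L" "0 < b" "b < L" for a b
  proof -
    from that(1) obtain n :: int where n: "2 * pi / L * a = 2 * pi / L * b + 2 * pi * n"
      using sin_cos_eq_iff[of "2 * pi / L * a" "2 * pi / L * b"] by (auto simp: complex_eq_iff)
    have "2 * pi / L * a = 2 * pi / L * (b + L * n)"
      using n L_pos by (simp add: field_simps)
    then have ab: "a = b + L * n" using L_pos pi_gt_zero by (subst (asm) mult_cancel_left) auto
    have "L * of_int n < L * 1" "L * (-1) < L * of_int n" using ab that(2-5) by linarith+
    then have "of_int n < (1::real)" "(-1::real) < of_int n" using L_pos by (simp_all only: mult_less_cancel_left_pos)
    then have "n = 0" by linarith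
    then show ?thesis using ab by simp
  qed
  have "x $ i = y $ i" for i
    using exhaust_2[of i] e x y *[of "x $ i" "y $ i"]
    by (auto simp: torus_embed_def freq_def inner_vec2 cell_def mem_box_cart)
  then show ?thesis by (simp add: vec_eq_iff)
qed

lemma trigpoly_cos_sin: "trigpoly (\<lambda>x. cos (freq k \<bullet> x))" "trigpoly (\<lambda>x. sin (freq k \<bullet> x))"
proof -
  have "trigpoly (\<lambda>x. (1/2) * trig k x + (1/2) * trig (- k) x)"
    "trigpoly (\<lambda>x. (1/2) * trig k x + (-1/2) * trig (- k) x)"
    by (intro trigpoly.intros)+
  then show "trigpoly (\<lambda>x. cos (freq k \<bullet> x))" "trigpoly (\<lambda>x. sin (freq k \<bullet> x))"
    by (simp_all add: trig_def cas_def freq_minus field_simps)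
qed

text \<open>A linear functional is determined by its values on the four real basis vectors of the
  target, which pick out the cosines and sines of the two basic frequencies. Products are covered by
  \<open>trigpoly_mult\<close>.\<close>

lemma trigpoly_polynomial:
  "real_polynomial_function p \<Longrightarrow> trigpoly (\<lambda>x. p (torus_embed x))"
proof (induction rule: real_polynomial_function.induct)
  case (linear f)
  then interpret bounded_linear f .
  have e: "(cis a, cis b) = cos a *\<^sub>R (1, 0) + sin a *\<^sub>R (\<i>, 0) + cos b *\<^sub>R (0, 1) + sin b *\<^sub>R (0, \<i>)" for a b
    by (simp add: complex_eq_iff)
  have "f (torus_embed x) = ((f (1,0) * cos (freq (1,0) \<bullet> x) + f (\<i>,0) * sin (freq (1,0) \<bullet> x)) +
     f (0,1) * cos (freq (0,1) \<bullet> x)) + f (0,\<i>) * sin (freq (0,1) \<bullet> x)" for x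
    unfolding torus_embed_def e by (simp only: add scaleR real_scaleR_def mult.commute)
  then show ?case by (auto intro!: trigpoly.intros trigpoly_cos_sin)
next
  case (const c)
  show ?case using trigpoly.cmult[OF trigpoly.trig[of 0], of c] by simp
qed (auto intro: trigpoly.intros trigpoly_mult)

lemma trigpoly_continuous: "trigpoly g \<Longrightarrow> continuous_on UNIV g"
  by (induction rule: trigpoly.induct) (auto intro!: continuous_intros trig_continuous)

lemma trigpoly_bounded: "trigpoly g \<Longrightarrow> \<exists>B. \<forall>x. \<bar>g x\<bar> \<le> B"
proof (induction rule: trigpoly.induct)
  case (add f g)
  then obtain B C where "\<And>x. \<bar>f x\<bar> \<le> B" "\<And>x. \<bar>g x\<bar> \<le> C" by blast
  then have "\<bar>f x + g x\<bar> \<le> B + C" for x by (meson abs_triangle_ineq add_mono order_trans)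
  then show ?case by blast
next
  case (cmult f c)
  then obtain B where "\<And>x. \<bar>f x\<bar> \<le> B" by blast
  then have "\<bar>c * f x\<bar> \<le> \<bar>c\<bar> * B" for x by (auto simp: abs_mult intro: mult_left_mono)
  then show ?case by blast
qed (auto intro: abs_trig_le)

context
  fixes f :: "real^2 \<Rightarrow> real"
  assumes f_meas [measurable]: "f \<in> borel_measurable borel" and f_int: "set_integrable lborel (cell L) f"
    and f_orth: "\<And>k. (LINT x:cell L|lborel. f x * trig k x) = 0"
begin

lemma integrable_mult_bounded:
  "continuous_on UNIV g \<Longrightarrow> (\<And>x. \<bar>g x\<bar> \<le> B) \<Longrightarrow> set_integrable lborel (cell L) (\<lambda>x. f x * g x)"
  by (rule set_integrable_mult_bounded[OF f_int]) (auto intro: borel_measurable_continuous_onI)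

lemma trigpoly_orth: "trigpoly g \<Longrightarrow> (LINT x:cell L|lborel. f x * g x) = 0"
proof (induction rule: trigpoly.induct)
  case (trig k) then show ?case by (rule f_orth)
next
  case (add g h)
  obtain B C where "\<And>x. \<bar>g x\<bar> \<le> B" "\<And>x. \<bar>h x\<bar> \<le> C" using trigpoly_bounded add by meson
  then have "set_integrable lborel (cell L) (\<lambda>x. f x * g x)" "set_integrable lborel (cell L) (\<lambda>x. f x * h x)"
    using integrable_mult_bounded trigpoly_continuous add by blast+
  then show ?case using add by (simp add: distrib_left set_integral_add)
next
  case (cmult g c) then show ?case by (simp add: mult.left_commute[of _ c])
qed

text \<open>A polynomial close to \<open>g\<close> on the two circles pulls back to a trigonometric
  polynomial, against which \<open>f\<close> integrates to 0. The error is the uniform distance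
  times the L1 norm of \<open>f\<close>.\<close>

lemma continuous_orth:
  assumes g: "continuous_on (sphere 0 1 \<times> sphere 0 1) g"
  shows "(LINT x:cell L|lborel. f x * g (torus_embed x)) = 0"
proof -
  let ?S = "sphere (0::complex) 1 \<times> sphere (0::complex) 1"
  have S: "compact ?S" by (intro compact_Times compact_sphere)
  have gc: "continuous_on UNIV (\<lambda>x. g (torus_embed x))"
    by (rule continuous_on_compose2[OF g torus_embed_continuous]) (use torus_embed_in in blast)
  obtain B where B: "\<And>z. z \<in> ?S \<Longrightarrow> \<bar>g z\<bar> \<le> B"
    using compact_imp_bounded[OF compact_continuous_image[OF g S]] by (auto simp: bounded_iff)
  define N where "N = (LINT x:cell L|lborel. \<bar>f x\<bar>)"
  have N: "0 \<le> N" unfolding N_def set_lebesgue_integral_def by (intro integral_nonneg_AE) auto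
  have "\<bar>LINT x:cell L|lborel. f x * g (torus_embed x)\<bar> \<le> 0 + e" if e: "e > 0" for e
  proof -
    \<comment> \<open>The summand 1 covers the case that \<open>f\<close> has L1 norm 0.\<close>
    have "e / (N + 1) > 0" using e N by simp
    then obtain p where p: "real_polynomial_function p" "\<And>z. z \<in> ?S \<Longrightarrow> \<bar>g z - p z\<bar> < e / (N + 1)"
      using Stone_Weierstrass_real_polynomial_function[OF S g] by metis
    note tp = trigpoly_polynomial[OF p(1)]
    obtain C where C: "\<And>x. \<bar>p (torus_embed x)\<bar> \<le> C" using trigpoly_bounded[OF tp] by blast
    have i1: "set_integrable lborel (cell L) (\<lambda>x. f x * g (torus_embed x))"
      by (rule integrable_mult_bounded[OF gc B[OF torus_embed_in]])
    have i2: "set_integrable lborel (cell L) (\<lambda>x. f x * p (torus_embed x))"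
      using trigpoly_continuous[OF tp] C by (rule integrable_mult_bounded)
    have "(LINT x:cell L|lborel. f x * g (torus_embed x)) =
        (LINT x:cell L|lborel. f x * g (torus_embed x) - f x * p (torus_embed x))"
      using trigpoly_orth[OF tp] by (simp add: set_integral_diff(2)[OF i1 i2])
    also have "\<bar>\<dots>\<bar> \<le> (LINT x:cell L|lborel. \<bar>f x * g (torus_embed x) - f x * p (torus_embed x)\<bar>)"
      using set_integral_norm_bound[OF set_integral_diff(1)[OF i1 i2]] by simp
    also have "\<dots> \<le> (LINT x:cell L|lborel. (e / (N + 1)) * \<bar>f x\<bar>)"
    proof (rule set_integral_mono)
      show "set_integrable lborel (cell L) (\<lambda>x. \<bar>f x * g (torus_embed x) - f x * p (torus_embed x)\<bar>)"
        using set_integral_diff(1)[OF i1 i2] by (rule set_integrable_abs)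
      show "set_integrable lborel (cell L) (\<lambda>x. e / (N + 1) * \<bar>f x\<bar>)"
        using f_int by (intro set_integrable_mult_right set_integrable_abs)
      show "\<bar>f x * g (torus_embed x) - f x * p (torus_embed x)\<bar> \<le> e / (N + 1) * \<bar>f x\<bar>" for x
        using mult_left_mono[OF less_imp_le[OF p(2)[OF torus_embed_in, of x]], of "\<bar>f x\<bar>"]
        by (simp add: right_diff_distrib[symmetric] abs_mult mult.commute)
    qed
    also have "\<dots> = e / (N + 1) * N" by (simp add: N_def)
    also have "\<dots> \<le> e" using e N by (simp add: field_simps)
    finally show ?thesis by simp
  qed
  then have "\<bar>LINT x:cell L|lborel. f x * g (torus_embed x)\<bar> \<le> 0"
    by (rule field_le_epsilon)
  then show ?thesis by simp
qed

text \<open>The indicator of \<open>K\<close> is a pointwise limit of continuous functions on the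
  embedded torus. That \<open>K\<close> lies in the open box ensures that, within the cell, only
  points of \<open>K\<close> are mapped into the image of \<open>K\<close>.\<close>

lemma compact_orth:
  assumes K: "compact K" "K \<subseteq> box 0 (\<chi> i. L)"
  shows "(LINT x:K|lborel. f x) = 0"
proof (cases "K = {}")
  case True then show ?thesis by (simp add: set_lebesgue_integral_def)
next
  case False
  let ?K = "torus_embed ` K"
  have cK: "closed ?K" "?K \<noteq> {}"
    using compact_continuous_image[OF torus_embed_continuous K(1)] False by (auto intro: compact_imp_closed)
  have [measurable]: "K \<in> sets borel" using K(1) by (simp add: compact_imp_closed)
  have box: "K \<subseteq> cell L" using K(2) by (force simp: cell_def mem_box_cart less_imp_le)
  \<comment> \<open>Functions of height 1 on the image of \<open>K\<close> that fall off with slope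
    \<open>n\<close>; they tend to the indicator because the image is closed.\<close>
  define g where "g n z = max 0 (1 - real n * infdist z ?K)" for n z
  have gc: "continuous_on S (g n)" for n S unfolding g_def by (intro continuous_intros)
  have [measurable]: "(\<lambda>x. g n (torus_embed x)) \<in> borel_measurable borel" for n
    by (intro borel_measurable_continuous_onI continuous_on_compose2[OF gc torus_embed_continuous]) auto
  have lim: "(\<lambda>n. g n z) \<longlonglongrightarrow> indicat_real ?K z" for z
  proof (cases "z \<in> ?K")
    case True then show ?thesis by (simp add: g_def)
  next
    case False
    then have "infdist z ?K > 0" using cK in_closed_iff_infdist_zero[of ?K z] infdist_nonneg[of z ?K] by auto
    then obtain m :: nat where m: "1 < real m * infdist z ?K" using reals_Archimedean3 by blast
    have "1 < real n * infdist z ?K" if "m \<le> n" for n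
      using m mult_right_mono[of "real m" "real n" "infdist z ?K"] that infdist_nonneg[of z ?K] by simp
    then have "\<forall>\<^sub>F n in sequentially. 1 < real n * infdist z ?K"
      by (auto simp: eventually_sequentially)
    then have "\<forall>\<^sub>F n in sequentially. g n z = indicat_real ?K z"
      by eventually_elim (use False in \<open>auto simp: g_def\<close>)
    then show ?thesis by (rule tendsto_eventually)
  qed
  have b: "\<bar>g n z\<bar> \<le> 1" for n z using infdist_nonneg[of z ?K] by (auto simp: g_def)
  have "(\<lambda>n. LINT x:cell L|lborel. f x * g n (torus_embed x)) \<longlonglongrightarrow> (LINT x|lborel. indicat_real (cell L) x * (f x * indicat_real ?K (torus_embed x)))"
    unfolding set_lebesgue_integral_def real_scaleR_def
  proof (rule integral_dominated_convergence)
    show "integrable lborel (\<lambda>x. \<bar>indicat_real (cell L) x * f x\<bar>)"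
      using f_int by (auto simp: set_integrable_def)
    show "AE x in lborel. (\<lambda>n. indicat_real (cell L) x * (f x * g n (torus_embed x)))
        \<longlonglongrightarrow> indicat_real (cell L) x * (f x * indicat_real ?K (torus_embed x))"
      by (intro AE_I2 tendsto_intros lim)
    show "AE x in lborel. norm (indicat_real (cell L) x * (f x * g n (torus_embed x))) \<le> \<bar>indicat_real (cell L) x * f x\<bar>" for n
    proof (rule AE_I2)
      fix x
      have "\<bar>f x\<bar> * \<bar>g n (torus_embed x)\<bar> \<le> \<bar>f x\<bar> * 1" by (intro mult_left_mono b) simp
      then show "norm (indicat_real (cell L) x * (f x * g n (torus_embed x))) \<le> \<bar>indicat_real (cell L) x * f x\<bar>"
        by (simp add: abs_mult indicator_def)
    qed
    have "torus_embed \<in> borel_measurable borel"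
      by (rule borel_measurable_continuous_onI[OF torus_embed_continuous])
    moreover have "indicat_real ?K \<in> borel_measurable borel"
      using cK(1) by (intro borel_measurable_indicator) simp
    ultimately have [measurable]: "(\<lambda>x. indicat_real ?K (torus_embed x)) \<in> borel_measurable borel"
      by (rule measurable_compose)
    show "(\<lambda>x. indicat_real (cell L) x * (f x * indicat_real ?K (torus_embed x))) \<in> borel_measurable lborel"
      by measurable
  qed measurable
  moreover have "(LINT x:cell L|lborel. f x * g n (torus_embed x)) = 0" for n by (rule continuous_orth[OF gc])
  moreover have "indicat_real (cell L) x * (f x * indicat_real ?K (torus_embed x)) = indicat_real K x *\<^sub>R f x" for x
    using torus_embed_inj[of x] K(2) box by (auto simp: indicator_def)
  ultimately show ?thesis
    by (simp add: set_lebesgue_integral_def LIMSEQ_const_iff)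
qed

lemma trig_complete: "AE x in lborel. x \<in> cell L \<longrightarrow> f x = 0"
proof -
  have "set_integrable lborel (box 0 (\<chi> i. L)) f"
    using f_int by (rule set_integrable_subset) (auto simp: cell_def mem_box_cart less_imp_le)
  then have "AE x in lborel. x \<in> box 0 (\<chi> i. L) \<longrightarrow> f x = 0"
    by (intro AE_eq_0_if_integral_compact_0 compact_orth) auto
  with AE_cell_box show ?thesis by eventually_elim auto
qed

end

end

section \<open>The Hilbert space structure of \<open>L\<^sup>2\<close>\<close>

lemma fld_add: "AE x in lborel. fld (u + v) x = fld u x + fld v x"
  using fld_vfield_of[of "\<lambda>x. fld u x + fld v x"] by (simp add: plus_vfield_def)

lemma fld_scaleR: "AE x in lborel. fld (c *\<^sub>R u) x = c *\<^sub>R fld u x"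
  using fld_vfield_of[of "\<lambda>x. c *\<^sub>R fld u x"] by (simp add: scaleR_vfield_def)

lemma fld_zero: "AE x in lborel. fld 0 x = 0"
  using fld_vfield_of[of "\<lambda>_. 0"] by (simp add: zero_vfield_def)

lemma fld_sum: "AE x in lborel. fld (\<Sum>k\<in>K. f k) x = (\<Sum>k\<in>K. fld (f k) x)"
proof (induction K rule: infinite_finite_induct)
  case (insert k K)
  have "AE x in lborel. fld (f k + (\<Sum>k\<in>K. f k)) x = fld (f k) x + fld (\<Sum>k\<in>K. f k) x" by (rule fld_add)
  with insert(3) show ?case using insert(1,2) by (auto elim!: AE_mp)
qed (simp_all add: fld_zero)

lemma set_integral_cong_AE_cell:
  fixes f g :: "real^2 \<Rightarrow> 'b::{banach, second_countable_topology}"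
  assumes [measurable]: "f \<in> borel_measurable borel" "g \<in> borel_measurable borel"
    and "AE x in lborel. f x = g x"
  shows "(LINT x:cell L|lborel. f x) = (LINT x:cell L|lborel. g x)"
  unfolding set_lebesgue_integral_def by (rule integral_cong_AE) (use assms(3) in auto)

lemma hinner_cong_AE:
  assumes [measurable]: "f \<in> borel_measurable borel" "g \<in> borel_measurable borel"
    and "AE x in lborel. fld u x = f x" "AE x in lborel. fld v x = g x"
  shows "hinner L u v = (LINT x:cell L|lborel. f x \<bullet> g x)"
  unfolding hinner_def using assms(3,4) by (intro set_integral_cong_AE_cell) auto

lemma hinner_vfield_of:
  "g \<in> borel_measurable borel \<Longrightarrow> hinner L u (vfield_of g) = (LINT x:cell L|lborel. fld u x \<bullet> g x)"
  by (rule hinner_cong_AE) (auto intro: fld_vfield_of)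

lemma set_nn_integral_cell_finite_iff:
  assumes [measurable]: "f \<in> borel_measurable borel" and nn: "\<And>x. 0 \<le> (f x :: real)"
  shows "set_integrable lborel (cell L) f \<longleftrightarrow> (\<integral>\<^sup>+x\<in>cell L. ennreal (f x) \<partial>lborel) < \<infinity>"
proof -
  have "(\<integral>\<^sup>+x\<in>cell L. ennreal (f x) \<partial>lborel) = (\<integral>\<^sup>+x. ennreal (norm (indicat_real (cell L) x *\<^sub>R f x)) \<partial>lborel)"
    by (intro nn_integral_cong) (auto simp: indicator_def nn)
  then show ?thesis unfolding set_integrable_def integrable_iff_bounded by simp
qed

lemma hnorm_nonneg [simp]: "0 \<le> hnorm L u"
  by (simp add: hnorm_def hinner_nonneg)

lemma hnorm_square: "(hnorm L u)\<^sup>2 = hinner L u u"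
  by (simp add: hnorm_def hinner_nonneg)

lemma hnorm_nn_integral:
  assumes "u \<in> L2 L"
  shows "(\<integral>\<^sup>+x\<in>cell L. ennreal ((norm (fld u x))\<^sup>2) \<partial>lborel) = ennreal ((hnorm L u)\<^sup>2)"
proof -
  have i: "integrable lborel (\<lambda>x. indicat_real (cell L) x *\<^sub>R (norm (fld u x))\<^sup>2)"
    using assms by (simp add: L2_def set_integrable_def)
  have "(\<integral>\<^sup>+x\<in>cell L. ennreal ((norm (fld u x))\<^sup>2) \<partial>lborel) =
      (\<integral>\<^sup>+x. ennreal (indicat_real (cell L) x *\<^sub>R (norm (fld u x))\<^sup>2) \<partial>lborel)"
    by (intro nn_integral_cong) (auto simp: indicator_def)
  also have "\<dots> = ennreal (LINT x|lborel. indicat_real (cell L) x *\<^sub>R (norm (fld u x))\<^sup>2)"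
    by (rule nn_integral_eq_integral[OF i]) simp
  also have "(LINT x|lborel. indicat_real (cell L) x *\<^sub>R (norm (fld u x))\<^sup>2) = (hnorm L u)\<^sup>2"
    by (simp add: hnorm_square hinner_def set_lebesgue_integral_def power2_norm_eq_inner)
  finally show ?thesis .
qed

lemma L2_I_nn_integral:
  assumes p: "periodic L u" and le: "(\<integral>\<^sup>+x\<in>cell L. ennreal ((norm (fld u x))\<^sup>2) \<partial>lborel) \<le> ennreal (C\<^sup>2)"
    and C: "0 \<le> C"
  shows "u \<in> L2 L" "hnorm L u \<le> C"
proof -
  have "(\<integral>\<^sup>+x\<in>cell L. ennreal ((norm (fld u x))\<^sup>2) \<partial>lborel) < \<infinity>"
    using le by (rule le_less_trans) simp
  then show u: "u \<in> L2 L" using p unfolding L2_def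
    by (simp add: set_nn_integral_cell_finite_iff)
  have "(hnorm L u)\<^sup>2 \<le> C\<^sup>2" using le by (simp add: hnorm_nn_integral[OF u])
  then show "hnorm L u \<le> C" using C by (rule power2_le_imp_le)
qed

lemma periodic_vfield_of:
  assumes [measurable]: "g \<in> borel_measurable borel" and p: "\<And>i. AE x in lborel. g (x + L *\<^sub>R axis i 1) = g x"
  shows "periodic L (vfield_of g)"
  unfolding periodic_def
proof
  fix i :: 2
  show "AE x in lborel. fld (vfield_of g) (x + L *\<^sub>R axis i 1) = fld (vfield_of g) x"
    using p[of i] fld_vfield_of[of g] AE_lborel_translation[OF fld_vfield_of[of g], of "L *\<^sub>R axis i 1"]
    by (auto elim!: AE_mp)
qed

lemma L2_vfield_of:
  assumes g: "continuous_on UNIV g" and p: "periodic_fun L g"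
  shows "vfield_of g \<in> L2 L"
proof -
  have [measurable]: "g \<in> borel_measurable borel" using g by (rule borel_measurable_continuous_onI)
  have "AE x in lborel. fld (vfield_of g) x = g x" by (rule fld_vfield_of) measurable
  moreover have "set_integrable lborel (cell L) (\<lambda>x. (norm (g x))\<^sup>2)"
    by (intro set_integrable_cell continuous_intros g)
  ultimately have "set_integrable lborel (cell L) (\<lambda>x. (norm (fld (vfield_of g) x))\<^sup>2)"
    unfolding set_integrable_def
    by (subst integrable_cong_AE[where g="\<lambda>x. indicat_real (cell L) x *\<^sub>R (norm (g x))\<^sup>2"]) auto
  then show ?thesis
    using periodic_vfield_of[of g L] p by (simp add: L2_def periodic_fun_def)
qed

section \<open>Linear operations and the inner product\<close>

lemma L2_zero: "0 \<in> L2 L"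
  using L2_vfield_of[of "\<lambda>_. 0" L] by (simp add: zero_vfield_def periodic_fun_def)

lemma L2_uminus: "u \<in> L2 L \<Longrightarrow> - u \<in> L2 L"
  using L2_diff[OF L2_zero] by simp

lemma L2_add: "u \<in> L2 L \<Longrightarrow> v \<in> L2 L \<Longrightarrow> u + v \<in> L2 L"
  using L2_diff[OF _ L2_uminus, of u L v] by simp

lemma L2_scaleR:
  assumes u: "u \<in> L2 L" shows "c *\<^sub>R u \<in> L2 L"
proof -
  have "periodic L (c *\<^sub>R u)"
    unfolding periodic_def
  proof
    fix i :: 2
    show "AE x in lborel. fld (c *\<^sub>R u) (x + L *\<^sub>R axis i 1) = fld (c *\<^sub>R u) x"
      using u[unfolded L2_def periodic_def, simplified, THEN conjunct1, rule_format, of i] fld_scaleR[of c u]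
        AE_lborel_translation[OF fld_scaleR[of c u], of "L *\<^sub>R axis i 1"]
      by eventually_elim simp
  qed
  moreover have "set_integrable lborel (cell L) (\<lambda>x. (norm (fld (c *\<^sub>R u) x))\<^sup>2)"
  proof -
    have "set_integrable lborel (cell L) (\<lambda>x. c\<^sup>2 * (norm (fld u x))\<^sup>2)"
      using u by (intro set_integrable_mult_right) (simp add: L2_def)
    then show ?thesis unfolding set_integrable_def
      by (subst integrable_cong_AE[where g="\<lambda>x. indicat_real (cell L) x *\<^sub>R (c\<^sup>2 * (norm (fld u x))\<^sup>2)"])
         (use fld_scaleR[of c u] in \<open>auto simp: power_mult_distrib elim!: AE_mp\<close>)
  qed
  ultimately show ?thesis by (simp add: L2_def)
qed

lemma L2_sum: "(\<And>k. k \<in> K \<Longrightarrow> f k \<in> L2 L) \<Longrightarrow> (\<Sum>k\<in>K. f k) \<in> L2 L"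
  by (induction K rule: infinite_finite_induct) (auto intro: L2_zero L2_add)

lemma hinner_commute: "hinner L u v = hinner L v u"
  by (simp add: hinner_def inner_commute)

lemma hinner_add_left:
  assumes "u \<in> L2 L" "v \<in> L2 L" "w \<in> L2 L"
  shows "hinner L (u + v) w = hinner L u w + hinner L v w"
proof -
  have "hinner L (u + v) w = (LINT x:cell L|lborel. (fld u x + fld v x) \<bullet> fld w x)"
    by (rule hinner_cong_AE) (auto intro: fld_add)
  then show ?thesis using hinner_integrable assms
    by (simp add: inner_add_left hinner_def set_integral_add)
qed

lemma hinner_scaleR_left: "hinner L (c *\<^sub>R u) w = c * hinner L u w"
proof -
  have "hinner L (c *\<^sub>R u) w = (LINT x:cell L|lborel. (c *\<^sub>R fld u x) \<bullet> fld w x)"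
    by (rule hinner_cong_AE) (auto intro: fld_scaleR)
  then show ?thesis by (simp add: hinner_def)
qed

lemma hinner_zero_left [simp]: "hinner L 0 w = 0"
  using hinner_scaleR_left[of L 0 0 w] by simp

lemma hinner_uminus_left [simp]: "hinner L (- u) w = - hinner L u w"
  using hinner_scaleR_left[of L "-1" u w] by simp

lemma hinner_diff_left:
  assumes "u \<in> L2 L" "v \<in> L2 L" "w \<in> L2 L"
  shows "hinner L (u - v) w = hinner L u w - hinner L v w"
  using hinner_add_left[OF assms(1) L2_uminus[OF assms(2)] assms(3)] by simp

lemma hinner_sum_left:
  "(\<And>k. k \<in> K \<Longrightarrow> f k \<in> L2 L) \<Longrightarrow> w \<in> L2 L \<Longrightarrow> hinner L (\<Sum>k\<in>K. f k) w = (\<Sum>k\<in>K. hinner L (f k) w)"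
  by (induction K rule: infinite_finite_induct) (auto simp: hinner_add_left L2_sum)

lemma hinner_zero_right [simp]: "hinner L w 0 = 0"
  by (simp add: hinner_commute[of L w])

lemma hinner_scaleR_right: "hinner L w (c *\<^sub>R u) = c * hinner L w u"
  by (simp add: hinner_commute[of L w] hinner_scaleR_left)

lemma hinner_diff_right:
  "u \<in> L2 L \<Longrightarrow> v \<in> L2 L \<Longrightarrow> w \<in> L2 L \<Longrightarrow> hinner L w (u - v) = hinner L w u - hinner L w v"
  by (simp add: hinner_commute[of L w] hinner_diff_left)

lemma hinner_sum_right:
  "(\<And>k. k \<in> K \<Longrightarrow> f k \<in> L2 L) \<Longrightarrow> w \<in> L2 L \<Longrightarrow> hinner L w (\<Sum>k\<in>K. f k) = (\<Sum>k\<in>K. hinner L w (f k))"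
  by (simp add: hinner_commute[of L w] hinner_sum_left)

lemma abs_hinner_le: "u \<in> L2 L \<Longrightarrow> v \<in> L2 L \<Longrightarrow> \<bar>hinner L u v\<bar> \<le> hnorm L u * hnorm L v"
  by (rule abs_le_square_iff[THEN iffD2, of _ "hnorm L u * hnorm L v", simplified])
     (simp add: power_mult_distrib hnorm_square hinner_square_le)

lemma hnorm_zero [simp]: "hnorm L 0 = 0"
  by (simp add: hnorm_def)

lemma abs_hnorm_diff_le:
  assumes "u \<in> L2 L" "v \<in> L2 L" shows "\<bar>hnorm L u - hnorm L v\<bar> \<le> hnorm L (u - v)"
  using hnorm_triangle[OF assms L2_zero] hnorm_triangle[OF assms(2,1) L2_zero]
  by (simp add: hnorm_commute[of L v u])

text \<open>Convergence in norm is L1 convergence of the squared pointwise distance. The almost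
  everywhere limit is what lets Fatou's lemma carry bounds from trigonometric fields to general
  ones.\<close>

lemma hnorm_tendsto_imp_AE_subseq:
  assumes s: "\<And>n. s n \<in> L2 L" and y: "y \<in> L2 L" and lim: "(\<lambda>n. hnorm L (s n - y)) \<longlonglongrightarrow> 0"
  obtains r :: "nat \<Rightarrow> nat" where "strict_mono r"
    "AE x in lborel. x \<in> cell L \<longrightarrow> (\<lambda>n. fld (s (r n)) x) \<longlonglongrightarrow> fld y x"
proof -
  define w where "w n x = indicat_real (cell L) x *\<^sub>R (norm (fld (s n - y) x))\<^sup>2" for n x
  have i: "integrable lborel (w n)" for n
    using L2_diff[OF s y, of n] unfolding w_def L2_def set_integrable_def by simp
  have "(LINT x|lborel. norm (w n x)) = (hnorm L (s n - y))\<^sup>2" for n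
    by (simp add: w_def hnorm_square hinner_def set_lebesgue_integral_def power2_norm_eq_inner)
  moreover have "(\<lambda>n. (hnorm L (s n - y))\<^sup>2) \<longlonglongrightarrow> 0\<^sup>2" by (intro tendsto_intros lim)
  ultimately have "(\<lambda>n. LINT x|lborel. norm (w n x)) \<longlonglongrightarrow> 0" by simp
  from tendsto_L1_AE_subseq[OF i this]
  obtain r where r: "strict_mono r" "AE x in lborel. (\<lambda>n. w (r n) x) \<longlonglongrightarrow> 0" by blast
  have "AE x in lborel. \<forall>n. fld (s n - y) x = fld (s n) x - fld y x"
    using fld_diff by (simp add: AE_all_countable)
  with r(2) have "AE x in lborel. x \<in> cell L \<longrightarrow> (\<lambda>n. fld (s (r n)) x) \<longlonglongrightarrow> fld y x"
  proof eventually_elim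
    case (elim x)
    show ?case
    proof
      assume "x \<in> cell L"
      then have "(\<lambda>n. sqrt ((norm (fld (s (r n)) x - fld y x))\<^sup>2)) \<longlonglongrightarrow> sqrt 0"
        using elim by (intro tendsto_real_sqrt) (simp add: w_def)
      then show "(\<lambda>n. fld (s (r n)) x) \<longlonglongrightarrow> fld y x"
        by (simp add: LIM_zero_iff tendsto_norm_zero_iff)
    qed
  qed
  with r(1) show ?thesis by (rule that)
qed

lemma integral_norm_le_hnorm:
  assumes L: "L > 0" and u: "u \<in> L2 L"
  shows "(\<integral>\<^sup>+x\<in>cell L. ennreal (norm (fld u x)) \<partial>lborel) \<le> ennreal (L * hnorm L u)"
proof (rule ennreal_le_epsilon)
  fix e :: real assume e: "e > 0"
  have m: "emeasure lborel (cell L) = ennreal (L\<^sup>2)"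
    using L unfolding cell_def
    by (simp add: emeasure_lborel_cbox_eq Basis_vec_def UNIV_2 inner_axis axis_eq_axis power2_eq_square)
  \<comment> \<open>Weight in the inequality a \<le> t / 2 + a^2 / (2 t). The best choice is
    \<open>hnorm L u / L\<close>; the extra term keeps \<open>t\<close> positive when
    \<open>u\<close> has norm 0 and costs only \<open>e / 2\<close>.\<close>
  define t where "t = hnorm L u / L + e / L\<^sup>2"
  have t: "t > 0" using e L by (auto simp: t_def intro: add_nonneg_pos)
  have "a \<le> t / 2 + (1 / (2 * t)) * a\<^sup>2" for a :: real
  proof -
    have "0 \<le> (a - t)\<^sup>2" by simp
    then show ?thesis using t by (simp add: field_simps power2_eq_square)
  qed
  then have "(\<integral>\<^sup>+x\<in>cell L. ennreal (norm (fld u x)) \<partial>lborel) \<le>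
      (\<integral>\<^sup>+x. (ennreal (t / 2) * indicator (cell L) x + ennreal (1 / (2 * t)) * (ennreal ((norm (fld u x))\<^sup>2) * indicator (cell L) x)) \<partial>lborel)"
    using t by (intro nn_integral_mono) (auto simp: indicator_def ennreal_plus[symmetric] ennreal_mult[symmetric] simp del: ennreal_plus intro!: ennreal_leI)
  also have "\<dots> = ennreal (t / 2) * ennreal (L\<^sup>2) + ennreal (1 / (2 * t)) * ennreal ((hnorm L u)\<^sup>2)"
    by (subst nn_integral_add) (auto simp: nn_integral_cmult hnorm_nn_integral[OF u] nn_integral_cmult_indicator m)
  also have "\<dots> = ennreal (t / 2 * L\<^sup>2 + 1 / (2 * t) * (hnorm L u)\<^sup>2)"
    using t by (simp add: ennreal_mult[symmetric] ennreal_plus[symmetric] del: ennreal_plus)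
  also have "\<dots> \<le> ennreal (L * hnorm L u + e)"
  proof (rule ennreal_leI)
    have "hnorm L u \<le> t * L" using e L by (simp add: t_def field_simps power2_eq_square)
    then have "(hnorm L u)\<^sup>2 \<le> hnorm L u * (t * L)" by (simp add: power2_eq_square mult_left_mono)
    then have "1 / (2 * t) * (hnorm L u)\<^sup>2 \<le> 1 / (2 * t) * (hnorm L u * (t * L))"
      using t by (intro mult_left_mono) auto
    also have "\<dots> = L * hnorm L u / 2" using t by simp
    finally have "1 / (2 * t) * (hnorm L u)\<^sup>2 \<le> L * hnorm L u / 2" .
    moreover have "t / 2 * L\<^sup>2 = L * hnorm L u / 2 + e / 2"
      using L by (simp add: t_def field_simps power2_eq_square)
    ultimately show "t / 2 * L\<^sup>2 + 1 / (2 * t) * (hnorm L u)\<^sup>2 \<le> L * hnorm L u + e"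
      using e by linarith
  qed
  also have "\<dots> = ennreal (L * hnorm L u) + ennreal e"
    using L e by simp
  finally show "(\<integral>\<^sup>+x\<in>cell L. ennreal (norm (fld u x)) \<partial>lborel) \<le> ennreal (L * hnorm L u) + ennreal e" .
qed

lemma Cauchy_fast_subseq:
  assumes "\<And>e. e > 0 \<Longrightarrow> \<exists>N. \<forall>m\<ge>N. \<forall>n\<ge>N. d m n < (e::real)"
  obtains r :: "nat \<Rightarrow> nat" where "strict_mono r" "\<And>k. d (r (Suc k)) (r k) < (1/2)^k"
proof -
  have "\<exists>N. \<forall>m\<ge>N. \<forall>n\<ge>N. d m n < (1/2)^k" for k :: nat by (rule assms) simp
  then obtain N where N: "\<And>k m n. m \<ge> N k \<Longrightarrow> n \<ge> N k \<Longrightarrow> d m n < (1/2)^k" by metis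
  \<comment> \<open>Summing the thresholds makes \<open>r k\<close> exceed every earlier one, and
    adding \<open>k\<close> makes \<open>r\<close> strictly increasing.\<close>
  define r where "r k = (\<Sum>j\<le>k. N j) + k" for k
  have "N k \<le> r k" for k
    using member_le_sum[of k "{..k}" N] by (simp add: r_def trans_le_add1)
  moreover have "r k < r (Suc k)" for k by (simp add: r_def)
  ultimately show ?thesis
    using N that[of r] by (meson less_imp_le order_trans strict_mono_Suc_iff)
qed

text \<open>The limit is built from pointwise limits of a rapidly converging subsequence.\<close>

lemma L2_complete:
  assumes L: "L > 0" and s: "\<And>n. s n \<in> L2 L"
    and cau: "\<And>e. e > 0 \<Longrightarrow> \<exists>N. \<forall>m\<ge>N. \<forall>n\<ge>N. hnorm L (s m - s n) < e"
  obtains y where "y \<in> L2 L" "(\<lambda>n. hnorm L (s n - y)) \<longlonglongrightarrow> 0"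
proof -
  obtain r where r: "strict_mono r" "\<And>k. hnorm L (s (r (Suc k)) - s (r k)) < (1/2)^k"
    using Cauchy_fast_subseq[OF cau] by metis
  define d where "d k x = norm (fld (s (r (Suc k)) - s (r k)) x)" for k x
  have [measurable]: "d k \<in> borel_measurable borel" for k unfolding d_def by measurable
  have "(\<integral>\<^sup>+x. (\<Sum>k. ennreal (d k x) * indicator (cell L) x) \<partial>lborel) = (\<Sum>k. \<integral>\<^sup>+x\<in>cell L. ennreal (d k x) \<partial>lborel)"
    by (rule nn_integral_suminf) measurable
  also have "\<dots> \<le> (\<Sum>k. ennreal (L * (1/2)^k))"
  proof (rule suminf_le)
    show "(\<integral>\<^sup>+x\<in>cell L. ennreal (d k x) \<partial>lborel) \<le> ennreal (L * (1/2)^k)" for k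
      unfolding d_def
      using integral_norm_le_hnorm[OF L L2_diff[OF s s]] 
      by (rule order_trans) (use r(2)[of k] L in \<open>auto intro!: ennreal_leI mult_left_mono less_imp_le\<close>)
  qed auto
  also have "\<dots> = ennreal (\<Sum>k. L * (1/2)^k)"
    using L by (intro suminf_ennreal2) (auto intro!: summable_mult summable_geometric)
  also have "\<dots> < \<infinity>" by simp
  finally have "AE x in lborel. (\<Sum>k. ennreal (d k x) * indicator (cell L) x) \<noteq> \<infinity>"
    by (intro nn_integral_PInf_AE) auto
  moreover have "AE x in lborel. \<forall>k. fld (s (r (Suc k)) - s (r k)) x = fld (s (r (Suc k))) x - fld (s (r k)) x"
    using fld_diff by (simp add: AE_all_countable)
  ultimately have conv: "AE x in lborel. x \<in> cell L \<longrightarrow> convergent (\<lambda>k. fld (s (r k)) x)"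
  proof eventually_elim
    case (elim x)
    show ?case
    proof
      assume "x \<in> cell L"
      then have "(\<Sum>k. ennreal (d k x)) \<noteq> \<infinity>" using elim(1) by simp
      then have sd: "summable (\<lambda>k. d k x)"
        by (intro summable_suminf_not_top) (auto simp: d_def)
      have "summable (\<lambda>k. fld (s (r (Suc k))) x - fld (s (r k)) x)"
      proof (rule summable_norm_cancel)
        show "summable (\<lambda>k. norm (fld (s (r (Suc k))) x - fld (s (r k)) x))"
          using sd elim(2) by (simp add: d_def)
      qed
      then show "convergent (\<lambda>k. fld (s (r k)) x)"
        by (simp add: summable_iff_convergent sum_lessThan_telescope[of "\<lambda>k. fld (s (r k)) x"]
            convergent_diff_const_right_iff)
    qed
  qed
  define f where "f x = lim (\<lambda>k. fld (s (r k)) x)" for x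
  have f [measurable]: "f \<in> borel_measurable borel" unfolding f_def by measurable
  define y where "y = vfield_of f"
  have yf: "AE x in lborel. fld y x = f x" unfolding y_def by (rule fld_vfield_of[OF f])
  have py: "periodic L y"
    unfolding y_def
  proof (rule periodic_vfield_of[OF f])
    fix i :: 2
    have "AE x in lborel. \<forall>k. fld (s (r k)) (x + L *\<^sub>R axis i 1) = fld (s (r k)) x"
      using s by (auto simp: AE_all_countable L2_def periodic_def)
    then show "AE x in lborel. f (x + L *\<^sub>R axis i 1) = f x"
      by eventually_elim (simp add: f_def)
  qed
  \<comment> \<open>Fatou's lemma along the subsequence turns the Cauchy bound between members into
    the same bound for the distance to the limit.\<close>
  have sub: "s n - y \<in> L2 L \<and> hnorm L (s n - y) \<le> e"
    if e: "e > 0" and N: "\<And>m n. m \<ge> N \<Longrightarrow> n \<ge> N \<Longrightarrow> hnorm L (s m - s n) < e" and n: "n \<ge> N" for n N e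
  proof -
    have "AE x in lborel. \<forall>k. fld (s n - s (r k)) x = fld (s n) x - fld (s (r k)) x"
      using fld_diff by (simp add: AE_all_countable)
    with conv yf fld_diff[of "s n" y]
    have "AE x in lborel. ennreal ((norm (fld (s n - y) x))\<^sup>2) * indicator (cell L) x =
        liminf (\<lambda>k. ennreal ((norm (fld (s n - s (r k)) x))\<^sup>2) * indicator (cell L) x)"
    proof eventually_elim
      case (elim x)
      show ?case
      proof (cases "x \<in> cell L")
        case True
        then have "(\<lambda>k. fld (s (r k)) x) \<longlonglongrightarrow> f x"
          using elim(1) by (simp add: f_def convergent_LIMSEQ_iff)
        then have "(\<lambda>k. ennreal ((norm (fld (s n) x - fld (s (r k)) x))\<^sup>2)) \<longlonglongrightarrow> ennreal ((norm (fld (s n) x - f x))\<^sup>2)"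
          by (intro tendsto_intros tendsto_ennrealI)
        from lim_imp_Liminf[OF _ this] True elim show ?thesis by simp
      qed (simp add: Liminf_const)
    qed
    then have "(\<integral>\<^sup>+x\<in>cell L. ennreal ((norm (fld (s n - y) x))\<^sup>2) \<partial>lborel) =
        (\<integral>\<^sup>+x. liminf (\<lambda>k. ennreal ((norm (fld (s n - s (r k)) x))\<^sup>2) * indicator (cell L) x) \<partial>lborel)"
      by (rule nn_integral_cong_AE)
    also have "\<dots> \<le> liminf (\<lambda>k. \<integral>\<^sup>+x\<in>cell L. ennreal ((norm (fld (s n - s (r k)) x))\<^sup>2) \<partial>lborel)"
      by (rule nn_integral_liminf) measurable
    also have "\<dots> \<le> ennreal (e\<^sup>2)"
    proof (rule Liminf_le)
      have "\<forall>\<^sub>F k in sequentially. N \<le> r k"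
        using r(1) by (metis eventually_sequentiallyI order_trans strict_mono_imp_increasing)
      then show "\<forall>\<^sub>F k in sequentially. (\<integral>\<^sup>+x\<in>cell L. ennreal ((norm (fld (s n - s (r k)) x))\<^sup>2) \<partial>lborel) \<le> ennreal (e\<^sup>2)"
      proof eventually_elim
        case (elim k)
        have "hnorm L (s n - s (r k)) \<le> e" using N[OF n elim] by simp
        then show ?case using hnorm_nn_integral[OF L2_diff[OF s s]]
          by (simp add: ennreal_leI power_mono)
      qed
    qed simp
    finally show ?thesis
      using L2_I_nn_integral[OF periodic_diff[OF _ py], of "s n" e] s[of n] e by (simp add: L2_def)
  qed
  obtain N where "\<And>m n. m \<ge> N \<Longrightarrow> n \<ge> N \<Longrightarrow> hnorm L (s m - s n) < 1" using cau[of 1] by auto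
  then have "s N - y \<in> L2 L" using sub[of 1 N N] by simp
  then have "s N - (s N - y) \<in> L2 L" by (rule L2_diff[OF s])
  then have y: "y \<in> L2 L" by simp
  have "(\<lambda>n. hnorm L (s n - y)) \<longlonglongrightarrow> 0"
  proof (rule LIMSEQ_I)
    fix e :: real assume e: "e > 0"
    then obtain N where "\<And>m n. m \<ge> N \<Longrightarrow> n \<ge> N \<Longrightarrow> hnorm L (s m - s n) < e/2"
      using cau[of "e/2"] by auto
    then have "hnorm L (s n - y) < e" if "n \<ge> N" for n
      using sub[of "e/2" N n] that e by (auto intro!: le_less_trans[of _ "e/2" e])
    then show "\<exists>N. \<forall>n\<ge>N. norm (hnorm L (s n - y) - 0) < e"
      by (intro exI[of _ N]) auto
  qed
  with y show ?thesis by (rule that)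
qed

section \<open>H as a closed linear subspace\<close>

lemma H_subset_L2: "u \<in> H L \<Longrightarrow> u \<in> L2 L"
  by (simp add: H_def)

definition gradient :: "(real^2 \<Rightarrow> real) \<Rightarrow> real^2 \<Rightarrow> real^2" where
  "gradient \<phi> x = (\<chi> i. pdiff i \<phi> x)"

lemma gradient_continuous: "\<phi> \<in> test_functions L \<Longrightarrow> continuous_on UNIV (gradient \<phi>)"
  unfolding gradient_def by (intro continuous_intros test_functionD(3))

lemma pdiff_periodic:
  assumes p: "periodic_fun L f" shows "periodic_fun L (pdiff i f)"
proof -
  have "f \<circ> (\<lambda>x. x + L *\<^sub>R axis j 1) = f" for j using p by (auto simp: periodic_fun_def)
  moreover have "pdiff i (f \<circ> (\<lambda>x. x + c)) x = pdiff i f (x + c)" for c x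
  proof -
    have "((f \<circ> (\<lambda>x. x + c)) has_derivative f') (at x) \<longleftrightarrow> (f has_derivative f') (at (x + c))" for f'
    proof
      assume "(f has_derivative f') (at (x + c))"
      then have "(f has_derivative f') (at ((\<lambda>x. x + c) x))" by simp
      moreover have "((\<lambda>x. x + c) has_derivative (\<lambda>h. h)) (at x)"
        by (auto intro!: derivative_eq_intros)
      ultimately show "((f \<circ> (\<lambda>x. x + c)) has_derivative f') (at x)"
        using diff_chain_at[of "\<lambda>x. x + c" "\<lambda>h. h" x f f'] by (simp add: o_def)
    next
      assume *: "((f \<circ> (\<lambda>x. x + c)) has_derivative f') (at x)"
      have "((\<lambda>x. x - c) has_derivative (\<lambda>h. h)) (at (x + c))"
        by (auto intro!: derivative_eq_intros)
      with * show "(f has_derivative f') (at (x + c))"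
        using diff_chain_at[of "\<lambda>x. x - c" "\<lambda>h. h" "x + c" "f \<circ> (\<lambda>x. x + c)" f'] by (simp add: o_def)
    qed
    then show ?thesis by (simp add: pdiff_def frechet_derivative_def)
  qed
  ultimately show ?thesis by (metis periodic_fun_def)
qed

lemma gradient_in_L2:
  assumes "\<phi> \<in> test_functions L" shows "vfield_of (gradient \<phi>) \<in> L2 L"
  using gradient_continuous[OF assms] pdiff_periodic[OF test_functionD(4)[OF assms]]
  by (intro L2_vfield_of) (simp_all add: periodic_fun_def gradient_def)

lemma const_in_L2: "vfield_of (\<lambda>_. c) \<in> L2 L"
  by (intro L2_vfield_of) (simp_all add: periodic_fun_def)

lemma fld_nth_measurable [measurable]: "(\<lambda>x. fld u x $ i) \<in> borel_measurable borel"
proof -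
  have "(\<lambda>x. fld u x \<bullet> axis i 1) \<in> borel_measurable borel" by measurable
  then show ?thesis by (simp add: inner_axis)
qed

lemma L2_imp_integrable:
  assumes "u \<in> L2 L" shows "set_integrable lborel (cell L) (\<lambda>x. fld u x $ i)"
proof -
  have "set_integrable lborel (cell L) (\<lambda>x. fld u x \<bullet> fld (vfield_of (\<lambda>_. axis i 1)) x)"
    using hinner_integrable[OF assms const_in_L2] .
  then show ?thesis unfolding set_integrable_def
    by (subst integrable_cong_AE[where g="\<lambda>x. indicat_real (cell L) x *\<^sub>R (fld u x \<bullet> fld (vfield_of (\<lambda>_. axis i 1)) x)"])
      (use fld_vfield_of[of "\<lambda>_. axis i 1"] in \<open>auto simp: inner_axis elim!: AE_mp\<close>)
qed

lemma L2_imp_integrable_vec: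
  assumes "u \<in> L2 L" shows "set_integrable lborel (cell L) (fld u)"
proof -
  have *: "set_integrable lborel (cell L) (\<lambda>x. \<Sum>i\<in>UNIV. (fld u x $ i) *\<^sub>R (axis i 1 :: real^2))"
    unfolding sum_2 by (intro set_integral_add set_integrable_scaleR_left) (auto intro: L2_imp_integrable assms)
  have "(\<Sum>i\<in>UNIV. (fld u x $ i) *\<^sub>R axis i 1) = fld u x" for x
    by (simp add: vec_eq_iff forall_2 sum_2 axis_def)
  then show ?thesis using * by (simp only:)
qed

lemma integral_fld_nth:
  assumes "u \<in> L2 L" shows "(LINT x:cell L|lborel. fld u x) $ i = hinner L u (vfield_of (\<lambda>_. axis i 1))"
proof -
  have "(LINT x:cell L|lborel. fld u x) $ i = (LINT x:cell L|lborel. fld u x $ i)"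
    unfolding set_lebesgue_integral_def
    using integral_bounded_linear[OF bounded_linear_vec_nth, of lborel "\<lambda>x. indicat_real (cell L) x *\<^sub>R fld u x" i]
      L2_imp_integrable_vec[OF assms] by (simp add: set_integrable_def)
  then show ?thesis by (simp add: hinner_vfield_of inner_axis)
qed

text \<open>Zero mean and zero divergence are both orthogonality relations, to constants and to
  gradients. Linearity and closedness of H then follow from properties of the inner product
  alone.\<close>

lemma H_iff:
  "u \<in> H L \<longleftrightarrow> u \<in> L2 L \<and> (\<forall>i. hinner L u (vfield_of (\<lambda>_. axis i 1)) = 0) \<and>
     (\<forall>\<phi>\<in>test_functions L. hinner L u (vfield_of (gradient \<phi>)) = 0)"
proof -
  have "hinner L u (vfield_of (gradient \<phi>)) = (LINT x:cell L|lborel. fld u x \<bullet> (\<chi> i. pdiff i \<phi> x))"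
    if "\<phi> \<in> test_functions L" for \<phi>
    using hinner_vfield_of[OF borel_measurable_continuous_onI[OF gradient_continuous[OF that]]]
    by (simp add: gradient_def)
  then show ?thesis
    using integral_fld_nth[of u L] by (auto simp: H_def div_free_def vec_eq_iff)
qed

lemma H_zero: "0 \<in> H L"
  by (simp add: H_iff L2_zero)

lemma H_add: "u \<in> H L \<Longrightarrow> v \<in> H L \<Longrightarrow> u + v \<in> H L"
  by (auto simp: H_iff L2_add hinner_add_left const_in_L2 gradient_in_L2)

lemma H_scaleR: "u \<in> H L \<Longrightarrow> c *\<^sub>R u \<in> H L"
  by (auto simp: H_iff L2_scaleR hinner_scaleR_left)

lemma H_uminus: "u \<in> H L \<Longrightarrow> - u \<in> H L"
  using H_scaleR[of u L "-1"] by simp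

lemma H_diff: "u \<in> H L \<Longrightarrow> v \<in> H L \<Longrightarrow> u - v \<in> H L"
  using H_add[of u L "- v"] H_uminus by simp

lemma H_sum: "(\<And>k. k \<in> K \<Longrightarrow> f k \<in> H L) \<Longrightarrow> (\<Sum>k\<in>K. f k) \<in> H L"
  by (induction K rule: infinite_finite_induct) (auto intro: H_zero H_add)

lemma hinner_tendsto:
  assumes s: "\<And>n. s n \<in> L2 L" and y: "y \<in> L2 L" and v: "v \<in> L2 L"
    and lim: "(\<lambda>n. hnorm L (s n - y)) \<longlonglongrightarrow> 0"
  shows "(\<lambda>n. hinner L (s n) v) \<longlonglongrightarrow> hinner L y v"
proof -
  have "(\<lambda>n. hinner L (s n) v - hinner L y v) \<longlonglongrightarrow> 0"
  proof (rule Lim_null_comparison)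
    show "\<forall>\<^sub>F n in sequentially. norm (hinner L (s n) v - hinner L y v) \<le> hnorm L (s n - y) * hnorm L v"
      using abs_hinner_le[OF L2_diff[OF s y] v] by (simp add: hinner_diff_left s y v)
    show "(\<lambda>n. hnorm L (s n - y) * hnorm L v) \<longlonglongrightarrow> 0"
      using tendsto_mult_right[OF lim, of "hnorm L v"] by simp
  qed
  then show ?thesis by (simp add: LIM_zero_iff)
qed

lemma H_closed:
  assumes "\<And>n. s n \<in> H L" "y \<in> L2 L" "(\<lambda>n. hnorm L (s n - y)) \<longlonglongrightarrow> 0"
  shows "y \<in> H L"
proof -
  have z: "hinner L y v = 0" if "v \<in> L2 L" "\<And>n. hinner L (s n) v = 0" for v
    using hinner_tendsto[of s L y v] assms that by (simp add: H_iff LIMSEQ_const_iff)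
  show ?thesis using assms(1,2) by (auto simp: H_iff intro!: z const_in_L2 gradient_in_L2)
qed

lemma hnorm_tendsto:
  assumes "\<And>n. s n \<in> L2 L" "y \<in> L2 L" "(\<lambda>n. hnorm L (s n - y)) \<longlonglongrightarrow> 0"
  shows "(\<lambda>n. hnorm L (s n)) \<longlonglongrightarrow> hnorm L y"
proof -
  have "(\<lambda>n. hnorm L (s n) - hnorm L y) \<longlonglongrightarrow> 0"
    by (rule Lim_null_comparison[OF _ assms(3)]) (simp add: abs_hnorm_diff_le assms)
  then show ?thesis by (simp add: LIM_zero_iff)
qed

section \<open>The Fourier basis of \<open>H\<close>\<close>

context torus begin

text \<open>The wave vector turned by a right angle and normalised. At \<open>k = 0\<close> it is 0,
  so that \<open>ek 0\<close> is the zero field and several statements about \<open>ek k\<close>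
  need no side condition.\<close>

definition pol :: "int \<times> int \<Rightarrow> real^2" where
  "pol k = (1 / norm (freq k)) *\<^sub>R vec2 (- freq k $ 2) (freq k $ 1)"

lemma pol_orth: "freq k \<bullet> pol k = 0"
  by (simp add: pol_def inner_commute[of "freq k"] inner_vec2)

lemma norm_freq_square: "(norm (freq k))\<^sup>2 = (freq k $ 1)\<^sup>2 + (freq k $ 2)\<^sup>2"
  unfolding power2_norm_eq_inner by (simp add: inner_vec_def sum_2 power2_eq_square)

lemma pol_unit: "k \<noteq> 0 \<Longrightarrow> pol k \<bullet> pol k = 1"
proof -
  assume "k \<noteq> 0"
  then have "norm (freq k) \<noteq> 0" by simp
  moreover have "pol k \<bullet> pol k = ((freq k $ 1)\<^sup>2 + (freq k $ 2)\<^sup>2) / (norm (freq k))\<^sup>2"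
    by (simp add: pol_def inner_vec2 power2_eq_square add_divide_distrib)
  then have "pol k \<bullet> pol k = (norm (freq k))\<^sup>2 / (norm (freq k))\<^sup>2"
    by (simp only: norm_freq_square)
  ultimately show ?thesis by simp
qed

text \<open>The square of a mode integrates to the square of \<open>L\<close> over the cell, hence
  the division by \<open>L\<close>.\<close>

definition efun :: "int \<times> int \<Rightarrow> real^2 \<Rightarrow> real^2" where
  "efun k x = (trig k x / L) *\<^sub>R pol k"

definition ek :: "int \<times> int \<Rightarrow> vfield" where
  "ek k = vfield_of (efun k)"

lemma efun_continuous: "continuous_on UNIV (efun k)"
  unfolding efun_def using L_pos by (intro continuous_intros trig_continuous) auto

lemma efun_measurable [measurable]: "efun k \<in> borel_measurable borel"
  by (rule borel_measurable_continuous_onI[OF efun_continuous])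

lemma efun_periodic: "periodic_fun L (efun k)"
  by (simp add: periodic_fun_def efun_def trig_periodic)

lemma ek_L2: "ek k \<in> L2 L"
  unfolding ek_def by (rule L2_vfield_of[OF efun_continuous efun_periodic])

lemma fld_ek: "AE x in lborel. fld (ek k) x = efun k x"
  unfolding ek_def by (rule fld_vfield_of) measurable

lemma hinner_ek: "hinner L u (ek k) = (LINT x:cell L|lborel. fld u x \<bullet> efun k x)"
  unfolding ek_def by (rule hinner_vfield_of) measurable

lemma hinner_ek_ek: "k \<noteq> 0 \<Longrightarrow> hinner L (ek k) (ek l) = (if k = l then 1 else 0)"
proof -
  assume k: "k \<noteq> 0"
  have "hinner L (ek k) (ek l) = (LINT x:cell L|lborel. efun k x \<bullet> efun l x)"
    by (rule hinner_cong_AE) (auto intro: fld_ek)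
  also have "\<dots> = (LINT x:cell L|lborel. (pol k \<bullet> pol l / L\<^sup>2) * (trig k x * trig l x))"
    by (simp add: efun_def power2_eq_square algebra_simps)
  also have "\<dots> = (pol k \<bullet> pol l / L\<^sup>2) * (if k = l then L\<^sup>2 else 0)"
    by (simp only: set_integral_mult_right integral_trig_mult)
  finally show ?thesis using L_pos k pol_unit[OF k] by auto
qed

text \<open>Against a gradient, integration by parts moves the derivative to the mode and produces
  the factor \<open>freq k \<bullet> pol k\<close>, which is 0. The mean vanishes because
  \<open>trig k\<close> has mean 0 for nonzero \<open>k\<close> and \<open>pol 0\<close> is
  0.\<close>

lemma ek_H: "ek k \<in> H L"
proof -
  have "hinner L (ek k) (vfield_of (\<lambda>_. axis i 1)) = 0" for i
  proof -
    have "hinner L (ek k) (vfield_of (\<lambda>_. axis i 1)) = (LINT x:cell L|lborel. efun k x \<bullet> axis i 1)"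
      by (rule hinner_cong_AE) (auto intro: fld_ek fld_vfield_of)
    also have "\<dots> = (LINT x:cell L|lborel. (pol k $ i / L) * trig k x)"
      by (simp add: efun_def inner_axis mult.commute)
    also have "\<dots> = (pol k $ i / L) * (if k = 0 then L\<^sup>2 else 0)"
      by (simp only: set_integral_mult_right integral_trig)
    finally show ?thesis by (simp add: pol_def)
  qed
  moreover have "hinner L (ek k) (vfield_of (gradient \<phi>)) = 0" if phi: "\<phi> \<in> test_functions L" for \<phi>
  proof -
    note t = test_functionD[OF phi] and tk = test_functionD[OF trig_test_function[of k]]
    have gm: "gradient \<phi> \<in> borel_measurable borel"
      by (rule borel_measurable_continuous_onI[OF gradient_continuous[OF phi]])
    have i: "set_integrable lborel (cell L) (\<lambda>x. pdiff i \<phi> x * trig k x)" for i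
      by (intro set_integrable_cell continuous_intros t tk)
    have ib: "(LINT x:cell L|lborel. pdiff i \<phi> x * trig k x) = - (freq k $ i * (LINT x:cell L|lborel. \<phi> x * trig (- k) x))" for i
      by (subst integration_by_parts[OF L_pos phi trig_test_function])
         (simp only: pdiff_trig mult.left_commute[of "\<phi> _" "freq k $ i"] set_integral_mult_right)
    have "hinner L (ek k) (vfield_of (gradient \<phi>)) = (LINT x:cell L|lborel. efun k x \<bullet> gradient \<phi> x)"
      by (rule hinner_cong_AE) (auto intro: fld_ek fld_vfield_of gm)
    also have "\<dots> = (LINT x:cell L|lborel. (pol k $ 1 / L) * (pdiff 1 \<phi> x * trig k x) + (pol k $ 2 / L) * (pdiff 2 \<phi> x * trig k x))"
      by (simp add: efun_def gradient_def inner_vec_def sum_2 algebra_simps)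
    also have "\<dots> = (pol k $ 1 / L) * (LINT x:cell L|lborel. pdiff 1 \<phi> x * trig k x) +
        (pol k $ 2 / L) * (LINT x:cell L|lborel. pdiff 2 \<phi> x * trig k x)"
      using i by (subst set_integral_add(2)) (auto intro: set_integrable_mult_right)
    also have "\<dots> = - (freq k \<bullet> pol k) / L * (LINT x:cell L|lborel. \<phi> x * trig (- k) x)"
      unfolding ib using L_pos by (simp add: inner_vec_def sum_2 field_simps)
    finally show ?thesis by (simp add: pol_orth)
  qed
  ultimately show ?thesis by (simp add: H_iff ek_L2)
qed

lemma L2_eq_zeroI:
  assumes u: "u \<in> L2 L" and z: "\<And>i k. (LINT x:cell L|lborel. fld u x $ i * trig k x) = 0"
  shows "u = 0"
proof -
  have "AE x in lborel. x \<in> cell L \<longrightarrow> fld u x $ i = 0" for i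
    by (rule trig_complete) (use z L2_imp_integrable[OF u] in auto)
  then have "AE x in lborel. \<forall>i. x \<in> cell L \<longrightarrow> fld u x $ i = 0"
    unfolding AE_all_countable by blast
  then have "AE x in lborel. x \<in> cell L \<longrightarrow> fld u x = 0"
    by eventually_elim (simp add: vec_eq_iff)
  then show ?thesis using u by (intro periodic_zero[OF L_pos]) (auto simp: L2_def)
qed

text \<open>For nonzero \<open>k\<close> the vector (\<open>A 1 k\<close>, \<open>A 2 k\<close>) is
  orthogonal to \<open>pol k\<close> by hypothesis and to \<open>freq k\<close> because the
  divergence is 0, tested with \<open>trig (- k)\<close>. These two directions span the plane. The
  vector for \<open>k = 0\<close> is the mean.\<close>

lemma H_complete:
  assumes u: "u \<in> H L" and z: "\<And>k. k \<noteq> 0 \<Longrightarrow> hinner L u (ek k) = 0"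
  shows "u = 0"
proof -
  have u2: "u \<in> L2 L" using u by (rule H_subset_L2)
  define A where "A i k = (LINT x:cell L|lborel. fld u x $ i * trig k x)" for i k
  have i: "set_integrable lborel (cell L) (\<lambda>x. fld u x $ i * trig k x)" for i k
    by (rule set_integrable_mult_bounded[OF L2_imp_integrable[OF u2] _ _ _ abs_trig_le]) auto
  have lin: "(LINT x:cell L|lborel. fld u x \<bullet> (trig k x *\<^sub>R v)) = v $ 1 * A 1 k + v $ 2 * A 2 k" for k v
  proof -
    have "(LINT x:cell L|lborel. fld u x \<bullet> (trig k x *\<^sub>R v)) =
      (LINT x:cell L|lborel. v $ 1 * (fld u x $ 1 * trig k x) + v $ 2 * (fld u x $ 2 * trig k x))"
      by (simp add: inner_vec_def sum_2 algebra_simps)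
    then show ?thesis unfolding A_def using i
      by (simp add: set_integral_add set_integrable_mult_right)
  qed
  have A0: "A i k = 0" for i k
  proof (cases "k = 0")
    case True
    have "hinner L u (vfield_of (\<lambda>_. axis i 1)) = A i 0"
      by (subst hinner_vfield_of) (simp_all add: A_def inner_axis)
    then show ?thesis using u True by (simp add: H_iff)
  next
    case False
    let ?f = "freq k"
    have "gradient (trig (- k)) x = trig k x *\<^sub>R (- ?f)" for x
      by (simp add: gradient_def pdiff_trig freq_minus vec_eq_iff)
    then have g: "(LINT x:cell L|lborel. fld u x \<bullet> (trig k x *\<^sub>R (- ?f))) = hinner L u (vfield_of (gradient (trig (- k))))"
      by (subst hinner_vfield_of)
         (auto intro!: borel_measurable_continuous_onI gradient_continuous trig_test_function)
    then have 1: "?f $ 1 * A 1 k + ?f $ 2 * A 2 k = 0"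
      using u trig_test_function[of "- k"] unfolding lin by (simp add: H_iff)
    have "efun k = (\<lambda>x. trig k x *\<^sub>R ((1 / L) *\<^sub>R pol k))" by (rule ext) (simp add: efun_def)
    then have "(LINT x:cell L|lborel. fld u x \<bullet> (trig k x *\<^sub>R ((1 / L) *\<^sub>R pol k))) = 0"
      using z[OF False] by (simp only: hinner_ek)
    then have "(pol k $ 1 * A 1 k + pol k $ 2 * A 2 k) / L = 0"
      unfolding lin by (simp add: add_divide_distrib)
    then have "(- ?f $ 2 * A 1 k + ?f $ 1 * A 2 k) / norm ?f = 0"
      using L_pos by (auto simp: pol_def add_divide_distrib)
    then have 2: "- ?f $ 2 * A 1 k + ?f $ 1 * A 2 k = 0" using False by simp
    have "(norm ?f)\<^sup>2 \<noteq> 0" using False by simp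
    then have nz: "(?f $ 1)\<^sup>2 + (?f $ 2)\<^sup>2 \<noteq> 0" by (simp only: norm_freq_square not_False_eq_True)
    have "((?f $ 1)\<^sup>2 + (?f $ 2)\<^sup>2) * A 1 k = ?f $ 1 * (?f $ 1 * A 1 k + ?f $ 2 * A 2 k) - ?f $ 2 * (- ?f $ 2 * A 1 k + ?f $ 1 * A 2 k)"
      "((?f $ 1)\<^sup>2 + (?f $ 2)\<^sup>2) * A 2 k = ?f $ 2 * (?f $ 1 * A 1 k + ?f $ 2 * A 2 k) + ?f $ 1 * (- ?f $ 2 * A 1 k + ?f $ 1 * A 2 k)"
      by (simp_all add: algebra_simps power2_eq_square)
    then have "A 1 k = 0" "A 2 k = 0" unfolding 1 2 using nz by auto
    then show ?thesis using exhaust_2[of i] by auto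
  qed
  show ?thesis using u2 A0 by (intro L2_eq_zeroI) (auto simp: A_def)
qed

section \<open>Fourier coefficients: Bessel, Riesz-Fischer and Parseval\<close>

definition coef :: "vfield \<Rightarrow> int \<times> int \<Rightarrow> real" where
  "coef u k = hinner L u (ek k)"

text \<open>Square blocks of frequencies are finite and increasing, and they sit in a product set,
  over which the sum bounding the trace of the covariance factorises.\<close>

definition trunc :: "nat \<Rightarrow> (int \<times> int) set" where
  "trunc n = ({- int n..int n} \<times> {- int n..int n}) - {0}"

definition fourier_sum :: "(int \<times> int) set \<Rightarrow> (int \<times> int \<Rightarrow> real) \<Rightarrow> vfield" where
  "fourier_sum K a = (\<Sum>k\<in>K. a k *\<^sub>R ek k)"

lemma finite_trunc [simp]: "finite (trunc n)"
  by (simp add: trunc_def)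

lemma zero_notin_trunc [simp]: "0 \<notin> trunc n"
  by (simp add: trunc_def)

lemma trunc_mono: "m \<le> n \<Longrightarrow> trunc m \<subseteq> trunc n"
  by (auto simp: trunc_def)

lemma mem_trunc: "k \<noteq> 0 \<Longrightarrow> \<exists>n. k \<in> trunc n"
  by (intro exI[of _ "nat (max \<bar>fst k\<bar> \<bar>snd k\<bar>)"]) (cases k, auto simp: trunc_def)

lemma fourier_sum_H: "fourier_sum K a \<in> H L"
  unfolding fourier_sum_def by (intro H_sum H_scaleR ek_H)

lemma fourier_sum_L2: "fourier_sum K a \<in> L2 L"
  by (rule H_subset_L2[OF fourier_sum_H])

lemma hinner_fourier_sum_right: "u \<in> L2 L \<Longrightarrow> hinner L u (fourier_sum K a) = (\<Sum>k\<in>K. a k * coef u k)"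
  unfolding fourier_sum_def coef_def
  by (subst hinner_sum_right) (auto intro: L2_scaleR ek_L2 simp: hinner_scaleR_right)

lemma coef_fourier_sum: "finite K \<Longrightarrow> k \<noteq> 0 \<Longrightarrow> coef (fourier_sum K a) k = (if k \<in> K then a k else 0)"
  unfolding coef_def
  by (subst hinner_commute, subst hinner_fourier_sum_right[OF ek_L2])
     (simp add: coef_def hinner_ek_ek if_distrib sum.delta cong: if_cong)

lemma hnorm_fourier_sum: "finite K \<Longrightarrow> 0 \<notin> K \<Longrightarrow> (hnorm L (fourier_sum K a))\<^sup>2 = (\<Sum>k\<in>K. (a k)\<^sup>2)"
  unfolding hnorm_square hinner_fourier_sum_right[OF fourier_sum_L2]
  by (intro sum.cong refl) (subst coef_fourier_sum, auto simp: power2_eq_square)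

lemma coef_diff: "u \<in> L2 L \<Longrightarrow> v \<in> L2 L \<Longrightarrow> coef (u - v) k = coef u k - coef v k"
  by (simp add: coef_def hinner_diff_left ek_L2)

lemma bessel:
  assumes u: "u \<in> L2 L" and K: "finite K" "0 \<notin> K"
  shows "(hnorm L (u - fourier_sum K (coef u)))\<^sup>2 = (hnorm L u)\<^sup>2 - (\<Sum>k\<in>K. (coef u k)\<^sup>2)"
    and "(\<Sum>k\<in>K. (coef u k)\<^sup>2) \<le> (hnorm L u)\<^sup>2"
proof -
  let ?p = "fourier_sum K (coef u)"
  have "hinner L (u - ?p) (u - ?p) = hinner L u u - hinner L u ?p - (hinner L u ?p - hinner L ?p ?p)"
    using u by (simp add: hinner_diff_left hinner_diff_right fourier_sum_L2 L2_diff hinner_commute[of L ?p u])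
  then show *: "(hnorm L (u - ?p))\<^sup>2 = (hnorm L u)\<^sup>2 - (\<Sum>k\<in>K. (coef u k)\<^sup>2)"
    using hnorm_fourier_sum[OF K, of "coef u"]
    by (simp add: hnorm_square hinner_fourier_sum_right[OF u] power2_eq_square[of "coef u _"])
  have "0 \<le> (hnorm L (u - ?p))\<^sup>2" by simp
  then show "(\<Sum>k\<in>K. (coef u k)\<^sup>2) \<le> (hnorm L u)\<^sup>2" unfolding * by simp
qed

lemma fourier_sum_diff: "finite K' \<Longrightarrow> K \<subseteq> K' \<Longrightarrow> fourier_sum K' a - fourier_sum K a = fourier_sum (K' - K) a"
  by (simp add: fourier_sum_def sum_diff)

text \<open>The source of all elements of H that are given only by their coefficients: the Leray
  projection and the fractional powers, which are introduced by definite descriptions, are shown to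
  exist in this way.\<close>

lemma riesz_fischer:
  assumes C: "\<And>n. (\<Sum>k\<in>trunc n. (a k)\<^sup>2) \<le> C"
  obtains y where "y \<in> H L" "\<And>k. k \<noteq> 0 \<Longrightarrow> coef y k = a k"
    "(\<lambda>n. hnorm L (fourier_sum (trunc n) a - y)) \<longlonglongrightarrow> 0"
proof -
  define S where "S n = (\<Sum>k\<in>trunc n. (a k)\<^sup>2)" for n
  have mono: "S m \<le> S n" if "m \<le> n" for m n
    unfolding S_def using trunc_mono[OF that] by (intro sum_mono2) auto
  have diff: "(hnorm L (fourier_sum (trunc n) a - fourier_sum (trunc m) a))\<^sup>2 = S n - S m" if "m \<le> n" for m n
    using hnorm_fourier_sum[of "trunc n - trunc m" a] trunc_mono[OF that]
    by (simp add: fourier_sum_diff S_def sum_diff)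
  have "convergent S"
    using C mono by (intro Bseq_mono_convergent BseqI'[of _ C]) (auto simp: S_def abs_of_nonneg sum_nonneg)
  then have "Cauchy S" by (rule convergent_Cauchy)
  have cau: "\<exists>N. \<forall>m\<ge>N. \<forall>n\<ge>N. hnorm L (fourier_sum (trunc m) a - fourier_sum (trunc n) a) < \<epsilon>" if \<epsilon>: "\<epsilon> > 0" for \<epsilon>
  proof -
    obtain N where N: "\<And>m n. m \<ge> N \<Longrightarrow> n \<ge> N \<Longrightarrow> \<bar>S m - S n\<bar> < \<epsilon>\<^sup>2"
      using CauchyD[OF \<open>Cauchy S\<close>, of "\<epsilon>\<^sup>2"] \<epsilon> by auto
    have "hnorm L (fourier_sum (trunc m) a - fourier_sum (trunc n) a) < \<epsilon>" if "m \<ge> N" "n \<ge> N" for m n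
    proof -
      have "(hnorm L (fourier_sum (trunc m) a - fourier_sum (trunc n) a))\<^sup>2 \<le> \<bar>S m - S n\<bar>"
        using diff[of n m] diff[of m n] by (cases "n \<le> m") (auto simp: hnorm_commute[of L "fourier_sum (trunc m) a"])
      also have "\<dots> < \<epsilon>\<^sup>2" by (rule N) fact+
      finally show ?thesis using \<epsilon> by (simp add: power2_less_imp_less)
    qed
    then show ?thesis by blast
  qed
  obtain y where y: "y \<in> L2 L" "(\<lambda>n. hnorm L (fourier_sum (trunc n) a - y)) \<longlonglongrightarrow> 0"
    using L2_complete[OF L_pos fourier_sum_L2 cau] by blast
  have yH: "y \<in> H L" using fourier_sum_H y by (rule H_closed)
  have "coef y k = a k" if k: "k \<noteq> 0" for k
  proof -
    obtain m where m: "k \<in> trunc m" using mem_trunc[OF k] by blast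
    have "(\<lambda>n. coef (fourier_sum (trunc n) a) k) \<longlonglongrightarrow> coef y k"
      unfolding coef_def by (rule hinner_tendsto[OF fourier_sum_L2 y(1) ek_L2 y(2)])
    moreover have "\<forall>\<^sub>F n in sequentially. coef (fourier_sum (trunc n) a) k = a k"
      using trunc_mono m k by (auto simp: coef_fourier_sum eventually_sequentially intro!: exI[of _ m])
    ultimately show ?thesis by (metis LIMSEQ_unique tendsto_eventually)
  qed
  from yH this y(2) show ?thesis by (rule that)
qed

text \<open>Bessel's inequality and Riesz-Fischer give some limit with the coefficients of
  \<open>u\<close>; completeness of the modes identifies it with \<open>u\<close>.\<close>

lemma fourier_tendsto:
  assumes u: "u \<in> H L"
  shows "(\<lambda>n. hnorm L (fourier_sum (trunc n) (coef u) - u)) \<longlonglongrightarrow> 0"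
proof -
  note u2 = H_subset_L2[OF u]
  obtain y where y: "y \<in> H L" "\<And>k. k \<noteq> 0 \<Longrightarrow> coef y k = coef u k"
    "(\<lambda>n. hnorm L (fourier_sum (trunc n) (coef u) - y)) \<longlonglongrightarrow> 0"
    using riesz_fischer[OF bessel(2)[OF u2 finite_trunc zero_notin_trunc]] by blast
  have "y - u = 0"
    using y u by (intro H_complete H_diff) (auto simp: coef_def[symmetric] coef_diff H_subset_L2)
  then show ?thesis using y(3) by simp
qed

lemma parseval: "u \<in> H L \<Longrightarrow> (\<lambda>n. \<Sum>k\<in>trunc n. (coef u k)\<^sup>2) \<longlonglongrightarrow> (hnorm L u)\<^sup>2"
  using tendsto_power[OF hnorm_tendsto[OF fourier_sum_L2 H_subset_L2 fourier_tendsto], of u 2]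
  by (simp add: hnorm_fourier_sum)

lemma H_eqI: "u \<in> H L \<Longrightarrow> v \<in> H L \<Longrightarrow> (\<And>k. k \<noteq> 0 \<Longrightarrow> coef u k = coef v k) \<Longrightarrow> u = v"
  using H_complete[of "u - v"] by (simp add: H_diff coef_def[symmetric] coef_diff H_subset_L2)

end

section \<open>Spectral decomposition of the Stokes operator\<close>

lemma set_integrable_scaleR_fld:
  assumes u: "u \<in> L2 L" and \<phi>: "continuous_on UNIV \<phi>"
  shows "set_integrable lborel (cell L) (\<lambda>x. \<phi> x *\<^sub>R fld u x)"
proof -
  have [measurable]: "\<phi> \<in> borel_measurable borel" using \<phi> by (rule borel_measurable_continuous_onI)
  obtain B where B: "\<And>x. x \<in> cell L \<Longrightarrow> \<bar>\<phi> x\<bar> \<le> B"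
    using compact_imp_bounded[OF compact_continuous_image[OF continuous_on_subset[OF \<phi>] compact_cell, of L]]
    by (auto simp: bounded_iff)
  have "integrable lborel (\<lambda>x. \<bar>B\<bar> *\<^sub>R (indicat_real (cell L) x *\<^sub>R fld u x))"
    using L2_imp_integrable_vec[OF u] by (intro integrable_scaleR_right) (simp add: set_integrable_def)
  then show ?thesis unfolding set_integrable_def
  proof (rule Bochner_Integration.integrable_bound)
    have "norm (indicat_real (cell L) x *\<^sub>R \<phi> x *\<^sub>R fld u x) \<le> norm (\<bar>B\<bar> *\<^sub>R (indicat_real (cell L) x *\<^sub>R fld u x))" for x
    proof (cases "x \<in> cell L")
      case True
      then have "\<bar>\<phi> x\<bar> * norm (fld u x) \<le> \<bar>B\<bar> * norm (fld u x)"
        using B[OF True] by (intro mult_right_mono) auto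
      then show ?thesis using True by simp
    qed simp
    then show "AE x in lborel. norm (indicat_real (cell L) x *\<^sub>R \<phi> x *\<^sub>R fld u x)
        \<le> norm (\<bar>B\<bar> *\<^sub>R (indicat_real (cell L) x *\<^sub>R fld u x))" by simp
  qed measurable
qed

lemma set_integral_inner_left:
  fixes f :: "'a \<Rightarrow> 'b::{real_inner, banach, second_countable_topology}"
  assumes "set_integrable M A f"
  shows "(LINT x:A|M. f x \<bullet> c) = (LINT x:A|M. f x) \<bullet> c"
  using integral_inner_left[of c M "\<lambda>x. indicat_real A x *\<^sub>R f x"] assms
  by (simp add: set_lebesgue_integral_def set_integrable_def)

lemma set_integral_scaleR_left_cell:
  fixes f :: "'a \<Rightarrow> real" and c :: "'b::{banach, second_countable_topology}"
  assumes "set_integrable M A f"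
  shows "(LINT x:A|M. f x *\<^sub>R c) = (LINT x:A|M. f x) *\<^sub>R c"
  using integral_scaleR_left[of c M "\<lambda>x. indicat_real A x *\<^sub>R f x"] assms
  by (simp add: set_lebesgue_integral_def set_integrable_def)

section \<open>Linearity of weak derivatives\<close>

lemma has_weak_pdiff_add:
  assumes u: "u \<in> L2 L" "has_weak_pdiff L i u g" and v: "v \<in> L2 L" "has_weak_pdiff L i v h"
  shows "has_weak_pdiff L i (u + v) (g + h)"
  unfolding has_weak_pdiff_def
proof (intro conjI ballI)
  have gh: "g \<in> L2 L" "h \<in> L2 L" using u v by (auto simp: has_weak_pdiff_def)
  then show "g + h \<in> L2 L" by (rule L2_add)
  fix \<phi> assume \<phi>: "\<phi> \<in> test_functions L"
  note t = test_functionD[OF \<phi>]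
  have [measurable]: "\<phi> \<in> borel_measurable borel" "pdiff i \<phi> \<in> borel_measurable borel"
    using t(2,3) by (auto intro: borel_measurable_continuous_onI)
  have "(LINT x:cell L|lborel. pdiff i \<phi> x *\<^sub>R fld (u + v) x) =
      (LINT x:cell L|lborel. pdiff i \<phi> x *\<^sub>R fld u x + pdiff i \<phi> x *\<^sub>R fld v x)"
    using fld_add[of u v] by (intro set_integral_cong_AE_cell) (auto simp: scaleR_add_right elim!: AE_mp)
  also have "\<dots> = - (LINT x:cell L|lborel. \<phi> x *\<^sub>R fld g x + \<phi> x *\<^sub>R fld h x)"
    using u v \<phi> set_integrable_scaleR_fld[OF u(1) t(3)] set_integrable_scaleR_fld[OF v(1) t(3)]
      set_integrable_scaleR_fld[OF gh(1) t(2)] set_integrable_scaleR_fld[OF gh(2) t(2)]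
    by (simp add: has_weak_pdiff_def set_integral_add)
  also have "(LINT x:cell L|lborel. \<phi> x *\<^sub>R fld g x + \<phi> x *\<^sub>R fld h x) = (LINT x:cell L|lborel. \<phi> x *\<^sub>R fld (g + h) x)"
    using fld_add[of g h] by (intro set_integral_cong_AE_cell) (auto simp: scaleR_add_right elim!: AE_mp)
  finally show "(LINT x:cell L|lborel. pdiff i \<phi> x *\<^sub>R fld (u + v) x) = - (LINT x:cell L|lborel. \<phi> x *\<^sub>R fld (g + h) x)" .
qed

lemma has_weak_pdiff_scaleR:
  assumes u: "has_weak_pdiff L i u g"
  shows "has_weak_pdiff L i (c *\<^sub>R u) (c *\<^sub>R g)"
  unfolding has_weak_pdiff_def
proof (intro conjI ballI)
  show "c *\<^sub>R g \<in> L2 L" using u by (simp add: has_weak_pdiff_def L2_scaleR)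
  fix \<phi> assume \<phi>: "\<phi> \<in> test_functions L"
  note t = test_functionD[OF \<phi>]
  have [measurable]: "\<phi> \<in> borel_measurable borel" "pdiff i \<phi> \<in> borel_measurable borel"
    using t(2,3) by (auto intro: borel_measurable_continuous_onI)
  have "(LINT x:cell L|lborel. pdiff i \<phi> x *\<^sub>R fld (c *\<^sub>R u) x) = (LINT x:cell L|lborel. c *\<^sub>R (pdiff i \<phi> x *\<^sub>R fld u x))"
    using fld_scaleR[of c u] by (intro set_integral_cong_AE_cell) (auto elim!: AE_mp)
  also have "\<dots> = - (LINT x:cell L|lborel. c *\<^sub>R (\<phi> x *\<^sub>R fld g x))"
    using u \<phi> by (simp add: has_weak_pdiff_def set_integral_scaleR_right del: scaleR_scaleR)
  also have "(LINT x:cell L|lborel. c *\<^sub>R (\<phi> x *\<^sub>R fld g x)) = (LINT x:cell L|lborel. \<phi> x *\<^sub>R fld (c *\<^sub>R g) x)"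
    using fld_scaleR[of c g] by (intro set_integral_cong_AE_cell) (auto elim!: AE_mp)
  finally show "(LINT x:cell L|lborel. pdiff i \<phi> x *\<^sub>R fld (c *\<^sub>R u) x) = - (LINT x:cell L|lborel. \<phi> x *\<^sub>R fld (c *\<^sub>R g) x)" .
qed

lemma has_weak_pdiff_zero: "has_weak_pdiff L i 0 0"
proof -
  have z: "(LINT x:cell L|lborel. f x *\<^sub>R fld 0 x) = 0" if [measurable]: "f \<in> borel_measurable borel" for f :: "real^2 \<Rightarrow> real"
  proof -
    have "(LINT x:cell L|lborel. f x *\<^sub>R fld 0 x) = (LINT x:cell L|lborel. 0)"
      using fld_zero by (intro set_integral_cong_AE_cell) (auto elim!: AE_mp)
    then show ?thesis by simp
  qed
  show ?thesis unfolding has_weak_pdiff_def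
    by (auto simp: L2_zero z borel_measurable_continuous_onI test_functionD)
qed

lemma has_weak_pdiff_sum:
  assumes "\<And>k. k \<in> K \<Longrightarrow> u k \<in> L2 L" "\<And>k. k \<in> K \<Longrightarrow> has_weak_pdiff L i (u k) (g k)"
  shows "has_weak_pdiff L i (\<Sum>k\<in>K. u k) (\<Sum>k\<in>K. g k)"
  using assms
  by (induction K rule: infinite_finite_induct) (auto intro: has_weak_pdiff_zero has_weak_pdiff_add L2_sum)

text \<open>The difference of two candidates lies in the span of \<open>S\<close> and is orthogonal
  to both of them, hence to itself. The set \<open>S\<close> need not be known to be closed or
  linear, as a candidate is supplied.\<close>

lemma orth_proj_eqI:
  assumes L: "L > 0" and S: "S \<subseteq> L2 L" and x: "x \<in> L2 L" and y: "y \<in> S"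
    and o: "\<And>h. h \<in> S \<Longrightarrow> hinner L (x - y) h = 0"
  shows "orth_proj L S x = y"
  unfolding orth_proj_def
proof (rule the_equality)
  show "y \<in> S \<and> (\<forall>h\<in>S. hinner L (x - y) h = 0)" using y o by blast
  fix z assume z: "z \<in> S \<and> (\<forall>h\<in>S. hinner L (x - z) h = 0)"
  have L2: "y \<in> L2 L" "z \<in> L2 L" using y z S by auto
  have "hinner L (z - y) (z - y) = (hinner L (x - y) z - hinner L (x - y) y) - (hinner L (x - z) z - hinner L (x - z) y)"
    using L2 x by (simp add: hinner_diff_left hinner_diff_right L2_diff)
  also have "\<dots> = 0" using y z o by simp
  finally have "hnorm L (z - y) = 0" by (simp add: hnorm_def)
  then show "z = y" using hnorm_diff_zero_iff[OF L L2(2,1)] by simp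
qed

context torus begin

definition mu :: "int \<times> int \<Rightarrow> real" where
  "mu k = (norm (freq k))\<^sup>2"

lemma mu_altdef: "mu k = (2 * pi / L)\<^sup>2 * ((of_int (fst k))\<^sup>2 + (of_int (snd k))\<^sup>2)"
  unfolding mu_def norm_freq_square by (simp add: freq_def power_mult_distrib distrib_left power_divide)

lemma mu_minus [simp]: "mu (- k) = mu k"
  by (simp add: mu_def freq_minus)

lemma mu_sum: "mu k = freq k $ 1 * freq k $ 1 + freq k $ 2 * freq k $ 2"
  by (simp only: mu_def norm_freq_square) (simp add: power2_eq_square)

text \<open>The least eigenvalue of the Stokes operator, belonging to the frequencies of length 1 in
  the integer lattice.\<close>

definition mu1 :: real where
  "mu1 = (2 * pi / L)\<^sup>2"

lemma mu1_pos: "mu1 > 0"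
  using L_pos by (simp add: mu1_def)

lemma mu1_le_mu: assumes "k \<noteq> 0" shows "mu1 \<le> mu k"
proof -
  obtain a b where k: "k = (a, b)" by (cases k)
  have "0 < a\<^sup>2 + b\<^sup>2" using assms k by (simp add: zero_prod_def sum_power2_gt_zero_iff)
  then have "(1::int) \<le> a\<^sup>2 + b\<^sup>2" by simp
  then have "(1::real) \<le> (of_int a)\<^sup>2 + (of_int b)\<^sup>2" by (metis of_int_1 of_int_add of_int_le_iff of_int_power)
  then have "mu1 * 1 \<le> mu1 * ((of_int a)\<^sup>2 + (of_int b)\<^sup>2)" using mu1_pos by (intro mult_left_mono) auto
  then show ?thesis by (simp add: mu_altdef k mu1_def)
qed

lemma mu_pos: "k \<noteq> 0 \<Longrightarrow> mu k > 0"
  using mu1_le_mu mu1_pos by (meson order_less_le_trans)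

text \<open>Two weak derivatives have the same integrals against all modes, so they agree by
  completeness. This makes the definite description usable.\<close>

lemma weak_pdiff_eqI:
  assumes g: "has_weak_pdiff L i u g" shows "weak_pdiff L i u = g"
  unfolding weak_pdiff_def
proof (rule the_equality)
  show "has_weak_pdiff L i u g" by (rule g)
  fix h assume h: "has_weak_pdiff L i u h"
  have L2: "g \<in> L2 L" "h \<in> L2 L" using g h by (auto simp: has_weak_pdiff_def)
  have "h - g = 0"
  proof (rule L2_eq_zeroI)
    show "h - g \<in> L2 L" using L2 by (simp add: L2_diff)
    fix j k
    have i: "set_integrable lborel (cell L) (\<lambda>x. trig k x *\<^sub>R fld v x)" if "v \<in> L2 L" for v
      by (rule set_integrable_scaleR_fld[OF that trig_continuous])
    have "(LINT x:cell L|lborel. trig k x *\<^sub>R fld g x) = (LINT x:cell L|lborel. trig k x *\<^sub>R fld h x)"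
      using g h trig_test_function[of k] by (simp add: has_weak_pdiff_def)
    then have "(LINT x:cell L|lborel. trig k x *\<^sub>R fld h x - trig k x *\<^sub>R fld g x) \<bullet> axis j 1 = 0"
      using i[OF L2(1)] i[OF L2(2)] by (simp add: set_integral_diff)
    then have "(LINT x:cell L|lborel. (trig k x *\<^sub>R fld h x - trig k x *\<^sub>R fld g x) \<bullet> axis j 1) = 0"
      by (subst set_integral_inner_left) (auto intro!: set_integral_diff(1) i L2)
    also have "(LINT x:cell L|lborel. (trig k x *\<^sub>R fld h x - trig k x *\<^sub>R fld g x) \<bullet> axis j 1) =
        (LINT x:cell L|lborel. fld (h - g) x $ j * trig k x)"
    proof (rule set_integral_cong_AE_cell)
      show "AE x in lborel. (trig k x *\<^sub>R fld h x - trig k x *\<^sub>R fld g x) \<bullet> axis j 1 = fld (h - g) x $ j * trig k x"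
        using fld_diff[of h g] by eventually_elim (simp add: inner_axis right_diff_distrib mult.commute)
    qed measurable
    finally show "(LINT x:cell L|lborel. fld (h - g) x $ j * trig k x) = 0" .
  qed
  then show "h = g" by simp
qed

lemma pol_minus: "pol (- k) = - pol k"
  by (simp add: pol_def freq_minus vec_eq_iff forall_2)

text \<open>Differentiation turns mode \<open>k\<close> into mode \<open>- k\<close>, and
  \<open>pol\<close> is odd in \<open>k\<close>; the minus sign comes from the latter.\<close>

lemma has_weak_pdiff_ek: "has_weak_pdiff L i (ek k) ((- freq k $ i) *\<^sub>R ek (- k))"
  unfolding has_weak_pdiff_def
proof (intro conjI ballI)
  show "(- freq k $ i) *\<^sub>R ek (- k) \<in> L2 L" by (rule L2_scaleR[OF ek_L2])
  fix \<phi> assume \<phi>: "\<phi> \<in> test_functions L"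
  note t = test_functionD[OF \<phi>]
  have [measurable]: "\<phi> \<in> borel_measurable borel" "pdiff i \<phi> \<in> borel_measurable borel"
    using t(2,3) by (auto intro: borel_measurable_continuous_onI)
  have "(LINT x:cell L|lborel. pdiff i \<phi> x *\<^sub>R fld (ek k) x) =
      (LINT x:cell L|lborel. (pdiff i \<phi> x * trig k x) *\<^sub>R ((1 / L) *\<^sub>R pol k))"
    using fld_ek[of k] by (intro set_integral_cong_AE_cell) (auto simp: efun_def elim!: AE_mp)
  also have "\<dots> = (LINT x:cell L|lborel. pdiff i \<phi> x * trig k x) *\<^sub>R ((1 / L) *\<^sub>R pol k)"
    by (rule set_integral_scaleR_left_cell) (intro set_integrable_cell continuous_intros t trig_continuous)
  also have "\<dots> = - ((LINT x:cell L|lborel. \<phi> x * pdiff i (trig k) x) *\<^sub>R ((1 / L) *\<^sub>R pol k))"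
    by (simp add: integration_by_parts[OF L_pos \<phi> trig_test_function])
  also have "(LINT x:cell L|lborel. \<phi> x * pdiff i (trig k) x) *\<^sub>R ((1 / L) *\<^sub>R pol k) =
     (LINT x:cell L|lborel. (\<phi> x * pdiff i (trig k) x) *\<^sub>R ((1 / L) *\<^sub>R pol k))"
    by (rule set_integral_scaleR_left_cell[symmetric])
       (intro set_integrable_cell continuous_intros t test_functionD[OF trig_test_function])
  also have "\<dots> = (LINT x:cell L|lborel. \<phi> x *\<^sub>R fld ((- freq k $ i) *\<^sub>R ek (- k)) x)"
    using fld_ek[of "- k"] fld_scaleR[of "- freq k $ i" "ek (- k)"]
    by (intro set_integral_cong_AE_cell) (auto simp: efun_def pdiff_trig pol_minus elim!: AE_mp)
  finally show "(LINT x:cell L|lborel. pdiff i \<phi> x *\<^sub>R fld (ek k) x) =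
     - (LINT x:cell L|lborel. \<phi> x *\<^sub>R fld ((- freq k $ i) *\<^sub>R ek (- k)) x)" .
qed

lemma weak_pdiff_ek: "weak_pdiff L i (ek k) = (- freq k $ i) *\<^sub>R ek (- k)"
  by (rule weak_pdiff_eqI[OF has_weak_pdiff_ek])

lemma has_weak_pdiff_fourier_sum:
  "has_weak_pdiff L i (fourier_sum K a) (fourier_sum (uminus ` K) (\<lambda>k. freq k $ i * a (- k)))"
proof -
  have "has_weak_pdiff L i (\<Sum>k\<in>K. a k *\<^sub>R ek k) (\<Sum>k\<in>K. a k *\<^sub>R ((- freq k $ i) *\<^sub>R ek (- k)))"
    by (intro has_weak_pdiff_sum has_weak_pdiff_scaleR has_weak_pdiff_ek L2_scaleR ek_L2)
  also have "(\<Sum>k\<in>K. a k *\<^sub>R ((- freq k $ i) *\<^sub>R ek (- k))) = fourier_sum (uminus ` K) (\<lambda>k. freq k $ i * a (- k))"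
    unfolding fourier_sum_def by (subst sum.reindex) (auto simp: freq_minus mult.commute inj_on_def)
  finally show ?thesis by (simp add: fourier_sum_def)
qed

lemma fourier_sum_sobolev: "fourier_sum K a \<in> sobolev L n"
proof (induction n arbitrary: K a)
  case (Suc n)
  then show ?case using has_weak_pdiff_fourier_sum[of _ K a] fourier_sum_L2 by auto
qed (simp add: fourier_sum_L2)

lemma fourier_sum_stokes_dom: "fourier_sum K a \<in> stokes_dom L"
  by (simp add: stokes_dom_def fourier_sum_H fourier_sum_sobolev del: sobolev.simps)

lemma laplacian_fourier_sum: "laplacian L (fourier_sum K a) = - fourier_sum K (\<lambda>k. mu k * a k)"
proof -
  have "weak_pdiff L i (weak_pdiff L i (fourier_sum K a)) = fourier_sum K (\<lambda>k. - (freq k $ i * freq k $ i) * a k)" for i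
    using weak_pdiff_eqI[OF has_weak_pdiff_fourier_sum[of i "uminus ` K" "\<lambda>k. freq k $ i * a (- k)"]]
    by (simp add: weak_pdiff_eqI[OF has_weak_pdiff_fourier_sum] freq_minus image_image mult.assoc)
  then show ?thesis
    by (simp add: laplacian_def sum_2 mu_sum fourier_sum_def sum_negf sum.distrib scaleR_add_left distrib_right)
qed

text \<open>The projection is built from the coefficients of \<open>x\<close>. The remainder is
  orthogonal to every finite sum of modes, hence to their limits, which are all of H.\<close>

lemma leray_props:
  assumes x: "x \<in> L2 L"
  shows "leray L x \<in> H L" "k \<noteq> 0 \<Longrightarrow> coef (leray L x) k = coef x k"
proof -
  obtain y where y: "y \<in> H L" "\<And>k. k \<noteq> 0 \<Longrightarrow> coef y k = coef x k"
    using riesz_fischer[OF bessel(2)[OF x finite_trunc zero_notin_trunc]] by blast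
  have "leray L x = y" unfolding leray_def
  proof (rule orth_proj_eqI[OF L_pos _ x y(1)])
    show "H L \<subseteq> L2 L" using H_subset_L2 by blast
    fix h assume h: "h \<in> H L"
    have xy: "x - y \<in> L2 L" using x y by (simp add: L2_diff H_subset_L2)
    have "coef h k * coef (x - y) k = 0" if "k \<in> trunc n" for n k
    proof -
      have "k \<noteq> 0" using that by (auto simp: trunc_def)
      then show ?thesis using x y by (simp add: coef_diff H_subset_L2)
    qed
    then have "hinner L (fourier_sum (trunc n) (coef h)) (x - y) = 0" for n
      unfolding hinner_commute[of L _ "x - y"] hinner_fourier_sum_right[OF xy] by (intro sum.neutral) blast
    then have "hinner L h (x - y) = 0"
      using hinner_tendsto[OF fourier_sum_L2 H_subset_L2[OF h] xy fourier_tendsto[OF h]]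
      by (simp add: LIMSEQ_const_iff)
    then show "hinner L (x - y) h = 0" by (simp add: hinner_commute)
  qed
  with y show "leray L x \<in> H L" "k \<noteq> 0 \<Longrightarrow> coef (leray L x) k = coef x k" by auto
qed

lemma leray_H: "x \<in> H L \<Longrightarrow> leray L x = x"
  using leray_props[of x] by (intro H_eqI) (auto simp: H_subset_L2)

lemma stokes_fourier_sum: "stokes L (fourier_sum K a) = fourier_sum K (\<lambda>k. mu k * a k)"
  by (simp add: stokes_def laplacian_fourier_sum leray_H H_uminus fourier_sum_H)

lemma ek_fourier_sum: "ek k = fourier_sum {k} (\<lambda>_. 1)"
  by (simp add: fourier_sum_def)

lemma stokes_ek: "stokes L (ek k) = mu k *\<^sub>R ek k"
  using stokes_fourier_sum[of "{k}" "\<lambda>_. 1"] by (simp add: fourier_sum_def)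

lemma ek_stokes_dom: "ek k \<in> stokes_dom L"
  unfolding ek_fourier_sum by (rule fourier_sum_stokes_dom)

lemma coef_weak_pdiff:
  assumes u: "u \<in> L2 L" and g: "has_weak_pdiff L i u g"
  shows "coef g k = freq k $ i * coef u (- k)"
proof -
  have g2: "g \<in> L2 L" using g by (simp add: has_weak_pdiff_def)
  have coef: "coef v k = (LINT x:cell L|lborel. trig k x *\<^sub>R fld v x) \<bullet> ((1 / L) *\<^sub>R pol k)" if "v \<in> L2 L" for v k
  proof -
    have "coef v k = (LINT x:cell L|lborel. (trig k x *\<^sub>R fld v x) \<bullet> ((1 / L) *\<^sub>R pol k))"
      by (simp add: coef_def hinner_ek efun_def)
    also have "\<dots> = (LINT x:cell L|lborel. trig k x *\<^sub>R fld v x) \<bullet> ((1 / L) *\<^sub>R pol k)"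
      by (rule set_integral_inner_left[OF set_integrable_scaleR_fld[OF that trig_continuous]])
    finally show ?thesis .
  qed
  have "(LINT x:cell L|lborel. trig k x *\<^sub>R fld g x) = - (LINT x:cell L|lborel. pdiff i (trig k) x *\<^sub>R fld u x)"
    using g trig_test_function[of k] by (simp add: has_weak_pdiff_def)
  also have "\<dots> = - (freq k $ i *\<^sub>R (LINT x:cell L|lborel. trig (- k) x *\<^sub>R fld u x))"
    unfolding pdiff_trig scaleR_scaleR[symmetric] set_integral_scaleR_right ..
  finally show ?thesis by (simp add: coef[OF g2] coef[OF u] pol_minus)
qed

lemma coef_add: "u \<in> L2 L \<Longrightarrow> v \<in> L2 L \<Longrightarrow> coef (u + v) k = coef u k + coef v k"
  by (simp add: coef_def hinner_add_left ek_L2)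

text \<open>The domain contains more than finite sums, so the operator is computed on coefficients,
  by applying the weak derivative rule twice; the two reflections of \<open>k\<close> cancel. This
  excludes eigenvectors other than combinations of modes.\<close>

lemma coef_stokes:
  assumes u: "u \<in> stokes_dom L" and k: "k \<noteq> 0"
  shows "coef (stokes L u) k = mu k * coef u k"
proof -
  have u2: "u \<in> L2 L" using u by (simp add: stokes_dom_def H_subset_L2 del: sobolev.simps)
  have "u \<in> sobolev L (Suc (Suc 0))" using u by (simp add: stokes_dom_def numeral_2_eq_2)
  then have "\<forall>i. \<exists>g h. has_weak_pdiff L i u g \<and> g \<in> L2 L \<and> has_weak_pdiff L i g h \<and> h \<in> L2 L"
    by simp blast
  then obtain g h where g: "\<And>i. has_weak_pdiff L i u (g i)" "\<And>i. g i \<in> L2 L"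
    and h: "\<And>i. has_weak_pdiff L i (g i) (h i)" "\<And>i. h i \<in> L2 L" by metis
  have lap: "laplacian L u = h 1 + h 2"
    by (simp add: laplacian_def sum_2 weak_pdiff_eqI[OF g(1)] weak_pdiff_eqI[OF h(1)])
  have ch: "coef (h i) k = - (freq k $ i * freq k $ i) * coef u k" for i
    using coef_weak_pdiff[OF g(2) h(1), of i k] coef_weak_pdiff[OF u2 g(1), of i "- k"]
    by (simp add: freq_minus)
  have l2: "laplacian L u \<in> L2 L" unfolding lap by (intro L2_add h)
  have "coef (laplacian L u) k = - mu k * coef u k"
    unfolding lap by (simp add: coef_add h ch mu_sum algebra_simps)
  then have "coef (leray L (laplacian L u)) k = - mu k * coef u k"
    using leray_props(2)[OF l2 k] by simp
  then show ?thesis by (simp add: stokes_def coef_def)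
qed

section \<open>Eigenspaces and fractional powers\<close>

definition level :: "real \<Rightarrow> (int \<times> int) set" where
  "level m = {k. k \<noteq> 0 \<and> mu k = m}"

lemma finite_level: "finite (level m)"
proof -
  define N where "N = \<lceil>m / mu1\<rceil>"
  have "level m \<subseteq> {- N..N} \<times> {- N..N}"
  proof
    fix k assume "k \<in> level m"
    then have k: "mu k = m" by (simp add: level_def)
    obtain a b where ab: "k = (a, b)" by (cases k)
    have "mu1 * ((of_int a)\<^sup>2 + (of_int b)\<^sup>2) = m"
      using k by (simp add: ab mu_altdef mu1_def)
    then have "(of_int a)\<^sup>2 + (of_int b)\<^sup>2 = m / mu1"
      using mu1_pos by (simp add: eq_divide_eq mult.commute)
    then have "of_int (a\<^sup>2 + b\<^sup>2) \<le> (of_int N :: real)" by (simp add: N_def)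
    then have "a\<^sup>2 + b\<^sup>2 \<le> N" by (simp only: of_int_le_iff)
    moreover have "\<bar>c\<bar> \<le> c\<^sup>2" for c :: int
      using mult_left_mono[of 1 "\<bar>c\<bar>" "\<bar>c\<bar>"] by (cases "c = 0") (simp_all add: power2_eq_square)
    moreover have "0 \<le> a\<^sup>2" "0 \<le> b\<^sup>2" by simp_all
    ultimately have "\<bar>a\<bar> \<le> N" "\<bar>b\<bar> \<le> N" by (smt (verit))+
    then show "k \<in> {- N..N} \<times> {- N..N}" by (auto simp: ab)
  qed
  then show ?thesis by (rule finite_subset) simp
qed

lemma zero_notin_level: "0 \<notin> level m"
  by (simp add: level_def)

lemma eigenspace_coef:
  assumes h: "h \<in> stokes_eigenspace L m" and k: "k \<noteq> 0" "k \<notin> level m"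
  shows "coef h k = 0"
proof -
  have "mu k * coef h k = m * coef h k"
    using coef_stokes[of h k] h k(1) by (auto simp: stokes_eigenspace_def coef_def hinner_scaleR_left)
  moreover have "mu k \<noteq> m" using k by (simp add: level_def)
  ultimately show ?thesis by simp
qed

text \<open>The eigenspace of \<open>m\<close> is the finite span of the modes in
  \<open>level m\<close>, since all other coefficients of an eigenvector vanish. If \<open>m\<close>
  is no eigenvalue, the level is empty and both sides are 0.\<close>

lemma stokes_proj_eq:
  assumes x: "x \<in> L2 L" shows "stokes_proj L m x = fourier_sum (level m) (coef x)"
  unfolding stokes_proj_def
proof (rule orth_proj_eqI[OF L_pos _ x])
  show "stokes_eigenspace L m \<subseteq> L2 L"
    by (auto simp: stokes_eigenspace_def stokes_dom_def H_subset_L2 simp del: sobolev.simps)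
  have "fourier_sum (level m) (\<lambda>k. mu k * coef x k) = m *\<^sub>R fourier_sum (level m) (coef x)"
    unfolding fourier_sum_def scaleR_sum_right by (intro sum.cong) (auto simp: level_def)
  then show "fourier_sum (level m) (coef x) \<in> stokes_eigenspace L m"
    by (simp add: stokes_eigenspace_def fourier_sum_stokes_dom stokes_fourier_sum)
  fix h assume h: "h \<in> stokes_eigenspace L m"
  then have hH: "h \<in> H L" by (simp add: stokes_eigenspace_def stokes_dom_def)
  have "h = fourier_sum (level m) (coef h)"
    using hH eigenspace_coef[OF h] by (intro H_eqI fourier_sum_H) (auto simp: coef_fourier_sum finite_level)
  then have "hinner L (x - fourier_sum (level m) (coef x)) h =
      (\<Sum>k\<in>level m. coef h k * coef (x - fourier_sum (level m) (coef x)) k)"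
    using hinner_fourier_sum_right[of "x - fourier_sum (level m) (coef x)" "level m" "coef h"]
    by (simp add: L2_diff fourier_sum_L2 x)
  also have "\<dots> = 0"
  proof (intro sum.neutral ballI)
    fix k assume k: "k \<in> level m"
    then have "k \<noteq> 0" by (simp add: level_def)
    then show "coef h k * coef (x - fourier_sum (level m) (coef x)) k = 0"
      using k x by (simp add: coef_diff fourier_sum_L2 coef_fourier_sum finite_level)
  qed
  finally show "hinner L (x - fourier_sum (level m) (coef x)) h = 0" .
qed

lemma mu_eigenvalue: "k \<noteq> 0 \<Longrightarrow> mu k \<in> stokes_eigenvalues L"
proof -
  assume k: "k \<noteq> 0"
  then have "hinner L (ek k) (ek k) \<noteq> 0" by (simp add: hinner_ek_ek)
  then have "ek k \<noteq> 0" by auto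
  then show ?thesis using stokes_ek[of k] ek_stokes_dom[of k] by (auto simp: stokes_eigenvalues_def stokes_eigenspace_def)
qed

text \<open>The domain is given by a sum over eigenvalues, whereas the estimates run over
  frequencies. Grouping a truncation by eigenvalue, each group is part of a level, and the whole
  level is one summand of the defining sum.\<close>

lemma stokes_pow_dom_bound:
  assumes x: "x \<in> stokes_pow_dom L \<theta>"
  shows "\<exists>C. \<forall>n. (\<Sum>k\<in>trunc n. (mu k powr \<theta> * coef x k)\<^sup>2) \<le> C"
proof -
  have x2: "x \<in> L2 L" using x by (simp add: stokes_pow_dom_def H_subset_L2)
  define f where "f = (\<lambda>m. m powr (2 * \<theta>) * (hnorm L (stokes_proj L m x))\<^sup>2)"
  have f: "f summable_on stokes_eigenvalues L" using x by (simp add: stokes_pow_dom_def f_def)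
  have "(\<Sum>k\<in>trunc n. (mu k powr \<theta> * coef x k)\<^sup>2) \<le> infsum f (stokes_eigenvalues L)" for n
  proof -
    have "(\<Sum>k\<in>trunc n. (mu k powr \<theta> * coef x k)\<^sup>2) =
        (\<Sum>m\<in>mu ` trunc n. \<Sum>k | k \<in> trunc n \<and> mu k = m. (mu k powr \<theta> * coef x k)\<^sup>2)"
      by (rule sum.group[symmetric]) auto
    also have "\<dots> \<le> (\<Sum>m\<in>mu ` trunc n. f m)"
    proof (rule sum_mono)
      fix m assume "m \<in> mu ` trunc n"
      have p: "m powr (2 * \<theta>) = (m powr \<theta>)\<^sup>2"
        by (metis mult_2 powr_add power2_eq_square)
      have "(\<Sum>k | k \<in> trunc n \<and> mu k = m. (mu k powr \<theta> * coef x k)\<^sup>2) \<le> (\<Sum>k\<in>level m. (m powr \<theta> * coef x k)\<^sup>2)"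
      proof -
        have "(\<Sum>k | k \<in> trunc n \<and> mu k = m. (mu k powr \<theta> * coef x k)\<^sup>2) = (\<Sum>k | k \<in> trunc n \<and> mu k = m. (m powr \<theta> * coef x k)\<^sup>2)"
          by (rule sum.cong) auto
        also have "\<dots> \<le> (\<Sum>k\<in>level m. (m powr \<theta> * coef x k)\<^sup>2)"
          using finite_level by (intro sum_mono2) (auto simp: level_def trunc_def)
        finally show ?thesis .
      qed
      also have "\<dots> = f m"
        using hnorm_fourier_sum[OF finite_level zero_notin_level, of m "coef x"]
        by (simp add: f_def p stokes_proj_eq[OF x2] power_mult_distrib sum_distrib_left)
      finally show "(\<Sum>k | k \<in> trunc n \<and> mu k = m. (mu k powr \<theta> * coef x k)\<^sup>2) \<le> f m" .
    qed
    also have "\<dots> \<le> infsum f (stokes_eigenvalues L)"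
      using mu_eigenvalue by (intro finite_sum_le_infsum f) (auto simp: f_def trunc_def)
    finally show ?thesis .
  qed
  then show ?thesis by blast
qed

text \<open>The spectral conditions fix every coefficient, because each nonzero \<open>k\<close>
  lies in \<open>level (mu k)\<close>; hence at most one element satisfies them. Riesz-Fischer
  provides one.\<close>

lemma stokes_pow_props:
  assumes x: "x \<in> stokes_pow_dom L \<theta>"
  shows "stokes_pow L \<theta> x \<in> H L" "k \<noteq> 0 \<Longrightarrow> coef (stokes_pow L \<theta> x) k = mu k powr \<theta> * coef x k"
proof -
  have x2: "x \<in> L2 L" using x by (simp add: stokes_pow_dom_def H_subset_L2)
  obtain C where "\<And>n. (\<Sum>k\<in>trunc n. (mu k powr \<theta> * coef x k)\<^sup>2) \<le> C"
    using stokes_pow_dom_bound[OF x] by blast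
  from riesz_fischer[OF this] obtain y where y: "y \<in> H L" "\<And>k. k \<noteq> 0 \<Longrightarrow> coef y k = mu k powr \<theta> * coef x k"
    by blast
  have "stokes_pow L \<theta> x = y" unfolding stokes_pow_def
  proof (rule the_equality)
    have "fourier_sum (level m) (coef y) = m powr \<theta> *\<^sub>R fourier_sum (level m) (coef x)" for m
      unfolding fourier_sum_def scaleR_sum_right by (intro sum.cong) (auto simp: level_def y)
    then show "y \<in> H L \<and> (\<forall>\<mu>\<in>stokes_eigenvalues L. stokes_proj L \<mu> y = \<mu> powr \<theta> *\<^sub>R stokes_proj L \<mu> x)"
      using y(1) by (simp add: stokes_proj_eq x2 H_subset_L2)
    fix z assume z: "z \<in> H L \<and> (\<forall>\<mu>\<in>stokes_eigenvalues L. stokes_proj L \<mu> z = \<mu> powr \<theta> *\<^sub>R stokes_proj L \<mu> x)"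
    show "z = y"
    proof (rule H_eqI)
      fix k :: "int \<times> int" assume k: "k \<noteq> 0"
      then have zk: "k \<in> level (mu k)" by (simp add: level_def)
      have "coef (fourier_sum (level (mu k)) (coef z)) k = mu k powr \<theta> * coef (fourier_sum (level (mu k)) (coef x)) k"
        using z mu_eigenvalue[OF k] by (simp add: stokes_proj_eq[symmetric] x2 H_subset_L2 coef_def hinner_scaleR_left)
      then show "coef z k = coef y k"
        using k y(2)[OF k] zk by (simp add: coef_fourier_sum finite_level)
    qed (use z y in auto)
  qed
  with y show "stokes_pow L \<theta> x \<in> H L" "k \<noteq> 0 \<Longrightarrow> coef (stokes_pow L \<theta> x) k = mu k powr \<theta> * coef x k" by auto
qed

end

section \<open>The trilinear form\<close>

lemma vec2_measurable_comp [measurable (raw)]: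
  assumes [measurable]: "f \<in> borel_measurable M" "g \<in> borel_measurable M"
  shows "(\<lambda>x. vec2 (f x) (g x)) \<in> borel_measurable M"
  unfolding vec2_conv_axis by measurable

lemma times_differentiable_Suc: "times_differentiable (Suc n) f \<Longrightarrow> times_differentiable n f"
proof (induction n arbitrary: f)
  case 0
  then show ?case
    by (auto intro!: continuous_at_imp_continuous_on differentiable_imp_continuous_within)
qed auto

lemma times_differentiable_mult:
  "times_differentiable n f \<Longrightarrow> times_differentiable n g \<Longrightarrow> times_differentiable n (\<lambda>x. f x * g x)"
proof (induction n arbitrary: f g)
  case (Suc n)
  have fg: "times_differentiable n f" "times_differentiable n g" using Suc.prems times_differentiable_Suc by blast+
  have "pdiff i (\<lambda>x. f x * g x) = (\<lambda>x. f x * pdiff i g x + pdiff i f x * g x)" for i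
    using Suc.prems by (intro ext pdiff_mult) auto
  then show ?case using Suc.prems fg
    by (auto intro!: differentiable_mult times_differentiable_add Suc.IH)
qed (auto intro: continuous_intros)

lemma test_functions_mult:
  "f \<in> test_functions L \<Longrightarrow> g \<in> test_functions L \<Longrightarrow> (\<lambda>x. f x * g x) \<in> test_functions L"
  by (auto simp: test_functions_def intro: times_differentiable_mult)

text \<open>Integrability is not assumed: otherwise the left-hand integral has the default value
  0.\<close>

lemma abs_set_integral_le_nn_integral:
  fixes f :: "'a \<Rightarrow> real"
  shows "ennreal \<bar>LINT x:A|M. f x\<bar> \<le> (\<integral>\<^sup>+x\<in>A. ennreal \<bar>f x\<bar> \<partial>M)"
proof (cases "set_integrable M A f")
  case True
  have "ennreal (norm (LINT x|M. indicat_real A x *\<^sub>R f x)) \<le> (\<integral>\<^sup>+x. ennreal (norm (indicat_real A x *\<^sub>R f x)) \<partial>M)"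
    by (rule integral_norm_bound_ennreal) (use True in \<open>simp add: set_integrable_def\<close>)
  also have "(\<integral>\<^sup>+x. ennreal (norm (indicat_real A x *\<^sub>R f x)) \<partial>M) = (\<integral>\<^sup>+x\<in>A. ennreal \<bar>f x\<bar> \<partial>M)"
    by (intro nn_integral_cong) (auto simp: indicator_def)
  finally show ?thesis by (simp add: set_lebesgue_integral_def)
next
  case False
  then show ?thesis
    by (simp add: set_lebesgue_integral_def set_integrable_def not_integrable_integral_eq)
qed

text \<open>With the bounds given as squares of reals, no square root of an extended real has to be
  taken.\<close>

lemma cauchy_schwarz_set_nn_integral:
  assumes [measurable]: "f \<in> borel_measurable M" "g \<in> borel_measurable M" "A \<in> sets M"
    and f: "(\<integral>\<^sup>+x\<in>A. ennreal ((f x)\<^sup>2) \<partial>M) \<le> ennreal (a\<^sup>2)" and g: "(\<integral>\<^sup>+x\<in>A. ennreal ((g x)\<^sup>2) \<partial>M) \<le> ennreal (b\<^sup>2)"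
    and nn: "\<And>x. 0 \<le> f x" "\<And>x. 0 \<le> g x" "0 \<le> a" "0 \<le> b"
  shows "(\<integral>\<^sup>+x\<in>A. ennreal (f x * g x) \<partial>M) \<le> ennreal (a * b)"
proof -
  let ?f = "\<lambda>x. ennreal (f x) * indicator A x" and ?g = "\<lambda>x. ennreal (g x) * indicator A x"
  have sq: "(\<integral>\<^sup>+x. (ennreal (h x) * indicator A x)\<^sup>2 \<partial>M) = (\<integral>\<^sup>+x\<in>A. ennreal ((h x)\<^sup>2) \<partial>M)" if "\<And>x. 0 \<le> h x" for h
    using that by (intro nn_integral_cong) (auto simp: indicator_def power2_eq_square ennreal_mult)
  have "(\<integral>\<^sup>+x\<in>A. ennreal (f x * g x) \<partial>M)\<^sup>2 = (\<integral>\<^sup>+x. ?f x * ?g x \<partial>M)\<^sup>2"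
    using nn by (intro arg_cong[where f="\<lambda>x. x\<^sup>2"] nn_integral_cong) (auto simp: indicator_def ennreal_mult)
  also have "\<dots> \<le> (\<integral>\<^sup>+x. (?f x)\<^sup>2 \<partial>M) * (\<integral>\<^sup>+x. (?g x)\<^sup>2 \<partial>M)"
    by (rule Cauchy_Schwarz_nn_integral) measurable
  also have "\<dots> \<le> ennreal (a\<^sup>2) * ennreal (b\<^sup>2)"
    unfolding sq[OF nn(1)] sq[OF nn(2)] by (intro mult_mono f g) auto
  also have "\<dots> = (ennreal (a * b))\<^sup>2"
    using nn by (simp add: power2_eq_square ennreal_mult[symmetric] ac_simps)
  finally show ?thesis
    using nn by (cases "\<integral>\<^sup>+x\<in>A. ennreal (f x * g x) \<partial>M" rule: ennreal_cases)
      (auto simp: ennreal_power top_unique intro!: ennreal_leI elim: power2_le_imp_le)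
qed

text \<open>The value at \<open>s\<close> exceeds the value at any \<open>t\<close> by at most the
  total variation; averaging over \<open>t\<close> gives the claim. This one-dimensional bound of a
  supremum by integrals is the germ of Ladyzhenskaya's inequality.\<close>

lemma le_average_plus_variation:
  assumes L: "L > 0" and d: "\<And>t. (f has_real_derivative f' t) (at t)" and c: "continuous_on UNIV f'"
    and nn: "\<And>t. 0 \<le> f t" and s: "s \<in> {0..L}"
  shows "ennreal (f s) \<le> ennreal (1 / L) * (\<integral>\<^sup>+t\<in>{0..L}. ennreal (f t) \<partial>lborel) + (\<integral>\<^sup>+t\<in>{0..L}. ennreal \<bar>f' t\<bar> \<partial>lborel)"
proof -
  have fc: "continuous_on UNIV f" using d by (intro DERIV_continuous_on) (auto intro: has_field_derivative_at_within)
  have [measurable]: "f \<in> borel_measurable borel" "f' \<in> borel_measurable borel"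
    using fc c by (auto intro: borel_measurable_continuous_onI)
  define D where "D = (\<integral>\<^sup>+t\<in>{0..L}. ennreal \<bar>f' t\<bar> \<partial>lborel)"
  have inc: "ennreal \<bar>f b - f a\<bar> \<le> D" if "0 \<le> a" "a \<le> b" "b \<le> L" for a b
  proof -
    have "(LINT t:{a..b}|lborel. f' t) = f b - f a"
      using integral_FTC_Icc_real[OF \<open>a \<le> b\<close>, of f f'] d c
      by (simp add: set_lebesgue_integral_def mult.commute continuous_on_eq_continuous_at)
    then have "ennreal \<bar>f b - f a\<bar> \<le> (\<integral>\<^sup>+t\<in>{a..b}. ennreal \<bar>f' t\<bar> \<partial>lborel)"
      using abs_set_integral_le_nn_integral[of lborel "{a..b}" f'] by simp
    also have "\<dots> \<le> D" unfolding D_def using that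
      by (intro nn_integral_mono) (auto simp: indicator_def)
    finally show ?thesis .
  qed
  have le: "ennreal (f s) \<le> ennreal (f t) + D" if t: "t \<in> {0..L}" for t
  proof -
    have "ennreal (f s) \<le> ennreal (f t + \<bar>f s - f t\<bar>)" by (intro ennreal_leI) simp
    also have "\<dots> = ennreal (f t) + ennreal \<bar>f s - f t\<bar>" using nn by simp
    also have "\<dots> \<le> ennreal (f t) + D"
      using inc[of s t] inc[of t s] s t by (intro add_left_mono) (cases "s \<le> t", auto simp: abs_minus_commute)
    finally show ?thesis .
  qed
  have "ennreal (f s) * ennreal L = (\<integral>\<^sup>+t\<in>{0..L}. ennreal (f s) \<partial>lborel)"
    using L by (subst nn_integral_cmult_indicator) auto
  also have "\<dots> \<le> (\<integral>\<^sup>+t. (ennreal (f t) * indicator {0..L} t + D * indicator {0..L} t) \<partial>lborel)"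
    using le by (intro nn_integral_mono) (auto simp: indicator_def)
  also have "\<dots> = (\<integral>\<^sup>+t\<in>{0..L}. ennreal (f t) \<partial>lborel) + D * ennreal L"
    using L by (subst nn_integral_add) (auto simp: nn_integral_cmult_indicator)
  finally have "ennreal (1 / L) * (ennreal (f s) * ennreal L) \<le> ennreal (1 / L) * ((\<integral>\<^sup>+t\<in>{0..L}. ennreal (f t) \<partial>lborel) + D * ennreal L)"
    by (rule mult_left_mono) simp
  moreover have "ennreal (1 / L) * (a * ennreal L) = a" for a
    using L by (metis ennreal_1 ennreal_mult' less_imp_le mult.left_commute mult.right_neutral nonzero_eq_divide_eq less_irrefl)
  ultimately show ?thesis by (simp add: distrib_left D_def)
qed

context torus begin

text \<open>A continuous representative of the class \<open>fourier_sum K a\<close>, so that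
  derivatives can be taken pointwise and restrictions to lines make sense.\<close>

definition trig_field :: "(int \<times> int) set \<Rightarrow> (int \<times> int \<Rightarrow> real) \<Rightarrow> real^2 \<Rightarrow> real^2" where
  "trig_field K a x = (\<Sum>k\<in>K. a k *\<^sub>R efun k x)"

definition trig_deriv :: "(int \<times> int) set \<Rightarrow> (int \<times> int \<Rightarrow> real) \<Rightarrow> real^2 \<Rightarrow> real^2 \<Rightarrow> real^2" where
  "trig_deriv K a x h = (\<Sum>k\<in>K. (a k * (freq k \<bullet> h) * trig (- k) x / L) *\<^sub>R pol k)"

lemma fld_fourier_sum: "AE x in lborel. fld (fourier_sum K a) x = trig_field K a x"
proof -
  have "AE x in lborel. \<forall>k. fld (ek k) x = efun k x \<and> fld (a k *\<^sub>R ek k) x = a k *\<^sub>R fld (ek k) x"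
    using fld_ek fld_scaleR by (simp add: AE_all_countable AE_conj_iff)
  with fld_sum[where K=K and f="\<lambda>k. a k *\<^sub>R ek k"] show ?thesis
    by eventually_elim (simp add: fourier_sum_def trig_field_def)
qed

lemma trig_field_continuous: "continuous_on UNIV (trig_field K a)"
  unfolding trig_field_def by (intro continuous_intros efun_continuous)

lemma trig_field_measurable [measurable]: "trig_field K a \<in> borel_measurable borel"
  by (rule borel_measurable_continuous_onI[OF trig_field_continuous])

lemma trig_field_has_derivative: "(trig_field K a has_derivative trig_deriv K a x) (at x)"
proof -
  have "((\<lambda>x. \<Sum>k\<in>K. (a k * trig k x / L) *\<^sub>R pol k) has_derivative
     (\<lambda>h. \<Sum>k\<in>K. (a k * (trig (- k) x * (freq k \<bullet> h)) / L) *\<^sub>R pol k)) (at x)"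
    using L_pos by (auto intro!: derivative_eq_intros trig_has_derivative simp: field_simps)
  then show ?thesis by (simp add: trig_field_def[abs_def] trig_deriv_def[abs_def] efun_def mult_ac)
qed

lemma trig_deriv_axis:
  "trig_deriv K a x (axis i 1) = trig_field (uminus ` K) (\<lambda>k. freq k $ i * a (- k)) x"
  unfolding trig_deriv_def trig_field_def
  by (subst sum.reindex) (auto simp: inner_axis efun_def pol_minus freq_minus inj_on_def mult_ac intro!: sum.cong)

lemma trig_deriv_continuous: "continuous_on UNIV (\<lambda>x. trig_deriv K a x (axis i 1))"
  unfolding trig_deriv_axis by (rule trig_field_continuous)

lemma trig_field_nn_integral:
  assumes K: "finite K" "0 \<notin> K"
  shows "(\<integral>\<^sup>+x\<in>cell L. ennreal ((norm (trig_field K a x))\<^sup>2) \<partial>lborel) = ennreal (\<Sum>k\<in>K. (a k)\<^sup>2)"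
proof -
  have "(\<integral>\<^sup>+x\<in>cell L. ennreal ((norm (trig_field K a x))\<^sup>2) \<partial>lborel) =
      (\<integral>\<^sup>+x\<in>cell L. ennreal ((norm (fld (fourier_sum K a) x))\<^sup>2) \<partial>lborel)"
    using fld_fourier_sum[of K a] by (intro nn_integral_cong_AE) (auto elim!: AE_mp)
  then show ?thesis by (simp add: hnorm_nn_integral[OF fourier_sum_L2] hnorm_fourier_sum[OF K])
qed

definition dirichlet :: "(int \<times> int) set \<Rightarrow> (int \<times> int \<Rightarrow> real) \<Rightarrow> real" where
  "dirichlet K a = (\<Sum>k\<in>K. mu k * (a k)\<^sup>2)"

lemma trig_deriv_nn_integral:
  assumes K: "finite K" "0 \<notin> K"
  shows "(\<integral>\<^sup>+x\<in>cell L. ennreal ((norm (trig_deriv K a x (axis i 1)))\<^sup>2) \<partial>lborel) = ennreal (\<Sum>k\<in>K. (freq k $ i * a k)\<^sup>2)"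
proof -
  have "0 \<notin> uminus ` K" using K(2) by (metis (no_types, lifting) image_iff neg_equal_0_iff_equal)
  then have "(\<integral>\<^sup>+x\<in>cell L. ennreal ((norm (trig_deriv K a x (axis i 1)))\<^sup>2) \<partial>lborel) =
      ennreal (\<Sum>k\<in>uminus ` K. (freq k $ i * a (- k))\<^sup>2)"
    unfolding trig_deriv_axis by (rule trig_field_nn_integral[OF finite_imageI[OF K(1)]])
  also have "(\<Sum>k\<in>uminus ` K. (freq k $ i * a (- k))\<^sup>2) = (\<Sum>k\<in>K. (freq k $ i * a k)\<^sup>2)"
    by (subst sum.reindex) (auto simp: freq_minus inj_on_def)
  finally show ?thesis .
qed

lemma trig_deriv_le_dirichlet:
  assumes "finite K" "0 \<notin> K"
  shows "(\<Sum>k\<in>K. (freq k $ i * a k)\<^sup>2) \<le> dirichlet K a"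
  unfolding dirichlet_def
proof (rule sum_mono)
  fix k
  have "(freq k $ i)\<^sup>2 \<le> mu k" using exhaust_2[of i] by (auto simp: mu_sum power2_eq_square)
  then show "(freq k $ i * a k)\<^sup>2 \<le> mu k * (a k)\<^sup>2" by (simp add: power_mult_distrib mult_right_mono)
qed

lemma poincare:
  assumes "finite K" "0 \<notin> K"
  shows "mu1 * (\<Sum>k\<in>K. (a k)\<^sup>2) \<le> dirichlet K a"
  unfolding dirichlet_def sum_distrib_left
proof (intro sum_mono mult_right_mono)
  fix k assume "k \<in> K"
  then show "mu1 \<le> mu k" using assms by (intro mu1_le_mu) auto
qed simp

text \<open>The derivative part contributes 2 |y| |y|_V by Cauchy-Schwarz. The average contributes
  |y|^2 / L, at most |y| |y|_V by Poincare's inequality, as the root of \<open>mu1\<close> is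
  \<open>2 * pi / L\<close>. Hence the constant 3.\<close>

lemma energy_density_average:
  fixes i :: 2
  assumes K: "finite K" "0 \<notin> K"
  shows "(\<integral>\<^sup>+x\<in>cell L. (ennreal (1 / L) * ennreal ((norm (trig_field K a x))\<^sup>2)
      + ennreal \<bar>2 * (trig_field K a x \<bullet> trig_deriv K a x (axis i 1))\<bar>) \<partial>lborel)
    \<le> ennreal (3 * sqrt (\<Sum>k\<in>K. (a k)\<^sup>2) * sqrt (dirichlet K a))"
proof -
  define N D where "N = (\<Sum>k\<in>K. (a k)\<^sup>2)" and "D = dirichlet K a"
  have ND: "0 \<le> N" "0 \<le> D" by (auto simp: N_def D_def dirichlet_def mu_def intro!: sum_nonneg)
  have [measurable]: "(\<lambda>x. trig_deriv K a x (axis i 1)) \<in> borel_measurable borel"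
    by (rule borel_measurable_continuous_onI[OF trig_deriv_continuous])
  have "(\<integral>\<^sup>+x\<in>cell L. ennreal \<bar>2 * (trig_field K a x \<bullet> trig_deriv K a x (axis i 1))\<bar> \<partial>lborel) \<le>
      (\<integral>\<^sup>+x. 2 * (ennreal (norm (trig_field K a x) * norm (trig_deriv K a x (axis i 1))) * indicator (cell L) x) \<partial>lborel)"
  proof (rule nn_integral_mono)
    fix x
    have "\<bar>2 * (trig_field K a x \<bullet> trig_deriv K a x (axis i 1))\<bar> \<le> 2 * (norm (trig_field K a x) * norm (trig_deriv K a x (axis i 1)))"
      using Cauchy_Schwarz_ineq2[of "trig_field K a x" "trig_deriv K a x (axis i 1)"] by simp
    from ennreal_leI[OF this] show "ennreal \<bar>2 * (trig_field K a x \<bullet> trig_deriv K a x (axis i 1))\<bar> * indicator (cell L) x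
        \<le> 2 * (ennreal (norm (trig_field K a x) * norm (trig_deriv K a x (axis i 1))) * indicator (cell L) x)"
      by (auto simp: indicator_def ennreal_mult'')
  qed
  also have "\<dots> = 2 * (\<integral>\<^sup>+x\<in>cell L. ennreal (norm (trig_field K a x) * norm (trig_deriv K a x (axis i 1))) \<partial>lborel)"
    by (rule nn_integral_cmult) measurable
  also have "\<dots> \<le> 2 * ennreal (sqrt N * sqrt D)"
    using trig_deriv_le_dirichlet[OF K, of i a] ND
    by (intro mult_left_mono cauchy_schwarz_set_nn_integral)
       (auto simp: trig_field_nn_integral[OF K] trig_deriv_nn_integral[OF K] N_def D_def intro!: ennreal_leI)
  finally have 2: "(\<integral>\<^sup>+x\<in>cell L. ennreal \<bar>2 * (trig_field K a x \<bullet> trig_deriv K a x (axis i 1))\<bar> \<partial>lborel) \<le> ennreal (2 * (sqrt N * sqrt D))"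
    using ND by (simp add: ennreal_mult)
  have "sqrt mu1 * sqrt N \<le> sqrt D"
    using poincare[OF K, of a] by (simp add: real_sqrt_mult[symmetric] N_def D_def)
  moreover have "sqrt mu1 = 2 * pi / L" using L_pos by (simp add: mu1_def)
  ultimately have "(2 * pi / L) * sqrt N \<le> sqrt D" by simp
  moreover have "(1 / L) * sqrt N \<le> (2 * pi / L) * sqrt N"
    using L_pos pi_ge_two ND by (intro mult_right_mono divide_right_mono) auto
  ultimately have "(1 / L) * sqrt N \<le> sqrt D" by (rule order_trans[rotated])
  then have "sqrt N * ((1 / L) * sqrt N) \<le> sqrt N * sqrt D" using ND by (intro mult_left_mono) auto
  then have 1: "1 / L * N \<le> sqrt N * sqrt D" using ND by (simp add: mult.left_commute)
  have "(\<integral>\<^sup>+x\<in>cell L. (ennreal (1 / L) * ennreal ((norm (trig_field K a x))\<^sup>2)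
      + ennreal \<bar>2 * (trig_field K a x \<bullet> trig_deriv K a x (axis i 1))\<bar>) \<partial>lborel) =
      (\<integral>\<^sup>+x. ennreal (1 / L) * (ennreal ((norm (trig_field K a x))\<^sup>2) * indicator (cell L) x) \<partial>lborel) +
      (\<integral>\<^sup>+x\<in>cell L. ennreal \<bar>2 * (trig_field K a x \<bullet> trig_deriv K a x (axis i 1))\<bar> \<partial>lborel)"
    by (subst nn_integral_add[symmetric]) (auto simp: distrib_right mult.assoc intro!: nn_integral_cong)
  also have "(\<integral>\<^sup>+x. ennreal (1 / L) * (ennreal ((norm (trig_field K a x))\<^sup>2) * indicator (cell L) x) \<partial>lborel) = ennreal (1 / L * N)"
    using L_pos ND by (subst nn_integral_cmult) (auto simp: trig_field_nn_integral[OF K] N_def[symmetric] ennreal_mult[symmetric])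
  also have "ennreal (1 / L * N) + (\<integral>\<^sup>+x\<in>cell L. ennreal \<bar>2 * (trig_field K a x \<bullet> trig_deriv K a x (axis i 1))\<bar> \<partial>lborel)
      \<le> ennreal (sqrt N * sqrt D) + ennreal (2 * (sqrt N * sqrt D))"
    using 1 2 by (intro add_mono ennreal_leI)
  also have "\<dots> = ennreal (3 * sqrt N * sqrt D)"
    using ND by (subst ennreal_plus[symmetric]) auto
  finally show ?thesis by (simp add: N_def D_def)
qed

text \<open>
  The first factor is bounded by an average along the first coordinate, the second one by an average
  along the second coordinate; then the double integral factorises.
\<close>

lemma ladyzhenskaya:
  assumes K: "finite K" "0 \<notin> K" and K': "finite K'" "0 \<notin> K'"
  shows "(\<integral>\<^sup>+x\<in>cell L. ennreal ((norm (trig_field K a x))\<^sup>2 * (norm (trig_field K' b x))\<^sup>2) \<partial>lborel)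
    \<le> ennreal (3 * sqrt (\<Sum>k\<in>K. (a k)\<^sup>2) * sqrt (dirichlet K a)) *
       ennreal (3 * sqrt (\<Sum>k\<in>K'. (b k)\<^sup>2) * sqrt (dirichlet K' b))"
proof -
  define A where "A K a i x = ennreal (1 / L) * ennreal ((norm (trig_field K a x))\<^sup>2)
      + ennreal \<bar>2 * (trig_field K a x \<bullet> trig_deriv K a x (axis i 1))\<bar>" for K a x and i :: 2
  have [measurable]: "(\<lambda>x. trig_deriv K a x (axis i 1)) \<in> borel_measurable borel" for K a i
    by (rule borel_measurable_continuous_onI[OF trig_deriv_continuous])
  have Am [measurable]: "A K a i \<in> borel_measurable borel" for K a i
    unfolding A_def by measurable
  have der: "((\<lambda>t. (norm (trig_field K a (x + t *\<^sub>R axis i 1)))\<^sup>2) has_real_derivative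
     2 * (trig_field K a (x + t *\<^sub>R axis i 1) \<bullet> trig_deriv K a (x + t *\<^sub>R axis i 1) (axis i 1))) (at t)" for K a x t and i :: 2
  proof -
    let ?x = "x + t *\<^sub>R axis i 1"
    have 1: "((\<lambda>x. (norm (trig_field K a x))\<^sup>2) has_derivative
        (\<lambda>h. 2 * (trig_field K a ?x \<bullet> trig_deriv K a ?x h))) (at ?x)"
      unfolding power2_norm_eq_inner
      using has_derivative_inner[OF trig_field_has_derivative[of K a ?x] trig_field_has_derivative[of K a ?x]]
      by (simp add: inner_commute)
    then have "(\<lambda>x. (norm (trig_field K a x))\<^sup>2) differentiable (at ?x)" by (auto simp: differentiable_def)
    from pdiff_has_real_derivative[OF this] show ?thesis unfolding pdiff_eq[OF 1] .
  qed
  have cont: "continuous_on UNIV (\<lambda>t. 2 * (trig_field K a (x + t *\<^sub>R axis i 1) \<bullet> trig_deriv K a (x + t *\<^sub>R axis i 1) (axis i 1)))" for K a x and i :: 2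
    by (intro continuous_intros continuous_on_compose2[OF trig_field_continuous] continuous_on_compose2[OF trig_deriv_continuous]) auto
  have v1: "vec2 s t = vec2 0 t + s *\<^sub>R axis 1 1" and v2: "vec2 s t = vec2 s 0 + t *\<^sub>R axis 2 1" for s t
    by (simp_all add: vec2_conv_axis)
  have comb: "ennreal (1 / L) * (\<integral>\<^sup>+t\<in>{0..L}. f t \<partial>lborel) + (\<integral>\<^sup>+t\<in>{0..L}. g t \<partial>lborel) =
      (\<integral>\<^sup>+t\<in>{0..L}. (ennreal (1 / L) * f t + g t) \<partial>lborel)"
    if [measurable]: "f \<in> borel_measurable borel" "g \<in> borel_measurable borel" for f g :: "real \<Rightarrow> ennreal"
    by (subst nn_integral_cmult[symmetric], measurable, subst nn_integral_add[symmetric])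
       (auto simp: distrib_right mult.assoc)
  have b1: "ennreal ((norm (trig_field K a (vec2 s t)))\<^sup>2) \<le> (\<integral>\<^sup>+s\<in>{0..L}. A K a 1 (vec2 s t) \<partial>lborel)" if "s \<in> {0..L}" for s t
    using le_average_plus_variation[OF L_pos der cont _ that, of K a "vec2 0 t" 1]
    unfolding A_def v1[symmetric]
    by (subst comb[symmetric]) auto
  have b2: "ennreal ((norm (trig_field K' b (vec2 s t)))\<^sup>2) \<le> (\<integral>\<^sup>+t\<in>{0..L}. A K' b 2 (vec2 s t) \<partial>lborel)" if "t \<in> {0..L}" for s t
    using le_average_plus_variation[OF L_pos der cont _ that, of K' b "vec2 s 0" 2]
    unfolding A_def v2[symmetric]
    by (subst comb[symmetric]) auto
  let ?A = "\<lambda>t. \<integral>\<^sup>+s\<in>{0..L}. A K a 1 (vec2 s t) \<partial>lborel" and ?B = "\<lambda>s. \<integral>\<^sup>+t\<in>{0..L}. A K' b 2 (vec2 s t) \<partial>lborel"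
  have "(\<integral>\<^sup>+x\<in>cell L. ennreal ((norm (trig_field K a x))\<^sup>2 * (norm (trig_field K' b x))\<^sup>2) \<partial>lborel) =
      (\<integral>\<^sup>+s\<in>{0..L}. (\<integral>\<^sup>+t\<in>{0..L}. ennreal ((norm (trig_field K a (vec2 s t)))\<^sup>2 * (norm (trig_field K' b (vec2 s t)))\<^sup>2) \<partial>lborel) \<partial>lborel)"
    by (rule nn_integral_cell) measurable
  also have "\<dots> \<le> (\<integral>\<^sup>+s\<in>{0..L}. (\<integral>\<^sup>+t\<in>{0..L}. ?A t * ?B s \<partial>lborel) \<partial>lborel)"
  proof (intro nn_integral_mono)
    fix s :: real
    have "(\<integral>\<^sup>+t\<in>{0..L}. ennreal ((norm (trig_field K a (vec2 s t)))\<^sup>2 * (norm (trig_field K' b (vec2 s t)))\<^sup>2) \<partial>lborel)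
        \<le> (\<integral>\<^sup>+t\<in>{0..L}. ?A t * ?B s \<partial>lborel)" if "s \<in> {0..L}"
      using b1[OF that] b2 by (intro nn_integral_mono) (auto simp: indicator_def ennreal_mult intro!: mult_mono)
    then show "(\<integral>\<^sup>+t\<in>{0..L}. ennreal ((norm (trig_field K a (vec2 s t)))\<^sup>2 * (norm (trig_field K' b (vec2 s t)))\<^sup>2) \<partial>lborel) * indicator {0..L} s
        \<le> (\<integral>\<^sup>+t\<in>{0..L}. ?A t * ?B s \<partial>lborel) * indicator {0..L} s" by (auto simp: indicator_def)
  qed
  also have "\<dots> = (\<integral>\<^sup>+s. (\<integral>\<^sup>+t\<in>{0..L}. ?A t \<partial>lborel) * (?B s * indicator {0..L} s) \<partial>lborel)"
  proof (intro nn_integral_cong)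
    fix s :: real
    have "(\<integral>\<^sup>+t\<in>{0..L}. ?A t * ?B s \<partial>lborel) = (\<integral>\<^sup>+t. (?A t * indicator {0..L} t) * ?B s \<partial>lborel)"
      by (intro nn_integral_cong) (simp only: mult.assoc mult.commute[of "?B s"])
    also have "\<dots> = (\<integral>\<^sup>+t\<in>{0..L}. ?A t \<partial>lborel) * ?B s"
      by (rule nn_integral_multc) measurable
    finally show "(\<integral>\<^sup>+t\<in>{0..L}. ?A t * ?B s \<partial>lborel) * indicator {0..L} s =
      (\<integral>\<^sup>+t\<in>{0..L}. ?A t \<partial>lborel) * (?B s * indicator {0..L} s)"
      by (simp only: mult.assoc)
  qed
  also have "\<dots> = (\<integral>\<^sup>+t\<in>{0..L}. ?A t \<partial>lborel) * (\<integral>\<^sup>+s\<in>{0..L}. ?B s \<partial>lborel)"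
    by (rule nn_integral_cmult) measurable
  also have "(\<integral>\<^sup>+t\<in>{0..L}. ?A t \<partial>lborel) = (\<integral>\<^sup>+x\<in>cell L. A K a 1 x \<partial>lborel)"
    by (rule nn_integral_cell(2)[symmetric]) measurable
  also have "(\<integral>\<^sup>+s\<in>{0..L}. ?B s \<partial>lborel) = (\<integral>\<^sup>+x\<in>cell L. A K' b 2 x \<partial>lborel)"
    by (rule nn_integral_cell(1)[symmetric]) measurable
  finally show ?thesis
    unfolding A_def using energy_density_average[OF K, of a 1] energy_density_average[OF K', of b 2]
    by (elim order_trans) (intro mult_mono, auto)
qed

section \<open>The trilinear form against modes\<close>

lemma set_integrable_fld_mult:
  assumes u: "u \<in> L2 L" and v: "v \<in> L2 L"
  shows "set_integrable lborel (cell L) (\<lambda>x. (fld u x \<bullet> p) * (fld v x \<bullet> q))"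
proof -
  have "set_integrable lborel (cell L) (\<lambda>x. (norm p * norm q) * ((norm (fld u x))\<^sup>2 + (norm (fld v x))\<^sup>2))"
    using u v by (intro set_integrable_mult_right set_integral_add(1)) (auto simp: L2_def)
  then show ?thesis
    unfolding set_integrable_def
  proof (rule Bochner_Integration.integrable_bound)
    have "\<bar>(a \<bullet> p) * (b \<bullet> q)\<bar> \<le> (norm p * norm q) * ((norm a)\<^sup>2 + (norm b)\<^sup>2)" for a b :: "real^2"
    proof -
      have "\<bar>(a \<bullet> p) * (b \<bullet> q)\<bar> \<le> (norm a * norm p) * (norm b * norm q)"
        unfolding abs_mult by (intro mult_mono Cauchy_Schwarz_ineq2) auto
      also have "\<dots> = (norm p * norm q) * (norm a * norm b)" by simp
      also have "\<dots> \<le> (norm p * norm q) * ((norm a)\<^sup>2 + (norm b)\<^sup>2)"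
        using sum_squares_bound[of "norm a" "norm b"] mult_nonneg_nonneg[OF norm_ge_zero[of a] norm_ge_zero[of b]]
        by (intro mult_left_mono) (linarith, simp)
      finally show ?thesis .
    qed
    then show "AE x in lborel. norm (indicat_real (cell L) x *\<^sub>R ((fld u x \<bullet> p) * (fld v x \<bullet> q)))
        \<le> norm (indicat_real (cell L) x *\<^sub>R ((norm p * norm q) * ((norm (fld u x))\<^sup>2 + (norm (fld v x))\<^sup>2)))"
      by (intro AE_I2) (auto simp: indicator_def)
  qed measurable
qed

text \<open>This is b(u, e_k, v) with the derivative of the mode written out. No weak derivative is
  left, so the form is bounded on pairs of square integrable fields.\<close>

definition tri_mode :: "int \<times> int \<Rightarrow> vfield \<Rightarrow> vfield \<Rightarrow> real" where
  "tri_mode k u v = (LINT x:cell L|lborel. (fld u x \<bullet> freq k) * (fld v x \<bullet> pol k) * (trig (- k) x / L))"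

lemma tri_mode_integrable:
  assumes u: "u \<in> L2 L" and v: "v \<in> L2 L"
  shows "set_integrable lborel (cell L) (\<lambda>x. (fld u x \<bullet> p) * (fld v x \<bullet> q) * (trig k x / L))"
proof (rule set_integrable_mult_bounded[OF set_integrable_fld_mult[OF u v]])
  show "\<bar>trig k x / L\<bar> \<le> 2 / L" for x
    using abs_trig_le[of k x] L_pos by (simp add: divide_right_mono)
qed auto

lemma tri_ek:
  assumes u: "u \<in> L2 L" and v: "v \<in> L2 L"
  shows "tri L u (ek k) v = tri_mode k u v"
proof -
  have w: "AE x in lborel. fld (weak_pdiff L i (ek k)) x = (freq k $ i * (trig (- k) x / L)) *\<^sub>R pol k" for i
    unfolding weak_pdiff_ek using fld_scaleR[of "- freq k $ i" "ek (- k)"] fld_ek[of "- k"]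
    by eventually_elim (simp add: efun_def pol_minus)
  have t: "(LINT x:cell L|lborel. fld u x $ i * fld (weak_pdiff L i (ek k)) x $ j * fld v x $ j) =
      (LINT x:cell L|lborel. (freq k $ i * pol k $ j) * ((fld u x \<bullet> axis i 1) * (fld v x \<bullet> axis j 1) * (trig (- k) x / L)))" for i j
  proof (rule set_integral_cong_AE_cell)
    show "AE x in lborel. fld u x $ i * fld (weak_pdiff L i (ek k)) x $ j * fld v x $ j =
        (freq k $ i * pol k $ j) * ((fld u x \<bullet> axis i 1) * (fld v x \<bullet> axis j 1) * (trig (- k) x / L))"
      using w[of i] by eventually_elim (simp add: inner_axis)
  qed measurable
  let ?F = "\<lambda>i j x. (fld u x \<bullet> axis i 1) * (fld v x \<bullet> axis j 1) * (trig (- k) x / L)"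
  have F: "set_integrable lborel (cell L) (\<lambda>x. c * ?F i j x)" for c i j
    by (intro set_integrable_mult_right tri_mode_integrable u v)
  have "tri_mode k u v = (LINT x:cell L|lborel.
     ((freq k $ 1 * pol k $ 1) * ?F 1 1 x + (freq k $ 1 * pol k $ 2) * ?F 1 2 x) +
     ((freq k $ 2 * pol k $ 1) * ?F 2 1 x + (freq k $ 2 * pol k $ 2) * ?F 2 2 x))"
    unfolding tri_mode_def by (simp add: inner_vec_def sum_2 inner_axis axis_def algebra_simps add_divide_distrib)
  also have "\<dots> = tri L u (ek k) v"
    unfolding tri_def t sum_2 using F by (simp add: set_integral_add del: set_integral_mult_right)
  finally show ?thesis ..
qed

lemma trig_deriv_inner:
  "trig_deriv K a x h \<bullet> w = (\<Sum>k\<in>K. a k * ((h \<bullet> freq k) * (w \<bullet> pol k) * (trig (- k) x / L)))"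
  unfolding trig_deriv_def inner_sum_left by (intro sum.cong) (auto simp: inner_commute mult_ac)

text \<open>Summed with coefficients \<open>a k\<close>, the modes give b(u, y, v) for the field y
  with these coefficients, expressed by the pointwise derivative of y.\<close>

lemma trig_deriv_integral:
  assumes u: "u \<in> L2 L" and v: "v \<in> L2 L"
  shows "set_integrable lborel (cell L) (\<lambda>x. trig_deriv K a x (fld u x) \<bullet> fld v x)"
    and "(LINT x:cell L|lborel. trig_deriv K a x (fld u x) \<bullet> fld v x) = (\<Sum>k\<in>K. a k * tri_mode k u v)"
proof -
  have i: "integrable lborel (\<lambda>x. indicat_real (cell L) x *\<^sub>R (a k * ((fld u x \<bullet> freq k) * (fld v x \<bullet> pol k) * (trig (- k) x / L))))" for k
    using set_integrable_mult_right[OF tri_mode_integrable[OF u v], of "a k" "freq k" "pol k" "- k"]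
    by (simp add: set_integrable_def)
  show "set_integrable lborel (cell L) (\<lambda>x. trig_deriv K a x (fld u x) \<bullet> fld v x)"
    unfolding set_integrable_def trig_deriv_inner scaleR_sum_right
    by (intro Bochner_Integration.integrable_sum i)
  show "(LINT x:cell L|lborel. trig_deriv K a x (fld u x) \<bullet> fld v x) = (\<Sum>k\<in>K. a k * tri_mode k u v)"
    unfolding set_lebesgue_integral_def trig_deriv_inner scaleR_sum_right tri_mode_def
    by (subst Bochner_Integration.integral_sum[OF i]) (simp add: mult.left_commute)
qed

lemma trig_deriv_expand:
  "trig_deriv K a x h = (h $ 1) *\<^sub>R trig_deriv K a x (axis 1 1) + (h $ 2) *\<^sub>R trig_deriv K a x (axis 2 1)"
proof -
  interpret linear "trig_deriv K a x"
    by (rule has_derivative_linear[OF trig_field_has_derivative])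
  have "h = (h $ 1) *\<^sub>R axis 1 1 + (h $ 2) *\<^sub>R axis 2 1" by (simp add: vec_eq_iff forall_2 axis_def)
  then have "trig_deriv K a x h = trig_deriv K a x ((h $ 1) *\<^sub>R axis 1 1 + (h $ 2) *\<^sub>R axis 2 1)" by (rule arg_cong)
  then show ?thesis by (simp add: add scale)
qed

text \<open>The integrand is \<open>u \<bullet> \<nabla>(|y|\<^sup>2/2)\<close>, where \<open>y\<close> is the trigonometric field.\<close>

lemma energy_conservation:
  assumes u: "u \<in> H L"
  shows "(LINT x:cell L|lborel. trig_deriv K a x (fld u x) \<bullet> trig_field K a x) = 0"
proof -
  define \<phi> where "\<phi> x = 1/2 * (trig_field K a x $ 1 * trig_field K a x $ 1 + trig_field K a x $ 2 * trig_field K a x $ 2)" for x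
  have comp: "(\<lambda>x. trig_field K a x $ j) \<in> test_functions L" for j
  proof -
    have "(\<lambda>x. \<Sum>k\<in>K. (a k / L * pol k $ j) * trig k x) \<in> test_functions L"
      by (intro test_functions_sum test_functions_cmult trig_test_function)
    also have "(\<lambda>x. \<Sum>k\<in>K. (a k / L * pol k $ j) * trig k x) = (\<lambda>x. trig_field K a x $ j)"
      by (simp add: fun_eq_iff trig_field_def efun_def mult_ac)
    finally show ?thesis .
  qed
  have \<phi>: "\<phi> \<in> test_functions L"
    unfolding \<phi>_def by (intro test_functions_cmult test_functions_add test_functions_mult comp)
  have \<phi>_eq: "\<phi> = (\<lambda>x. 1/2 * (trig_field K a x \<bullet> trig_field K a x))"
    by (simp add: \<phi>_def fun_eq_iff inner_vec_def sum_2)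
  have der: "(\<phi> has_derivative (\<lambda>h. trig_field K a x \<bullet> trig_deriv K a x h)) (at x)" for x
    unfolding \<phi>_eq
    by (rule has_derivative_eq_rhs[OF has_derivative_mult_right[OF has_derivative_inner[OF trig_field_has_derivative trig_field_has_derivative]]])
       (simp add: inner_commute fun_eq_iff)
  have "fld u x \<bullet> (\<chi> i. pdiff i \<phi> x) = trig_deriv K a x (fld u x) \<bullet> trig_field K a x" for x
    unfolding pdiff_eq[OF der] trig_deriv_expand[of K a x "fld u x"]
    by (simp add: inner_vec_def[of "fld u x"] sum_2 inner_add_left inner_commute[of "trig_field K a x"])
  then show ?thesis using u \<phi> by (auto simp: H_def div_free_def)
qed

section \<open>Energy transfer and the norm of V\<close>

definition vnorm :: "vfield \<Rightarrow> real" where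
  "vnorm u = hnorm L (stokes_pow L (1/2) u)"

lemma dirichlet_le_vnorm:
  assumes u: "u \<in> V L" and K: "finite K" "0 \<notin> K"
  shows "dirichlet K (coef u) \<le> (vnorm u)\<^sup>2"
proof -
  have d: "u \<in> stokes_pow_dom L (1/2)" using u by (simp add: V_def)
  have "dirichlet K (coef u) = (\<Sum>k\<in>K. (coef (stokes_pow L (1/2) u) k)\<^sup>2)"
    unfolding dirichlet_def
  proof (rule sum.cong)
    fix k assume "k \<in> K"
    then have k: "k \<noteq> 0" using K by auto
    have "(mu k powr (1/2))\<^sup>2 = mu k" using mu_pos[OF k] by (simp add: powr_half_sqrt)
    then show "mu k * (coef u k)\<^sup>2 = (coef (stokes_pow L (1/2) u) k)\<^sup>2"
      by (simp add: stokes_pow_props(2)[OF d k] power_mult_distrib)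
  qed simp
  then show ?thesis
    unfolding vnorm_def using bessel(2)[OF H_subset_L2[OF stokes_pow_props(1)[OF d]] K] by simp
qed

text \<open>Ladyzhenskaya's inequality is applied to the truncations of \<open>u\<close> and of its
  remainder \<open>v\<close>, that is, to the frequencies outside \<open>trunc n\<close>; the
  constant is 3 * 3. Fatou's lemma along an almost everywhere convergent subsequence removes the
  truncation.\<close>

lemma product_bound:
  fixes u :: vfield and n :: nat
  defines "v \<equiv> u - fourier_sum (trunc n) (coef u)"
  assumes u: "u \<in> V L"
  shows "(\<integral>\<^sup>+x\<in>cell L. ennreal ((norm (fld u x))\<^sup>2 * (norm (fld v x))\<^sup>2) \<partial>lborel)
    \<le> ennreal (9 * hnorm L u * hnorm L v * (vnorm u)\<^sup>2)"
proof -
  have uH: "u \<in> H L" using u by (simp add: V_def stokes_pow_dom_def)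
  note u2 = H_subset_L2[OF uH]
  have v2: "v \<in> L2 L" unfolding v_def by (intro L2_diff u2 fourier_sum_L2)
  define c where "c = coef u"
  obtain r where r: "strict_mono r"
    "AE x in lborel. x \<in> cell L \<longrightarrow> (\<lambda>m. fld (fourier_sum (trunc (r m)) c) x) \<longlonglongrightarrow> fld u x"
    using hnorm_tendsto_imp_AE_subseq[OF fourier_sum_L2 u2 fourier_tendsto[OF uH]] unfolding c_def by blast
  define F where "F m x = ennreal ((norm (trig_field (trunc (r m)) c x))\<^sup>2 * (norm (trig_field (trunc (r m) - trunc n) c x))\<^sup>2)" for m x
  have [measurable]: "F m \<in> borel_measurable borel" for m unfolding F_def by measurable
  have rm: "\<forall>\<^sub>F m in sequentially. n \<le> r m"
    using r(1) by (metis eventually_sequentiallyI order_trans strict_mono_imp_increasing)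
  have "AE x in lborel. \<forall>m. fld (fourier_sum (trunc (r m)) c) x = trig_field (trunc (r m)) c x"
    using fld_fourier_sum by (simp add: AE_all_countable)
  with r(2) fld_fourier_sum[of "trunc n" c] fld_diff[of u "fourier_sum (trunc n) c"]
  have "AE x in lborel. ennreal ((norm (fld u x))\<^sup>2 * (norm (fld v x))\<^sup>2) * indicator (cell L) x =
      liminf (\<lambda>m. F m x * indicator (cell L) x)"
  proof eventually_elim
    case (elim x)
    show ?case
    proof (cases "x \<in> cell L")
      case True
      have lim: "(\<lambda>m. trig_field (trunc (r m)) c x) \<longlonglongrightarrow> fld u x" using elim True by simp
      have ev: "\<forall>\<^sub>F m in sequentially. trig_field (trunc (r m)) c x - trig_field (trunc n) c x = trig_field (trunc (r m) - trunc n) c x"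
        using rm by eventually_elim (simp add: trig_field_def sum_diff trunc_mono)
      have "(\<lambda>m. trig_field (trunc (r m)) c x - trig_field (trunc n) c x) \<longlonglongrightarrow> fld v x"
        using elim tendsto_diff[OF lim tendsto_const] by (simp add: v_def c_def)
      then have lim': "(\<lambda>m. trig_field (trunc (r m) - trunc n) c x) \<longlonglongrightarrow> fld v x"
        by (rule Lim_transform_eventually[OF _ ev])
      have "(\<lambda>m. F m x) \<longlonglongrightarrow> ennreal ((norm (fld u x))\<^sup>2 * (norm (fld v x))\<^sup>2)"
        unfolding F_def by (intro tendsto_ennrealI tendsto_intros lim lim')
      from lim_imp_Liminf[OF _ this] True show ?thesis by simp
    qed (simp add: Liminf_const)
  qed
  then have "(\<integral>\<^sup>+x\<in>cell L. ennreal ((norm (fld u x))\<^sup>2 * (norm (fld v x))\<^sup>2) \<partial>lborel) =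
      (\<integral>\<^sup>+x. liminf (\<lambda>m. F m x * indicator (cell L) x) \<partial>lborel)"
    by (rule nn_integral_cong_AE)
  also have "\<dots> \<le> liminf (\<lambda>m. \<integral>\<^sup>+x\<in>cell L. F m x \<partial>lborel)"
    by (rule nn_integral_liminf) measurable
  also have "\<dots> \<le> ennreal (9 * hnorm L u * hnorm L v * (vnorm u)\<^sup>2)"
  proof (rule Liminf_le)
    show "\<forall>\<^sub>F m in sequentially. (\<integral>\<^sup>+x\<in>cell L. F m x \<partial>lborel) \<le> ennreal (9 * hnorm L u * hnorm L v * (vnorm u)\<^sup>2)"
      using rm
    proof eventually_elim
      case (elim m)
      let ?K = "trunc (r m)" and ?K' = "trunc (r m) - trunc n"
      have K': "finite ?K'" "0 \<notin> ?K'" by auto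
      have 1: "sqrt (\<Sum>k\<in>?K. (c k)\<^sup>2) \<le> hnorm L u"
        using bessel(2)[OF u2, of ?K] by (intro real_le_lsqrt) (auto simp: c_def sum_nonneg)
      have "(\<Sum>k\<in>?K'. (c k)\<^sup>2) = (\<Sum>k\<in>?K'. (coef v k)\<^sup>2)"
      proof (rule sum.cong)
        fix k assume k: "k \<in> ?K'"
        then have "k \<noteq> 0" by (auto simp: trunc_def)
        then show "(c k)\<^sup>2 = (coef v k)\<^sup>2"
          using k by (simp add: v_def coef_diff u2 fourier_sum_L2 coef_fourier_sum c_def)
      qed simp
      then have 2: "sqrt (\<Sum>k\<in>?K'. (c k)\<^sup>2) \<le> hnorm L v"
        using bessel(2)[OF v2 K'] by (intro real_le_lsqrt) (auto simp: sum_nonneg)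
      have 3: "sqrt (dirichlet ?K c) \<le> vnorm u" "sqrt (dirichlet ?K' c) \<le> vnorm u"
        using dirichlet_le_vnorm[OF u, of ?K] dirichlet_le_vnorm[OF u K']
        by (auto simp: c_def vnorm_def intro!: real_le_lsqrt)
      have "(\<integral>\<^sup>+x\<in>cell L. F m x \<partial>lborel) \<le> ennreal (3 * sqrt (\<Sum>k\<in>?K. (c k)\<^sup>2) * sqrt (dirichlet ?K c)) *
         ennreal (3 * sqrt (\<Sum>k\<in>?K'. (c k)\<^sup>2) * sqrt (dirichlet ?K' c))"
        unfolding F_def by (rule ladyzhenskaya) auto
      also have "\<dots> \<le> ennreal (3 * hnorm L u * vnorm u) * ennreal (3 * hnorm L v * vnorm u)"
        using 1 2 3 by (intro mult_mono ennreal_leI) (auto simp: dirichlet_def mu_def vnorm_def intro!: sum_nonneg)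
      also have "\<dots> = ennreal (9 * hnorm L u * hnorm L v * (vnorm u)\<^sup>2)"
        by (subst ennreal_mult[symmetric]) (auto simp: vnorm_def power2_eq_square mult_ac)
      finally show ?case .
    qed
  qed simp
  finally show ?thesis .
qed

text \<open>Let y be the truncation of \<open>u\<close>. The sum is b(u, y, u) = b(u, y, y) + b(u,
  y, v), and the first term is 0. The second is at most the norm of the derivative of y times the L2
  norm of |u| |v|. Only the square of \<open>vnorm u\<close> appears, which is integrable along a
  solution, while \<open>hnorm L v\<close> supplies a factor that tends to 0.\<close>

lemma energy_transfer_bound:
  fixes u :: vfield and n :: nat
  defines "v \<equiv> u - fourier_sum (trunc n) (coef u)"
  assumes u: "u \<in> V L"
  shows "\<bar>\<Sum>k\<in>trunc n. coef u k * tri_mode k u u\<bar> \<le> 3 * (vnorm u)\<^sup>2 * sqrt (hnorm L u * hnorm L v)"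
proof -
  have uH: "u \<in> H L" using u by (simp add: V_def stokes_pow_dom_def)
  note u2 = H_subset_L2[OF uH]
  have v2: "v \<in> L2 L" unfolding v_def by (intro L2_diff u2 fourier_sum_L2)
  define c K where "c = coef u" and "K = trunc n"
  have K: "finite K" "0 \<notin> K" by (auto simp: K_def)
  let ?y = "fourier_sum K c"
  let ?D = "trig_deriv K c"
  have [measurable]: "(\<lambda>x. ?D x (axis i 1)) \<in> borel_measurable borel" for i
    by (rule borel_measurable_continuous_onI[OF trig_deriv_continuous])
  have [measurable]: "(\<lambda>x. ?D x (fld u x)) \<in> borel_measurable borel"
    unfolding trig_deriv_expand[of K c _ "fld u _"] by measurable
  have fv: "AE x in lborel. fld v x = fld u x - trig_field K c x"
    using fld_diff[of u ?y] fld_fourier_sum[of K c] by eventually_elim (simp add: v_def c_def K_def)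
  have "(\<Sum>k\<in>K. c k * tri_mode k u u) = (LINT x:cell L|lborel. ?D x (fld u x) \<bullet> fld u x)"
    by (rule trig_deriv_integral(2)[OF u2 u2, symmetric])
  also have "\<dots> = (LINT x:cell L|lborel. ?D x (fld u x) \<bullet> fld ?y x + ?D x (fld u x) \<bullet> fld v x)"
    using fv fld_fourier_sum[of K c]
    by (intro set_integral_cong_AE_cell) (auto simp: inner_add_right[symmetric] elim!: AE_mp)
  also have "\<dots> = (LINT x:cell L|lborel. ?D x (fld u x) \<bullet> fld ?y x) + (LINT x:cell L|lborel. ?D x (fld u x) \<bullet> fld v x)"
    by (intro set_integral_add(2) trig_deriv_integral(1) u2 fourier_sum_L2 v2)
  also have "(LINT x:cell L|lborel. ?D x (fld u x) \<bullet> fld ?y x) = (LINT x:cell L|lborel. ?D x (fld u x) \<bullet> trig_field K c x)"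
    using fld_fourier_sum[of K c] by (intro set_integral_cong_AE_cell) (auto elim!: AE_mp)
  also have "\<dots> = 0" by (rule energy_conservation[OF uH])
  finally have eq: "(\<Sum>k\<in>K. c k * tri_mode k u u) = (LINT x:cell L|lborel. ?D x (fld u x) \<bullet> fld v x)" by simp
  \<comment> \<open>The Hilbert-Schmidt norm of the derivative: it dominates the operator norm, and
    its square integrates exactly to the Dirichlet sum.\<close>
  define S where "S x = sqrt ((norm (?D x (axis 1 1)))\<^sup>2 + (norm (?D x (axis 2 1)))\<^sup>2)" for x
  have [measurable]: "S \<in> borel_measurable borel" unfolding S_def by measurable
  have pw: "\<bar>?D x h \<bullet> w\<bar> \<le> S x * (norm h * norm w)" for x h w
  proof -
    have "norm (?D x h) \<le> \<bar>h $ 1\<bar> * norm (?D x (axis 1 1)) + \<bar>h $ 2\<bar> * norm (?D x (axis 2 1))"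
      unfolding trig_deriv_expand[of K c x h] by (rule order_trans[OF norm_triangle_ineq]) simp
    also have "\<dots> = vec2 \<bar>h $ 1\<bar> \<bar>h $ 2\<bar> \<bullet> vec2 (norm (?D x (axis 1 1))) (norm (?D x (axis 2 1)))"
      by (simp add: inner_vec2)
    also have "\<dots> \<le> norm (vec2 \<bar>h $ 1\<bar> \<bar>h $ 2\<bar>) * norm (vec2 (norm (?D x (axis 1 1))) (norm (?D x (axis 2 1))))"
      by (rule norm_cauchy_schwarz)
    also have "\<dots> = norm h * S x"
      by (simp add: norm_eq_sqrt_inner inner_vec2 S_def inner_vec_def[of h] sum_2 power2_eq_square)
    finally have "norm (?D x h) * norm w \<le> (norm h * S x) * norm w" by (rule mult_right_mono) simp
    then show ?thesis using Cauchy_Schwarz_ineq2[of "?D x h" w] by (simp add: mult_ac)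
  qed
  have nn: "0 \<le> hnorm L u * hnorm L v" by simp
  have "ennreal \<bar>\<Sum>k\<in>K. c k * tri_mode k u u\<bar> \<le> (\<integral>\<^sup>+x\<in>cell L. ennreal \<bar>?D x (fld u x) \<bullet> fld v x\<bar> \<partial>lborel)"
    unfolding eq by (rule abs_set_integral_le_nn_integral)
  also have "\<dots> \<le> (\<integral>\<^sup>+x\<in>cell L. ennreal (S x * (norm (fld u x) * norm (fld v x))) \<partial>lborel)"
    by (intro nn_integral_mono mult_right_mono ennreal_leI pw) auto
  also have "\<dots> \<le> ennreal (vnorm u * (3 * vnorm u * sqrt (hnorm L u * hnorm L v)))"
  proof (rule cauchy_schwarz_set_nn_integral)
    have "(\<integral>\<^sup>+x\<in>cell L. ennreal ((S x)\<^sup>2) \<partial>lborel) =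
        (\<integral>\<^sup>+x\<in>cell L. ennreal ((norm (?D x (axis 1 1)))\<^sup>2) \<partial>lborel) + (\<integral>\<^sup>+x\<in>cell L. ennreal ((norm (?D x (axis 2 1)))\<^sup>2) \<partial>lborel)"
      by (subst nn_integral_add[symmetric]) (auto simp: S_def distrib_right intro!: nn_integral_cong)
    also have "\<dots> = ennreal ((\<Sum>k\<in>K. (freq k $ 1 * c k)\<^sup>2) + (\<Sum>k\<in>K. (freq k $ 2 * c k)\<^sup>2))"
      by (simp add: trig_deriv_nn_integral[OF K] sum_nonneg)
    also have "(\<Sum>k\<in>K. (freq k $ 1 * c k)\<^sup>2) + (\<Sum>k\<in>K. (freq k $ 2 * c k)\<^sup>2) = dirichlet K c"
      by (simp add: dirichlet_def mu_sum sum.distrib[symmetric] power2_eq_square algebra_simps)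
    also have "ennreal (dirichlet K c) \<le> ennreal ((vnorm u)\<^sup>2)"
      unfolding c_def by (intro ennreal_leI dirichlet_le_vnorm u K)
    finally show "(\<integral>\<^sup>+x\<in>cell L. ennreal ((S x)\<^sup>2) \<partial>lborel) \<le> ennreal ((vnorm u)\<^sup>2)" .
    have "(3 * vnorm u * sqrt (hnorm L u * hnorm L v))\<^sup>2 = 9 * hnorm L u * hnorm L v * (vnorm u)\<^sup>2"
      using nn by (simp add: power_mult_distrib)
    then show "(\<integral>\<^sup>+x\<in>cell L. ennreal ((norm (fld u x) * norm (fld v x))\<^sup>2) \<partial>lborel)
        \<le> ennreal ((3 * vnorm u * sqrt (hnorm L u * hnorm L v))\<^sup>2)"
      using product_bound[OF u, of n] by (simp only: power_mult_distrib v_def[symmetric])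
    show "0 \<le> S x" for x by (simp add: S_def)
  qed (auto simp: vnorm_def)
  finally show ?thesis
    by (simp add: vnorm_def c_def K_def power2_eq_square mult_ac)
qed

end

section \<open>Paths in \<open>H\<close>\<close>

lemma continuous_map_H_realI:
  assumes L: "L > 0" and lip: "\<And>u v. u \<in> H L \<Longrightarrow> v \<in> H L \<Longrightarrow> \<bar>\<phi> u - \<phi> v\<bar> \<le> C * hnorm L (u - v)"
  shows "continuous_map (H_topology L) euclideanreal \<phi>"
proof -
  interpret Metric_space "H L" "\<lambda>u v. hnorm L (u - v)" by (rule Metric_space_H[OF L])
  show ?thesis
    unfolding H_topology_def continuous_map_from_metric
  proof (intro conjI ballI allI impI)
    fix u U assume u: "u \<in> H L" and U: "openin euclideanreal U \<and> \<phi> u \<in> U"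
    then obtain e where e: "e > 0" "\<And>y. \<bar>y - \<phi> u\<bar> < e \<Longrightarrow> y \<in> U"
      by (auto simp: open_real)
    show "\<exists>r>0. \<forall>x. x \<in> H L \<and> hnorm L (u - x) < r \<longrightarrow> \<phi> x \<in> U"
    proof (intro exI[of _ "e / (\<bar>C\<bar> + 1)"] conjI allI impI)
      show "0 < e / (\<bar>C\<bar> + 1)" using e by simp
      fix x assume x: "x \<in> H L \<and> hnorm L (u - x) < e / (\<bar>C\<bar> + 1)"
      have "\<bar>\<phi> x - \<phi> u\<bar> \<le> C * hnorm L (u - x)" using lip[of x u] x u by (simp add: hnorm_commute[of L x])
      also have "\<dots> \<le> (\<bar>C\<bar> + 1) * hnorm L (u - x)" by (intro mult_right_mono) auto
      also have "\<dots> < e" using x by (simp add: field_simps)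
      finally show "\<phi> x \<in> U" by (rule e)
    qed
  qed simp
qed

lemma continuous_map_hnorm: "L > 0 \<Longrightarrow> continuous_map (H_topology L) euclideanreal (hnorm L)"
  by (rule continuous_map_H_realI[where C=1]) (auto intro: abs_hnorm_diff_le H_subset_L2)

lemma continuous_map_hinner:
  assumes "L > 0" "v \<in> L2 L" shows "continuous_map (H_topology L) euclideanreal (\<lambda>u. hinner L u v)"
proof (rule continuous_map_H_realI[where C="hnorm L v", OF assms(1)])
  fix u u' assume "u \<in> H L" "u' \<in> H L"
  then have "\<bar>hinner L u v - hinner L u' v\<bar> \<le> hnorm L (u - u') * hnorm L v"
    using abs_hinner_le[OF L2_diff assms(2), of u u'] by (simp add: hinner_diff_left H_subset_L2 assms)
  then show "\<bar>hinner L u v - hinner L u' v\<bar> \<le> hnorm L v * hnorm L (u - u')" by (simp add: mult.commute)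
qed

lemma borelH_measurable_continuous:
  assumes L: "L > 0" and \<phi>: "continuous_map (H_topology L) euclideanreal \<phi>"
  shows "\<phi> \<in> borel_measurable (borelH L)"
proof (rule borel_measurableI)
  fix S :: "real set" assume "open S"
  then have "openin (H_topology L) {x \<in> topspace (H_topology L). \<phi> x \<in> S}"
    using \<phi> by (intro openin_continuous_map_preimage) auto
  moreover have "{U. openin (H_topology L) U} \<subseteq> Pow (H L)"
    using openin_subset topspace_H_topology[OF L] by blast
  moreover have "\<phi> -` S \<inter> space (borelH L) = {x \<in> topspace (H_topology L). \<phi> x \<in> S}"
    by (auto simp: space_borelH[OF L] topspace_H_topology[OF L])
  ultimately show "\<phi> -` S \<inter> space (borelH L) \<in> sets (borelH L)"
    by (simp add: borelH_def sets_measure_of)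
qed

lemma continuous_path_tendsto:
  assumes L: "L > 0" and f: "continuous_map (top_of_set S) (H_topology L) f" and t: "t \<in> S"
  shows "f t \<in> H L" "((\<lambda>s. hnorm L (f s - f t)) \<longlongrightarrow> 0) (at t within S)"
proof -
  interpret Metric_space "H L" "\<lambda>u v. hnorm L (u - v)" by (rule Metric_space_H[OF L])
  have f': "\<forall>x\<in>S. \<forall>\<epsilon>>0. \<exists>U. openin (top_of_set S) U \<and> x \<in> U \<and> (\<forall>y\<in>U. f y \<in> mball (f x) \<epsilon>)"
    using f unfolding H_topology_def continuous_map_to_metric by simp
  show ft: "f t \<in> H L"
    using continuous_map_image_subset_topspace[OF f] t topspace_H_topology[OF L] by auto
  show "((\<lambda>s. hnorm L (f s - f t)) \<longlongrightarrow> 0) (at t within S)"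
  proof (rule tendstoI)
    fix e :: real assume "e > 0"
    from f'[rule_format, OF t this]
    obtain U where U: "openin (top_of_set S) U" "t \<in> U" and fU: "\<forall>y\<in>U. f y \<in> mball (f t) e"
      by (elim exE conjE)
    obtain O' where O': "open O'" "U = S \<inter> O'" using U(1) by (auto simp: openin_open)
    then have "\<forall>\<^sub>F s in at t within S. s \<in> O' \<and> s \<in> S"
      using U(2) by (auto simp: eventually_at_topological)
    then show "\<forall>\<^sub>F s in at t within S. dist (hnorm L (f s - f t)) 0 < e"
      by eventually_elim (use fU O' in \<open>auto simp: hnorm_commute[of L _ "f t"]\<close>)
  qed
qed

text \<open>The Lipschitz constant may grow linearly with the norms, so that one argument covers the
  norm, continuous linear functionals and quadratic forms such as \<open>tri_mode k\<close>.\<close>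

lemma continuous_on_path_functional:
  assumes L: "L > 0" and f: "continuous_map (top_of_set S) (H_topology L) f"
    and bd: "\<And>u v. u \<in> H L \<Longrightarrow> v \<in> H L \<Longrightarrow> \<bar>\<phi> u - \<phi> v\<bar> \<le> hnorm L (u - v) * (C * (hnorm L u + hnorm L v) + D)"
  shows "continuous_on S (\<lambda>t. \<phi> (f t))"
  unfolding continuous_on_def
proof
  fix t assume t: "t \<in> S"
  note ft = continuous_path_tendsto[OF L f t]
  have "((\<lambda>s. hnorm L (f s) - hnorm L (f t)) \<longlongrightarrow> 0) (at t within S)"
  proof (rule Lim_null_comparison[OF _ ft(2)])
    show "\<forall>\<^sub>F s in at t within S. norm (hnorm L (f s) - hnorm L (f t)) \<le> hnorm L (f s - f t)"
      using continuous_path_tendsto(1)[OF L f] ft(1)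
      by (auto simp: eventually_at_topological intro!: abs_hnorm_diff_le H_subset_L2)
  qed
  then have n: "((\<lambda>s. hnorm L (f s)) \<longlongrightarrow> hnorm L (f t)) (at t within S)" by (simp add: LIM_zero_iff)
  have "((\<lambda>s. \<phi> (f s) - \<phi> (f t)) \<longlongrightarrow> 0) (at t within S)"
  proof (rule Lim_null_comparison)
    show "\<forall>\<^sub>F s in at t within S. norm (\<phi> (f s) - \<phi> (f t)) \<le> hnorm L (f s - f t) * (C * (hnorm L (f s) + hnorm L (f t)) + D)"
      using continuous_path_tendsto(1)[OF L f] ft(1) bd by (auto simp: eventually_at_topological)
    show "((\<lambda>s. hnorm L (f s - f t) * (C * (hnorm L (f s) + hnorm L (f t)) + D)) \<longlongrightarrow> 0) (at t within S)"
      by (rule tendsto_eq_intros ft(2) n | simp)+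
  qed
  then show "((\<lambda>t. \<phi> (f t)) \<longlongrightarrow> \<phi> (f t)) (at t within S)" by (simp add: LIM_zero_iff)
qed

lemma continuous_on_path_hnorm:
  assumes "L > 0" "continuous_map (top_of_set S) (H_topology L) f"
  shows "continuous_on S (\<lambda>t. hnorm L (f t))"
  by (rule continuous_on_path_functional[OF assms, where C=0 and D=1])
     (auto intro: abs_hnorm_diff_le H_subset_L2)

lemma continuous_on_path_hinner:
  assumes "L > 0" "continuous_map (top_of_set S) (H_topology L) f" and v: "v \<in> L2 L"
  shows "continuous_on S (\<lambda>t. hinner L (f t) v)"
proof (rule continuous_on_path_functional[OF assms(1,2), where C=0 and D="hnorm L v"])
  fix u u' assume "u \<in> H L" "u' \<in> H L"
  then show "\<bar>hinner L u v - hinner L u' v\<bar> \<le> hnorm L (u - u') * (0 * (hnorm L u + hnorm L u') + hnorm L v)"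
    using abs_hinner_le[OF L2_diff v, of u u'] by (simp add: hinner_diff_left H_subset_L2 v)
qed

context torus begin

lemma tri_mode_diff:
  assumes "u \<in> L2 L" "v \<in> L2 L"
  shows "tri_mode k u u - tri_mode k v v = tri_mode k (u - v) u + tri_mode k v (u - v)"
proof -
  note i = tri_mode_integrable[of _ _ "freq k" "pol k" "- k"]
  have uv: "u - v \<in> L2 L" using assms by (rule L2_diff)
  have "tri_mode k (u - v) u + tri_mode k v (u - v) = (LINT x:cell L|lborel.
      (fld (u - v) x \<bullet> freq k) * (fld u x \<bullet> pol k) * (trig (- k) x / L) +
      (fld v x \<bullet> freq k) * (fld (u - v) x \<bullet> pol k) * (trig (- k) x / L))"
    unfolding tri_mode_def by (intro set_integral_add(2)[symmetric] i assms uv)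
  also have "\<dots> = (LINT x:cell L|lborel. (fld u x \<bullet> freq k) * (fld u x \<bullet> pol k) * (trig (- k) x / L) -
      (fld v x \<bullet> freq k) * (fld v x \<bullet> pol k) * (trig (- k) x / L))"
  proof (rule set_integral_cong_AE_cell)
    show "AE x in lborel. (fld (u - v) x \<bullet> freq k) * (fld u x \<bullet> pol k) * (trig (- k) x / L) +
      (fld v x \<bullet> freq k) * (fld (u - v) x \<bullet> pol k) * (trig (- k) x / L) =
      (fld u x \<bullet> freq k) * (fld u x \<bullet> pol k) * (trig (- k) x / L) -
      (fld v x \<bullet> freq k) * (fld v x \<bullet> pol k) * (trig (- k) x / L)"
      using fld_diff[of u v] by eventually_elim (simp add: inner_diff_left left_diff_distrib right_diff_distrib diff_divide_distrib)
  qed measurable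
  also have "\<dots> = tri_mode k u u - tri_mode k v v"
    unfolding tri_mode_def by (intro set_integral_diff(2) i assms)
  finally show ?thesis ..
qed

text \<open>The derivative falls on a fixed smooth mode, so for each \<open>k\<close> the norm of H
  suffices. This is what makes the drift of a single coefficient continuous in time.\<close>

lemma abs_tri_mode_le:
  assumes u: "u \<in> L2 L" and v: "v \<in> L2 L"
  shows "\<bar>tri_mode k u v\<bar> \<le> (norm (freq k) * norm (pol k) * (2 / L)) * (hnorm L u * hnorm L v)"
proof -
  let ?C = "norm (freq k) * norm (pol k) * (2 / L)"
  have C: "0 \<le> ?C" using L_pos by simp
  have pw: "\<bar>(a \<bullet> freq k) * (b \<bullet> pol k) * (trig (- k) x / L)\<bar> \<le> ?C * (norm a * norm b)" for a b x
  proof -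
    have "\<bar>(a \<bullet> freq k) * (b \<bullet> pol k) * (trig (- k) x / L)\<bar> \<le> (norm a * norm (freq k)) * (norm b * norm (pol k)) * (2 / L)"
      unfolding abs_mult
      using abs_trig_le[of "- k" x] L_pos
      by (intro mult_mono Cauchy_Schwarz_ineq2) (auto intro: divide_right_mono)
    then show ?thesis by (simp add: mult_ac)
  qed
  have "ennreal \<bar>tri_mode k u v\<bar> \<le> (\<integral>\<^sup>+x\<in>cell L. ennreal \<bar>(fld u x \<bullet> freq k) * (fld v x \<bullet> pol k) * (trig (- k) x / L)\<bar> \<partial>lborel)"
    unfolding tri_mode_def by (rule abs_set_integral_le_nn_integral)
  also have "\<dots> \<le> (\<integral>\<^sup>+x. ennreal ?C * (ennreal (norm (fld u x) * norm (fld v x)) * indicator (cell L) x) \<partial>lborel)"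
    using pw C by (intro nn_integral_mono) (auto simp: indicator_def ennreal_mult[symmetric] simp del: ennreal_mult_eq_top_iff intro!: ennreal_leI)
  also have "\<dots> = ennreal ?C * (\<integral>\<^sup>+x\<in>cell L. ennreal (norm (fld u x) * norm (fld v x)) \<partial>lborel)"
    by (rule nn_integral_cmult) measurable
  also have "\<dots> \<le> ennreal ?C * ennreal (hnorm L u * hnorm L v)"
    by (intro mult_left_mono cauchy_schwarz_set_nn_integral) (auto simp: hnorm_nn_integral u v)
  also have "\<dots> = ennreal (?C * (hnorm L u * hnorm L v))" using C by (intro ennreal_mult[symmetric]) auto
  finally show ?thesis using L_pos by (subst (asm) ennreal_le_iff) (intro mult_nonneg_nonneg, auto)
qed

lemma continuous_on_path_tri_mode:
  assumes f: "continuous_map (top_of_set S) (H_topology L) f"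
  shows "continuous_on S (\<lambda>t. tri_mode k (f t) (f t))"
proof (rule continuous_on_path_functional[OF L_pos f, where C="norm (freq k) * norm (pol k) * (2 / L)" and D=0])
  let ?C = "norm (freq k) * norm (pol k) * (2 / L)"
  fix u v assume "u \<in> H L" "v \<in> H L"
  then have uv: "u \<in> L2 L" "v \<in> L2 L" "u - v \<in> L2 L" by (auto intro: H_subset_L2 L2_diff)
  have "\<bar>tri_mode k u u - tri_mode k v v\<bar> \<le> ?C * (hnorm L (u - v) * hnorm L u) + ?C * (hnorm L v * hnorm L (u - v))"
    unfolding tri_mode_diff[OF uv(1,2)]
    using abs_tri_mode_le[OF uv(3,1), of k] abs_tri_mode_le[OF uv(2,3), of k] by linarith
  then show "\<bar>tri_mode k u u - tri_mode k v v\<bar> \<le> hnorm L (u - v) * (?C * (hnorm L u + hnorm L v) + 0)"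
    by (simp add: algebra_simps add_divide_distrib)
qed

text \<open>The rate at which the quadratic term changes half the energy of the modes in
  \<open>trunc n\<close>.\<close>

definition transfer :: "nat \<Rightarrow> vfield \<Rightarrow> real" where
  "transfer n u = (\<Sum>k\<in>trunc n. coef u k * tri_mode k u u)"

lemma continuous_on_path_transfer:
  "continuous_map (top_of_set S) (H_topology L) f \<Longrightarrow> continuous_on S (\<lambda>t. transfer n (f t))"
  unfolding transfer_def coef_def
  by (intro continuous_intros continuous_on_path_tri_mode continuous_on_path_hinner L_pos ek_L2)

text \<open>Dominated convergence: for almost every time the path is in V, the remainder tends to 0
  in H, and the transfer stays below \<open>3 * B\<close> times the squared norm of V, where
  \<open>B\<close> bounds the path in H on the time interval.\<close>

lemma transfer_tendsto_0:
  fixes f :: "real \<Rightarrow> vfield"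
  assumes f: "continuous_map (top_of_set {0..}) (H_topology L) f"
    and V: "AE t in lborel. t \<in> {0..T} \<longrightarrow> f t \<in> V L"
    and int: "set_integrable lborel {0..T} (\<lambda>t. (vnorm (f t))\<^sup>2)"
  shows "(\<lambda>n. LINT t:{0..T}|lborel. \<bar>transfer n (f t)\<bar>) \<longlonglongrightarrow> 0"
proof -
  have fH: "f t \<in> H L" if "t \<ge> 0" for t using continuous_path_tendsto(1)[OF L_pos f] that by simp
  have "continuous_on {0..T} (\<lambda>t. hnorm L (f t))"
    by (rule continuous_on_subset[OF continuous_on_path_hnorm[OF L_pos f]]) auto
  from compact_imp_bounded[OF compact_continuous_image[OF this compact_Icc]]
  obtain B where "\<forall>t\<in>{0..T}. hnorm L (f t) \<le> B" by (auto simp: bounded_iff)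
  then have B: "hnorm L (f t) \<le> B" if "t \<in> {0..T}" for t using that by blast
  have tm: "(\<lambda>t. indicat_real {0..T} t *\<^sub>R \<bar>transfer n (f t)\<bar>) \<in> borel_measurable lborel" for n
  proof -
    have "continuous_on {0..T} (\<lambda>t. \<bar>transfer n (f t)\<bar>)"
      by (rule continuous_on_subset[OF continuous_on_rabs[OF continuous_on_path_transfer[OF f]]]) auto
    from borel_measurable_continuous_on_indicator[OF _ this] show ?thesis by simp
  qed
  have res: "hnorm L (u - fourier_sum (trunc n) (coef u)) \<le> hnorm L u" if "u \<in> H L" for u n
  proof (rule power2_le_imp_le)
    show "(hnorm L (u - fourier_sum (trunc n) (coef u)))\<^sup>2 \<le> (hnorm L u)\<^sup>2"
      unfolding bessel(1)[OF H_subset_L2[OF that] finite_trunc zero_notin_trunc] by (simp add: sum_nonneg)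
  qed simp
  have "(\<lambda>n. LINT t|lborel. indicat_real {0..T} t *\<^sub>R \<bar>transfer n (f t)\<bar>) \<longlonglongrightarrow> (LINT t::real|lborel. 0)"
  proof (rule integral_dominated_convergence)
    show "integrable lborel (\<lambda>t. (3 * B) * (indicat_real {0..T} t *\<^sub>R (vnorm (f t))\<^sup>2))"
      using int by (intro integrable_mult_right) (simp add: set_integrable_def)
    show "AE t in lborel. (\<lambda>n. indicat_real {0..T} t *\<^sub>R \<bar>transfer n (f t)\<bar>) \<longlonglongrightarrow> 0"
      using V
    proof eventually_elim
      case (elim t)
      show ?case
      proof (cases "t \<in> {0..T}")
        case True
        let ?v = "\<lambda>n. f t - fourier_sum (trunc n) (coef (f t))"
        have "(\<lambda>n. 3 * (vnorm (f t))\<^sup>2 * sqrt (hnorm L (f t) * hnorm L (?v n))) \<longlonglongrightarrow> 3 * (vnorm (f t))\<^sup>2 * sqrt (hnorm L (f t) * 0)"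
          using fourier_tendsto[OF fH, of t] True
          by (intro tendsto_intros) (simp add: hnorm_commute[of L "f t"])
        then have "(\<lambda>n. 3 * (vnorm (f t))\<^sup>2 * sqrt (hnorm L (f t) * hnorm L (?v n))) \<longlonglongrightarrow> 0" by simp
        then have "(\<lambda>n. transfer n (f t)) \<longlonglongrightarrow> 0"
          by (rule Lim_null_comparison[rotated])
             (use energy_transfer_bound elim True in \<open>auto simp: transfer_def\<close>)
        then show ?thesis using True by (simp add: tendsto_rabs_zero)
      qed simp
    qed
    show "AE t in lborel. norm (indicat_real {0..T} t *\<^sub>R \<bar>transfer n (f t)\<bar>) \<le> (3 * B) * (indicat_real {0..T} t *\<^sub>R (vnorm (f t))\<^sup>2)" for n
      using V
    proof eventually_elim
      case (elim t)
      show ?case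
      proof (cases "t \<in> {0..T}")
        case True
        let ?v = "f t - fourier_sum (trunc n) (coef (f t))"
        have "f t \<in> H L" using True by (intro fH) simp
        then have "hnorm L (f t) * hnorm L ?v \<le> hnorm L (f t) * hnorm L (f t)"
          by (intro mult_left_mono res) auto
        then have "sqrt (hnorm L (f t) * hnorm L ?v) \<le> sqrt (hnorm L (f t) * hnorm L (f t))" by (rule real_sqrt_le_mono)
        also have "\<dots> \<le> B" using B[OF True] by simp
        finally have "3 * (vnorm (f t))\<^sup>2 * sqrt (hnorm L (f t) * hnorm L ?v) \<le> 3 * (vnorm (f t))\<^sup>2 * B"
          by (intro mult_left_mono) auto
        then show ?thesis using energy_transfer_bound[of "f t" n] elim True
          by (simp add: transfer_def mult_ac)
      qed simp
    qed
  qed (use tm in auto)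
  then show ?thesis by (simp add: set_lebesgue_integral_def)
qed

end

section \<open>A pathwise substitute for Ito's formula\<close>

text \<open>The upper index is left free for the induction; it is applied with
  \<open>n = N\<close>.\<close>

lemma sum_integral_partition:
  fixes f :: "real \<Rightarrow> real" and n N :: nat
  assumes f: "continuous_on {0..T} f" and T: "0 \<le> T" and n: "n \<le> N" "N > 0"
  shows "(\<Sum>i<n. integral {real i * T / N..real (Suc i) * T / N} f) = integral {0..real n * T / N} f"
  using n(1)
proof (induction n)
  case (Suc n)
  have le: "0 \<le> real n * T / N" "real n * T / N \<le> real (Suc n) * T / N"
    using T by (auto intro!: divide_right_mono mult_right_mono)
  have "real (Suc n) * T \<le> real N * T" using Suc.prems T by (intro mult_right_mono) auto
  then have "real (Suc n) * T / N \<le> T" using n(2) by (simp add: field_simps)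
  then have "f integrable_on {0..real (Suc n) * T / N}"
    by (intro integrable_continuous_real continuous_on_subset[OF f]) auto
  from Henstock_Kurzweil_Integration.integral_combine[OF le this]
  show ?case using Suc by simp
qed simp

text \<open>There are \<open>N\<close> errors, each of order o(T / N) uniformly in \<open>i\<close>,
  so their sum is o(1).\<close>

lemma sum_partition_errors_tendsto_0:
  fixes D :: "nat \<Rightarrow> nat \<Rightarrow> real"
  assumes T: "T > 0" and D: "\<And>\<eta>. \<eta> > 0 \<Longrightarrow> \<forall>\<^sub>F N in sequentially. \<forall>i<N. \<bar>D N i\<bar> \<le> T / N * \<eta>"
  shows "(\<lambda>N. \<Sum>i<N. D N i) \<longlonglongrightarrow> 0"
proof (rule LIMSEQ_I)
  fix e :: real assume e: "e > 0"
  have "\<forall>\<^sub>F N in sequentially. \<forall>i<N. \<bar>D N i\<bar> \<le> T / N * (e / (2 * T))" using e T by (intro D) simp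
  with eventually_gt_at_top[of 0] have "\<forall>\<^sub>F N in sequentially. \<bar>\<Sum>i<N. D N i\<bar> < e"
  proof eventually_elim
    case (elim N)
    have "\<bar>\<Sum>i<N. D N i\<bar> \<le> (\<Sum>i<N. \<bar>D N i\<bar>)" by (rule sum_abs)
    also have "\<dots> \<le> (\<Sum>i<N. T / N * (e / (2 * T)))" using elim by (intro sum_mono) auto
    also have "\<dots> = e / 2" using elim T by simp
    also have "\<dots> < e" using e by simp
    finally show ?case .
  qed
  then show "\<exists>no. \<forall>n\<ge>no. norm ((\<Sum>i<n. D n i) - 0) < e" by (simp add: eventually_sequentially)
qed

lemma continuous_on_partition_modulus:
  fixes f :: "real \<Rightarrow> real"
  assumes f: "continuous_on {0..T} f" and T: "T > 0" and \<eta>: "\<eta> > 0"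
  shows "\<forall>\<^sub>F N in sequentially. \<forall>i<N. \<forall>s\<in>{real i * T / N..real (Suc i) * T / N}.
           \<forall>t\<in>{real i * T / N..real (Suc i) * T / N}. \<bar>f s - f t\<bar> \<le> \<eta>"
proof -
  obtain d where d: "d > 0" "\<And>s t. s \<in> {0..T} \<Longrightarrow> t \<in> {0..T} \<Longrightarrow> dist s t < d \<Longrightarrow> dist (f s) (f t) < \<eta>"
    using compact_uniformly_continuous[OF f compact_Icc] \<eta> unfolding uniformly_continuous_on_def by metis
  have "(\<lambda>N. T / real N) \<longlonglongrightarrow> 0" by (rule lim_const_over_n)
  then have "\<forall>\<^sub>F N in sequentially. T / real N < d" using d(1) by (rule order_tendstoD)
  with eventually_gt_at_top[of 0] show ?thesis
  proof eventually_elim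
    case (elim N)
    show ?case
    proof (intro allI impI ballI)
      fix i s t assume i: "i < N" and s: "s \<in> {real i * T / N..real (Suc i) * T / N}" and t: "t \<in> {real i * T / N..real (Suc i) * T / N}"
      have "real (Suc i) * T \<le> real N * T" using i T by (intro mult_right_mono) auto
      then have "real (Suc i) * T / N \<le> T" using elim by (simp add: field_simps)
      moreover have "0 \<le> real i * T / N" using T by simp
      ultimately have st: "s \<in> {0..T}" "t \<in> {0..T}" using s t by auto
      have "real (Suc i) * T / N - real i * T / N = T / N" using elim by (simp add: field_simps)
      then have "dist s t < d" using s t elim by (auto simp: dist_real_def)
      from d(2)[OF st this] show "\<bar>f s - f t\<bar> \<le> \<eta>" by (simp add: dist_real_def)
    qed
  qed
qed

lemma partition_bounds:
  fixes i N :: nat and T :: real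
  assumes "i < N" "T > 0"
  shows "0 \<le> real i * T / N" "real i * T / N \<le> real (Suc i) * T / N" "real (Suc i) * T / N \<le> T"
    "real (Suc i) * T / N - real i * T / N = T / N" "{real i * T / N..real (Suc i) * T / N} \<subseteq> {0..T}"
proof -
  have "real (Suc i) * T \<le> real N * T" using assms by (intro mult_right_mono) auto
  then show c: "real (Suc i) * T / N \<le> T" using assms by (simp add: field_simps)
  show a: "0 \<le> real i * T / N" using assms by simp
  show "real i * T / N \<le> real (Suc i) * T / N" using assms by (intro divide_right_mono mult_right_mono) auto
  show "real (Suc i) * T / N - real i * T / N = T / N" using assms by (simp add: field_simps)
  show "{real i * T / N..real (Suc i) * T / N} \<subseteq> {0..T}" using a c by auto
qed

lemma integral_error_bound:
  fixes f :: "real \<Rightarrow> real"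
  assumes "a \<le> b" "continuous_on {a..b} f" "\<And>t. t \<in> {a..b} \<Longrightarrow> \<bar>f t\<bar> \<le> C"
  shows "\<bar>integral {a..b} f\<bar> \<le> (b - a) * C"
  using integral_bound[of a b f C] assms by (simp add: mult.commute)

lemma riemann_sum_tendsto:
  fixes f :: "real \<Rightarrow> real"
  assumes f: "continuous_on {0..T} f" and T: "T > 0"
  shows "(\<lambda>N. \<Sum>i<N. T / N * f (real i * T / N)) \<longlonglongrightarrow> integral {0..T} f"
proof -
  define D where "D N i = T / N * f (real i * T / N) - integral {real i * T / N..real (Suc i) * T / N} f" for N i :: nat
  have "(\<lambda>N. \<Sum>i<N. D N i) \<longlonglongrightarrow> 0"
  proof (rule sum_partition_errors_tendsto_0[OF T])
    fix \<eta> :: real assume "\<eta> > 0"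
    from continuous_on_partition_modulus[OF f T this]
    show "\<forall>\<^sub>F N in sequentially. \<forall>i<N. \<bar>D N i\<bar> \<le> T / N * \<eta>"
    proof eventually_elim
      case (elim N)
      show ?case
      proof (intro allI impI)
        fix i assume i: "i < N"
        let ?a = "real i * T / N" and ?b = "real (Suc i) * T / N"
        note p = partition_bounds[OF i T]
        have fc: "continuous_on {?a..?b} f" using f p(5) by (rule continuous_on_subset)
        have "integral {?a..?b} (\<lambda>t. f ?a - f t) = integral {?a..?b} (\<lambda>t. f ?a) - integral {?a..?b} f"
          by (rule Henstock_Kurzweil_Integration.integral_diff)
             (intro integrable_continuous_real continuous_on_const fc)+
        also have "integral {?a..?b} (\<lambda>t. f ?a) = T / N * f ?a"
          using p(2,4) by simp
        finally have eq: "D N i = integral {?a..?b} (\<lambda>t. f ?a - f t)" by (simp add: D_def)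
        have "\<bar>integral {?a..?b} (\<lambda>t. f ?a - f t)\<bar> \<le> (?b - ?a) * \<eta>"
        proof (rule integral_error_bound[OF p(2)])
          show "continuous_on {?a..?b} (\<lambda>t. f ?a - f t)"
            by (intro continuous_on_diff continuous_on_const fc)
          show "\<bar>f ?a - f t\<bar> \<le> \<eta>" if "t \<in> {?a..?b}" for t
            using elim[rule_format, OF i _ that] p(2) by simp
        qed
        then show "\<bar>D N i\<bar> \<le> T / N * \<eta>" unfolding eq p(4) .
      qed
    qed
  qed
  moreover have "\<forall>\<^sub>F N in sequentially. (\<Sum>i<N. D N i) = (\<Sum>i<N. T / N * f (real i * T / N)) - integral {0..T} f"
    using eventually_gt_at_top[of 0]
  proof eventually_elim
    case (elim N)
    then show ?case using sum_integral_partition[OF f _ order_refl elim] T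
      by (simp add: D_def sum_subtractf)
  qed
  ultimately have "(\<lambda>N. (\<Sum>i<N. T / N * f (real i * T / N)) - integral {0..T} f) \<longlonglongrightarrow> 0"
    by (rule Lim_transform_eventually)
  then show ?thesis by (simp add: LIM_zero_iff)
qed

text \<open>Expand the increment of a X^2 over a grid interval, using that X moves by a drift part G
  and a noise part \<Delta>. The terms a (2 X \<Delta> + \<Delta>^2) at the left end point are kept
  as the sum on the left; the drift terms form a Riemann integral, and the rest is negligible.
  Nothing but continuity of \<open>B\<close> is used: its quadratic variation stays inside the sum,
  and its probabilistic limit is treated separately.\<close>

lemma discrete_ito:
  fixes X g B :: "real \<Rightarrow> real" and c T :: real
  defines "a \<equiv> \<lambda>t. exp (- c * (T - t))"
  assumes T: "T > 0" and c: "c > 0"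
    and X: "continuous_on {0..T} X" and g: "continuous_on {0..T} g" and B: "continuous_on {0..T} B"
    and eq: "\<And>t. t \<in> {0..T} \<Longrightarrow> X t = X 0 + integral {0..t} g + (B t - B 0)"
  shows "(\<lambda>N. \<Sum>i<N. a (real i * T / N) * (2 * X (real i * T / N) * (B (real (Suc i) * T / N) - B (real i * T / N))
            + (B (real (Suc i) * T / N) - B (real i * T / N))\<^sup>2))
    \<longlonglongrightarrow> (X T)\<^sup>2 - exp (- c * T) * (X 0)\<^sup>2 - integral {0..T} (\<lambda>s. a s * (c * (X s)\<^sup>2 + 2 * X s * g s))"
proof -
  define t where "t N i = real i * T / real N" for N i :: nat
  define F where "F = (\<lambda>s. a s * (c * (X s)\<^sup>2 + 2 * X s * g s))"
  have ac: "continuous_on S a" for S unfolding a_def by (intro continuous_intros)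
  have Fc: "continuous_on {0..T} F" unfolding F_def by (intro continuous_intros ac X g)
  define \<Delta> where "\<Delta> N i = B (t N (Suc i)) - B (t N i)" for N i
  define S where "S N i = a (t N i) * (2 * X (t N i) * \<Delta> N i + (\<Delta> N i)\<^sup>2)" for N i
  define D where "D N i = a (t N (Suc i)) * (X (t N (Suc i)))\<^sup>2 - a (t N i) * (X (t N i))\<^sup>2 - S N i
      - integral {t N i..t N (Suc i)} F" for N i
  obtain M0 where M0: "\<forall>s\<in>{0..T}. \<bar>g s\<bar> \<le> M0"
    using compact_imp_bounded[OF compact_continuous_image[OF g compact_Icc]] by (auto simp: bounded_iff)
  define M where "M = \<bar>M0\<bar>"
  have M: "\<bar>g s\<bar> \<le> M" if "s \<in> {0..T}" for s using bspec[OF M0 that] by (simp add: M_def)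
  have M_nn: "0 \<le> M" by (simp add: M_def)
  have a1: "0 < a s" for s by (simp add: a_def)
  have a2: "a s \<le> 1" if "s \<in> {0..T}" for s using that c by (simp add: a_def)
  have "(\<lambda>N. \<Sum>i<N. D N i) \<longlonglongrightarrow> 0"
  proof (rule sum_partition_errors_tendsto_0[OF T])
    fix \<eta>' :: real assume \<eta>': "\<eta>' > 0"
    \<comment> \<open>The three error terms below contribute \<open>c\<close>, \<open>2 * M\<close>
      and \<open>3 * M\<close>, in units of \<eta> times the mesh.\<close>
    define \<eta> where "\<eta> = \<eta>' / (c + 5 * M + 1)"
    have den: "c + 5 * M + 1 > 0" using c M_nn by simp
    have \<eta>: "\<eta> > 0" using \<eta>' den by (simp add: \<eta>_def)
    have X2: "continuous_on {0..T} (\<lambda>s. (X s)\<^sup>2)" and aX: "continuous_on {0..T} (\<lambda>s. a s * X s)"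
      by (intro continuous_intros ac X)+
    have "(\<lambda>N. T * M / real N) \<longlonglongrightarrow> 0" by (rule lim_const_over_n)
    then have "\<forall>\<^sub>F N in sequentially. T * M / real N < \<eta>" using \<eta> by (rule order_tendstoD)
    with continuous_on_partition_modulus[OF X2 T \<eta>] continuous_on_partition_modulus[OF aX T \<eta>]
      continuous_on_partition_modulus[OF B T \<eta>]
    show "\<forall>\<^sub>F N in sequentially. \<forall>i<N. \<bar>D N i\<bar> \<le> T / N * \<eta>'"
    proof eventually_elim
      case (elim N)
      show ?case
      proof (intro allI impI)
        fix i assume i: "i < N"
        let ?a = "t N i" and ?b = "t N (Suc i)"
        note p = partition_bounds[OF i T, folded t_def]
        note e = elim(1-3)[rule_format, OF i, folded t_def]
        have sub: "s \<in> {0..T}" if "s \<in> {?a..?b}" for s using p(5) that by auto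
        have co: "continuous_on {?a..?b} X" "continuous_on {?a..?b} g" "continuous_on {?a..?b} F"
          using X g Fc p(5) by (auto intro: continuous_on_subset)
        define G where "G = integral {?a..?b} g"
        have "g integrable_on {0..?b}" using p by (intro integrable_continuous_real continuous_on_subset[OF g]) auto
        from Henstock_Kurzweil_Integration.integral_combine[OF p(1,2) this]
        have XG: "X ?b = X ?a + G + \<Delta> N i"
          using eq[OF sub, of ?a] eq[OF sub, of ?b] p(2) by (simp add: \<Delta>_def G_def)
        have "\<bar>G\<bar> \<le> (?b - ?a) * M" unfolding G_def by (intro integral_error_bound p co M sub)
        then have Gb: "\<bar>G\<bar> \<le> T / N * M" by (simp add: p(4))
        then have Gb': "\<bar>G\<bar> \<le> \<eta>" using elim(4) by simp
        have \<Delta>b: "\<bar>\<Delta> N i\<bar> \<le> \<eta>" unfolding \<Delta>_def using p(2) by (intro e(3)) auto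
        have "((\<lambda>s. a s) has_real_derivative c * a s) (at s)" for s
          unfolding a_def by (auto intro!: derivative_eq_intros)
        then have "((\<lambda>s. c * a s) has_integral a ?b - a ?a) {?a..?b}"
          using p(2) by (intro fundamental_theorem_of_calculus)
            (auto simp: has_real_derivative_iff_has_vector_derivative[symmetric] intro: has_field_derivative_at_within)
        then have ai: "integral {?a..?b} (\<lambda>s. c * a s) = a ?b - a ?a" by (rule integral_unique)
        \<comment> \<open>\<open>P\<close> is the error of using the final value of the squared path
          while the weight changes, \<open>R\<close> that of freezing weight times path at the left
          end point in the drift. The third error collects the products of G with \<Delta> and with
          itself.\<close>
        define P where "P s = c * a s * ((X ?b)\<^sup>2 - (X s)\<^sup>2)" for s
        define R where "R s = 2 * (a ?a * X ?a - a s * X s) * g s" for s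
        have Pc: "continuous_on {?a..?b} P" and Rc: "continuous_on {?a..?b} R"
          unfolding P_def R_def by (intro continuous_intros co ac)+
        have "integral {?a..?b} P + integral {?a..?b} R + integral {?a..?b} F = integral {?a..?b} (\<lambda>s. (P s + R s) + F s)"
          using Pc Rc co(3) by (simp add: Henstock_Kurzweil_Integration.integral_add integrable_continuous_real integrable_add)
        also have "\<dots> = integral {?a..?b} (\<lambda>s. (X ?b)\<^sup>2 * (c * a s) + (2 * a ?a * X ?a) * g s)"
          by (intro arg_cong[where f="integral _"] ext) (simp add: P_def R_def F_def algebra_simps)
        also have "\<dots> = (X ?b)\<^sup>2 * (a ?b - a ?a) + (2 * a ?a * X ?a) * G"
          using co(2) ac[of "{?a..?b}"]
          by (subst Henstock_Kurzweil_Integration.integral_add)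
             (auto intro!: integrable_continuous_real continuous_intros simp: ai[symmetric] G_def)
        finally have DN: "D N i = integral {?a..?b} P + integral {?a..?b} R + a ?a * (2 * \<Delta> N i * G + G\<^sup>2)"
          unfolding D_def S_def XG by (simp add: algebra_simps power2_eq_square)
        have 1: "\<bar>integral {?a..?b} P\<bar> \<le> (?b - ?a) * (c * \<eta>)"
        proof (intro integral_error_bound p Pc)
          fix s assume s: "s \<in> {?a..?b}"
          have "c * a s * \<bar>(X ?b)\<^sup>2 - (X s)\<^sup>2\<bar> \<le> c * 1 * \<eta>"
            using c a2[OF sub[OF s]] less_imp_le[OF a1[of s]] s p(2) e(1) by (intro mult_mono) auto
          then show "\<bar>P s\<bar> \<le> c * \<eta>" using c a1[of s] by (simp add: P_def abs_mult)
        qed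
        have 2: "\<bar>integral {?a..?b} R\<bar> \<le> (?b - ?a) * (2 * \<eta> * M)"
        proof (intro integral_error_bound p Rc)
          fix s assume s: "s \<in> {?a..?b}"
          have "2 * \<bar>a ?a * X ?a - a s * X s\<bar> * \<bar>g s\<bar> \<le> 2 * \<eta> * M"
            using s p(2) e(2) M[OF sub[OF s]] \<eta> by (intro mult_mono) auto
          moreover have "\<bar>R s\<bar> = 2 * \<bar>a ?a * X ?a - a s * X s\<bar> * \<bar>g s\<bar>"
            unfolding R_def abs_mult by simp
          ultimately show "\<bar>R s\<bar> \<le> 2 * \<eta> * M" by simp
        qed
        have 3: "\<bar>a ?a * (2 * \<Delta> N i * G + G\<^sup>2)\<bar> \<le> T / N * (3 * \<eta> * M)"
        proof -
          have "2 * \<Delta> N i * G + G\<^sup>2 = (2 * \<Delta> N i + G) * G"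
            by (simp add: algebra_simps power2_eq_square)
          then have "\<bar>a ?a * (2 * \<Delta> N i * G + G\<^sup>2)\<bar> = a ?a * (\<bar>2 * \<Delta> N i + G\<bar> * \<bar>G\<bar>)"
            using a1[of ?a] by (simp add: abs_mult)
          also have "\<dots> \<le> 1 * ((3 * \<eta>) * (T / N * M))"
            using a2[OF sub, of ?a] p(2) Gb Gb' \<Delta>b \<eta> by (intro mult_mono) auto
          finally show ?thesis by (simp add: mult_ac)
        qed
        have tri: "\<bar>x + y + z\<bar> \<le> x' + y' + z'" if "\<bar>x\<bar> \<le> x'" "\<bar>y\<bar> \<le> y'" "\<bar>z\<bar> \<le> z'" for x y z x' y' z' :: real
          using that by linarith
        have "\<bar>D N i\<bar> \<le> T / N * (c * \<eta>) + T / N * (2 * \<eta> * M) + T / N * (3 * \<eta> * M)"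
          unfolding DN by (rule tri[OF 1[unfolded p(4)] 2[unfolded p(4)] 3])
        also have "\<dots> = T / N * (\<eta> * (c + 5 * M))" by (simp add: algebra_simps add_divide_distrib)
        also have "\<dots> \<le> T / N * \<eta>'"
        proof (intro mult_left_mono)
          have "\<eta> * (c + 5 * M) \<le> \<eta> * (c + 5 * M + 1)" using \<eta> by (intro mult_left_mono) auto
          also have "\<dots> = \<eta>'" using den by (simp add: \<eta>_def)
          finally show "\<eta> * (c + 5 * M) \<le> \<eta>'" .
        qed (use T in auto)
        finally show "\<bar>D N i\<bar> \<le> T / N * \<eta>'" .
      qed
    qed
  qed
  moreover have "\<forall>\<^sub>F N in sequentially. (\<Sum>i<N. D N i) = (X T)\<^sup>2 - exp (- c * T) * (X 0)\<^sup>2 - integral {0..T} F - (\<Sum>i<N. S N i)"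
    using eventually_gt_at_top[of 0]
  proof eventually_elim
    case (elim N)
    have "(\<Sum>i<N. a (t N (Suc i)) * (X (t N (Suc i)))\<^sup>2 - a (t N i) * (X (t N i))\<^sup>2) = a (t N N) * (X (t N N))\<^sup>2 - a (t N 0) * (X (t N 0))\<^sup>2"
      by (rule sum_lessThan_telescope)
    also have "\<dots> = (X T)\<^sup>2 - exp (- c * T) * (X 0)\<^sup>2" using elim by (simp add: t_def a_def)
    finally show ?case
      using sum_integral_partition[OF Fc _ order_refl elim] T elim
      by (simp add: D_def sum_subtractf t_def[abs_def])
  qed
  ultimately have "(\<lambda>N. (X T)\<^sup>2 - exp (- c * T) * (X 0)\<^sup>2 - integral {0..T} F - (\<Sum>i<N. S N i)) \<longlonglongrightarrow> 0"
    by (rule Lim_transform_eventually)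
  from tendsto_diff[OF tendsto_const[of "(X T)\<^sup>2 - exp (- c * T) * (X 0)\<^sup>2 - integral {0..T} F"] this]
  have "(\<lambda>N. \<Sum>i<N. S N i) \<longlonglongrightarrow> (X T)\<^sup>2 - exp (- c * T) * (X 0)\<^sup>2 - integral {0..T} F" by simp
  then show ?thesis by (simp only: S_def \<Delta>_def t_def F_def)
qed

section \<open>Gaussian increments\<close>

text \<open>Completing the square: the exponential factor shifts the mean by the variance.\<close>

lemma nn_integral_exp_normal:
  assumes \<sigma>: "\<sigma> > 0"
  shows "(\<integral>\<^sup>+x. ennreal (normal_density 0 \<sigma> x) * ennreal (exp x) \<partial>lborel) = ennreal (exp (\<sigma>\<^sup>2 / 2))"
proof -
  have "normal_density 0 \<sigma> x * exp x = exp (\<sigma>\<^sup>2 / 2) * normal_density (\<sigma>\<^sup>2) \<sigma> x" for x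
  proof -
    have "- x\<^sup>2 / (2 * \<sigma>\<^sup>2) + x = \<sigma>\<^sup>2 / 2 + - (x - \<sigma>\<^sup>2)\<^sup>2 / (2 * \<sigma>\<^sup>2)"
      using \<sigma> by (simp add: field_simps power2_eq_square)
    then have "exp (- x\<^sup>2 / (2 * \<sigma>\<^sup>2)) * exp x = exp (\<sigma>\<^sup>2 / 2) * exp (- (x - \<sigma>\<^sup>2)\<^sup>2 / (2 * \<sigma>\<^sup>2))"
      by (simp only: exp_add[symmetric])
    then show ?thesis by (simp add: normal_density_def)
  qed
  then have "(\<integral>\<^sup>+x. ennreal (normal_density 0 \<sigma> x) * ennreal (exp x) \<partial>lborel) =
      (\<integral>\<^sup>+x. ennreal (exp (\<sigma>\<^sup>2 / 2)) * ennreal (normal_density (\<sigma>\<^sup>2) \<sigma> x) \<partial>lborel)"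
    by (simp add: ennreal_mult[symmetric])
  also have "\<dots> = ennreal (exp (\<sigma>\<^sup>2 / 2)) * (\<integral>\<^sup>+x. ennreal (normal_density (\<sigma>\<^sup>2) \<sigma> x) \<partial>lborel)"
    by (rule nn_integral_cmult) measurable
  also have "(\<integral>\<^sup>+x. ennreal (normal_density (\<sigma>\<^sup>2) \<sigma> x) \<partial>lborel) = 1"
    using prob_space.emeasure_space_1[OF prob_space_normal_density[OF \<sigma>, of "\<sigma>\<^sup>2"]]
    by (simp add: emeasure_density)
  finally show ?thesis by simp
qed

context prob_space
begin

lemma centered_normal_mgf:
  assumes Y: "centered_normal M Y v" and v: "0 \<le> v"
  shows "(\<integral>\<^sup>+\<omega>. ennreal (exp (Y \<omega>)) \<partial>M) = ennreal (exp (v / 2))"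
proof (cases "v = 0")
  case True
  then have "AE \<omega> in M. Y \<omega> = 0" using Y by (simp add: centered_normal_def)
  then have "(\<integral>\<^sup>+\<omega>. ennreal (exp (Y \<omega>)) \<partial>M) = (\<integral>\<^sup>+\<omega>. 1 \<partial>M)"
    by (intro nn_integral_cong_AE) auto
  then show ?thesis using True by (simp add: emeasure_space_1)
next
  case False
  then have "distributed M lborel Y (normal_density 0 (sqrt v))" using Y by (simp add: centered_normal_def)
  from distributed_nn_integral[OF this, of "\<lambda>x. ennreal (exp x)"]
  have "(\<integral>\<^sup>+\<omega>. ennreal (exp (Y \<omega>)) \<partial>M) = (\<integral>\<^sup>+x. ennreal (normal_density 0 (sqrt v) x) * ennreal (exp x) \<partial>lborel)"
    by simp
  then show ?thesis using nn_integral_exp_normal[of "sqrt v"] False v by simp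
qed

text \<open>The fourth moment of a centred normal variable is 3 v^2, so its centred square has
  variance 3 v^2 - v^2.\<close>

lemma centered_normal_square:
  assumes Y: "centered_normal M Y v" and v: "0 \<le> v"
  shows "integrable M (\<lambda>\<omega>. (Y \<omega>)\<^sup>2 - v)" "(LINT \<omega>|M. (Y \<omega>)\<^sup>2 - v) = 0"
    "integrable M (\<lambda>\<omega>. ((Y \<omega>)\<^sup>2 - v)\<^sup>2)" "(LINT \<omega>|M. ((Y \<omega>)\<^sup>2 - v)\<^sup>2) = 2 * v\<^sup>2"
proof -
  have [measurable]: "Y \<in> borel_measurable M" using Y by (simp add: centered_normal_def)
  have "has_bochner_integral M (\<lambda>\<omega>. (Y \<omega>)\<^sup>2 - v) 0 \<and> has_bochner_integral M (\<lambda>\<omega>. ((Y \<omega>)\<^sup>2 - v)\<^sup>2) (2 * v\<^sup>2)"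
  proof (cases "v = 0")
    case True
    then have ae: "AE \<omega> in M. Y \<omega> = 0" using Y by (simp add: centered_normal_def)
    have "has_bochner_integral M (\<lambda>\<omega>. (Y \<omega>)\<^sup>2 - v) 0 \<longleftrightarrow> has_bochner_integral M (\<lambda>\<omega>. 0::real) 0"
      by (rule has_bochner_integral_cong_AE) (use ae True in auto)
    moreover have "has_bochner_integral M (\<lambda>\<omega>. ((Y \<omega>)\<^sup>2 - v)\<^sup>2) 0 \<longleftrightarrow> has_bochner_integral M (\<lambda>\<omega>. 0::real) 0"
      by (rule has_bochner_integral_cong_AE) (use ae True in auto)
    ultimately show ?thesis using True by (simp add: has_bochner_integral_zero)
  next
    case False
    then have d: "distributed M lborel Y (normal_density 0 (sqrt v))" using Y by (simp add: centered_normal_def)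
    have s: "sqrt v > 0" using False v by simp
    let ?n = "normal_density 0 (sqrt v)"
    have m0: "has_bochner_integral lborel ?n 1"
      using normal_moment_even[OF s, of 0 0] by simp
    have m2: "has_bochner_integral lborel (\<lambda>x. ?n x * x\<^sup>2) v"
      using normal_moment_even[OF s, of 0 1] v by (simp add: fact_numeral)
    have m4: "has_bochner_integral lborel (\<lambda>x. ?n x * x ^ 4) (3 * v\<^sup>2)"
      using normal_moment_even[OF s, of 0 2] v False by (simp add: fact_numeral power2_eq_square)
    have h1: "has_bochner_integral lborel (\<lambda>x. ?n x * (x\<^sup>2 - v)) 0"
    proof -
      have "has_bochner_integral lborel (\<lambda>x. ?n x * x\<^sup>2 - v * ?n x) (v - v * 1)"
        by (intro has_bochner_integral_diff has_bochner_integral_mult_right m0 m2)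
      then show ?thesis by (simp add: algebra_simps)
    qed
    have h2: "has_bochner_integral lborel (\<lambda>x. ?n x * (x\<^sup>2 - v)\<^sup>2) (2 * v\<^sup>2)"
    proof -
      have "has_bochner_integral lborel (\<lambda>x. (?n x * x ^ 4 - (2 * v) * (?n x * x\<^sup>2)) + v\<^sup>2 * ?n x) ((3 * v\<^sup>2 - (2 * v) * v) + v\<^sup>2 * 1)"
        by (intro has_bochner_integral_add has_bochner_integral_diff has_bochner_integral_mult_right m0 m2 m4)
      moreover have "(?n x * x ^ 4 - (2 * v) * (?n x * x\<^sup>2)) + v\<^sup>2 * ?n x = ?n x * (x\<^sup>2 - v)\<^sup>2" for x
        by (simp add: power2_eq_square power4_eq_xxxx algebra_simps)
      moreover have "(3 * v\<^sup>2 - (2 * v) * v) + v\<^sup>2 * 1 = 2 * v\<^sup>2" by (simp add: power2_eq_square)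
      ultimately show ?thesis by simp
    qed
    have tr: "has_bochner_integral M (\<lambda>\<omega>. g (Y \<omega>)) c"
      if "has_bochner_integral lborel (\<lambda>x. ?n x * g x) c" and [measurable]: "g \<in> borel_measurable borel" for g c
      using that distributed_integrable[OF d, of g] distributed_integral[OF d, of g]
      by (auto simp: has_bochner_integral_iff)
    show ?thesis using tr[OF h1] tr[OF h2] by simp
  qed
  then show "integrable M (\<lambda>\<omega>. (Y \<omega>)\<^sup>2 - v)" "(LINT \<omega>|M. (Y \<omega>)\<^sup>2 - v) = 0"
    "integrable M (\<lambda>\<omega>. ((Y \<omega>)\<^sup>2 - v)\<^sup>2)" "(LINT \<omega>|M. ((Y \<omega>)\<^sup>2 - v)\<^sup>2) = 2 * v\<^sup>2"
    by (auto simp: has_bochner_integral_iff)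
qed

end

text \<open>A positive bound \<open>q\<close> for the norm of \<open>Q\<close> is fixed: the
  variances are only estimated from above, and \<open>q\<close> will occur in a denominator.\<close>

locale wiener = torus L + prob_space M
  for L :: real and M :: "'a measure" +
  fixes F :: "real \<Rightarrow> 'a measure" and w :: "real \<Rightarrow> 'a \<Rightarrow> vfield" and Q :: "vfield \<Rightarrow> vfield" and q :: real
  assumes filtered: "filtered_prob_space M F"
    and wiener: "wiener_process L M F (Q \<circ> Q) w"
    and Q_selfadjoint: "positive_selfadjoint L Q"
    and q_pos: "q > 0" and Q_le: "\<And>x. x \<in> H L \<Longrightarrow> hnorm L (Q x) \<le> q * hnorm L x"
begin

lemma F_subalgebra: "subalgebra M (F t)"
  using filtered by (simp add: filtered_prob_space_def)

lemma space_F [simp]: "space (F t) = space M"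
  using F_subalgebra by (simp add: subalgebra_def)

lemma F_mono: "s \<le> t \<Longrightarrow> sets (F s) \<subseteq> sets (F t)"
  using filtered filtration.sets_F_mono[of "space M" F s t] by (simp add: filtered_prob_space_def)

lemma F_measurable_M: "f \<in> measurable (F t) N \<Longrightarrow> f \<in> measurable M N"
  by (rule measurable_from_subalg[OF F_subalgebra])

lemma F_measurable_mono: "f \<in> measurable (F s) N \<Longrightarrow> s \<le> t \<Longrightarrow> f \<in> measurable (F t) N"
  using measurable_mono[of N N "F s" "F t"] F_mono by auto

lemma w_measurable: "t \<ge> 0 \<Longrightarrow> w t \<in> measurable (F t) (borelH L)"
  using wiener by (simp add: wiener_process_def)

lemma H_of_measurable: "f \<in> measurable (F t) (borelH L) \<Longrightarrow> \<omega> \<in> space M \<Longrightarrow> f \<omega> \<in> H L"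
  using measurable_space[of f "F t" "borelH L" \<omega>] by (simp add: space_borelH L_pos)

lemma coef_measurable_borelH [measurable]: "(\<lambda>u. coef u k) \<in> borel_measurable (borelH L)"
  unfolding coef_def by (intro borelH_measurable_continuous L_pos continuous_map_hinner ek_L2)

definition inc :: "real \<Rightarrow> real \<Rightarrow> 'a \<Rightarrow> vfield" where
  "inc s t \<omega> = w t \<omega> - w s \<omega>"

lemma Q_H: "x \<in> H L \<Longrightarrow> Q x \<in> H L"
  using Q_selfadjoint by (auto simp: positive_selfadjoint_def bounded_in_H_def linear_in_H_def)

lemma inc_normal:
  assumes "0 \<le> s" "s < t" and h: "h \<in> H L"
  shows "centered_normal M (\<lambda>\<omega>. hinner L (inc s t \<omega>) h) ((t - s) * (hnorm L (Q h))\<^sup>2)"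
proof -
  have "hinner L ((Q \<circ> Q) h) h = (hnorm L (Q h))\<^sup>2"
    using Q_selfadjoint h Q_H[OF h] by (simp add: positive_selfadjoint_def hnorm_square)
  moreover have "centered_normal M (\<lambda>\<omega>. hinner L (w t \<omega> - w s \<omega>) h) ((t - s) * hinner L ((Q \<circ> Q) h) h)"
    using wiener assms unfolding wiener_process_def by blast
  ultimately show ?thesis unfolding inc_def by (simp only:)
qed

lemma inc_indep_set:
  assumes "0 \<le> s" "s < t"
  shows "indep_set (sets (F s)) (sets (vimage_algebra (space M) (inc s t) (borelH L)))"
  using wiener assms unfolding wiener_process_def inc_def[abs_def] by blast

lemma inc_H: "0 \<le> s \<Longrightarrow> s < t \<Longrightarrow> \<omega> \<in> space M \<Longrightarrow> inc s t \<omega> \<in> H L"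
  using H_of_measurable[OF w_measurable] by (simp add: inc_def H_diff)

text \<open>Subtraction need not be measurable for the product of the Borel sigma-algebra of H with
  itself without a countable base. Measurability is instead read off from independence, which
  includes that all preimages are events.\<close>

lemma inc_measurable:
  assumes "0 \<le> s" "s < t"
  shows "inc s t \<in> measurable M (borelH L)"
proof (rule measurableI)
  show "inc s t \<omega> \<in> space (borelH L)" if "\<omega> \<in> space M" for \<omega>
    using inc_H[OF assms that] by (simp add: space_borelH L_pos)
  fix A assume "A \<in> sets (borelH L)"
  then have "inc s t -` A \<inter> space M \<in> sets (vimage_algebra (space M) (inc s t) (borelH L))"
    by (rule in_vimage_algebra)
  then show "inc s t -` A \<inter> space M \<in> sets M"
    using inc_indep_set[OF assms] by (auto simp: indep_set_def indep_sets_def UNIV_bool split: bool.splits)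
qed

lemma inc_indep_var:
  assumes st: "0 \<le> s" "s < t" and f: "f \<in> borel_measurable (F s)" and g: "g \<in> borel_measurable (borelH L)"
  shows "indep_var borel f borel (\<lambda>\<omega>. g (inc s t \<omega>))"
proof -
  let ?V = "vimage_algebra (space M) (inc s t) (borelH L)"
  let ?A = "sigma_sets (space M) {f -` A \<inter> space M |A. A \<in> sets borel}"
  let ?B = "sigma_sets (space M) {(\<lambda>\<omega>. g (inc s t \<omega>)) -` A \<inter> space M |A. A \<in> sets borel}"
  have "{f -` A \<inter> space M |A. A \<in> sets borel} \<subseteq> sets (F s)"
    using measurable_sets[OF f] by auto
  from sets.sigma_sets_subset[OF this] have A: "?A \<subseteq> sets (F s)" by simp
  have gv: "(\<lambda>\<omega>. g (inc s t \<omega>)) \<in> borel_measurable ?V"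
    using inc_H[OF st] g by (intro measurable_compose[OF measurable_vimage_algebra1]) (auto simp: space_borelH L_pos)
  have "{(\<lambda>\<omega>. g (inc s t \<omega>)) -` A \<inter> space M |A. A \<in> sets borel} \<subseteq> sets ?V"
    using measurable_sets[OF gv] by auto
  from sets.sigma_sets_subset[OF this] have B: "?B \<subseteq> sets ?V" by simp
  have "indep_sets (case_bool (sets (F s)) (sets ?V)) UNIV"
    using inc_indep_set[OF st] by (simp add: indep_set_def)
  then have "indep_set ?A ?B"
    unfolding indep_set_def by (rule indep_sets_mono_sets) (use A B in \<open>simp split: bool.split\<close>)
  then show ?thesis
    unfolding indep_var_eq using F_measurable_M[OF f] measurable_compose[OF inc_measurable[OF st] g] by simp
qed

text \<open>The whole past is treated as one random variable, the identity map into
  \<open>F s\<close>. Independence then says that past and increment have a product law.\<close>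

lemma inc_joint_distribution:
  assumes st: "0 \<le> s" "s < t"
  shows "distr M (F s) (\<lambda>\<omega>. \<omega>) \<Otimes>\<^sub>M distr M (borelH L) (inc s t) = distr M (F s \<Otimes>\<^sub>M borelH L) (\<lambda>\<omega>. (\<omega>, inc s t \<omega>))"
proof -
  have id: "(\<lambda>\<omega>. \<omega>) \<in> measurable M (F s)"
    by (rule F_measurable_M[of _ s]) simp
  note inc = inc_measurable[OF st]
  interpret A: prob_space "distr M (F s) (\<lambda>\<omega>. \<omega>)" by (rule prob_space_distr[OF id])
  interpret D: prob_space "distr M (borelH L) (inc s t)" by (rule prob_space_distr[OF inc])
  show ?thesis
  proof (rule pair_measure_eqI)
    fix A B assume A: "A \<in> sets (distr M (F s) (\<lambda>\<omega>. \<omega>))" and B: "B \<in> sets (distr M (borelH L) (inc s t))"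
    let ?B = "inc s t -` B \<inter> space M"
    have A': "A \<in> sets (F s)" "A \<subseteq> space M" using A sets.sets_into_space[of A "F s"] by auto
    have B': "?B \<in> sets (vimage_algebra (space M) (inc s t) (borelH L))" using B by (intro in_vimage_algebra) simp
    have "emeasure M (A \<inter> ?B) = emeasure M A * emeasure M ?B"
      using indep_setD[OF inc_indep_set[OF st] A'(1) B'] by (simp add: emeasure_eq_measure ennreal_mult)
    moreover have "(\<lambda>\<omega>. (\<omega>, inc s t \<omega>)) -` (A \<times> B) \<inter> space M = A \<inter> ?B" using A'(2) by auto
    moreover have "(\<lambda>\<omega>. \<omega>) -` A \<inter> space M = A" using A'(2) by auto
    ultimately show "emeasure (distr M (F s) (\<lambda>\<omega>. \<omega>)) A * emeasure (distr M (borelH L) (inc s t)) B =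
        emeasure (distr M (F s \<Otimes>\<^sub>M borelH L) (\<lambda>\<omega>. (\<omega>, inc s t \<omega>))) (A \<times> B)"
      using A' B id inc by (simp add: emeasure_distr)
  qed (simp_all add: A.sigma_finite_measure_axioms D.sigma_finite_measure_axioms cong: sets_pair_measure_cong)
qed

text \<open>Replaces conditional expectation given the past: the increment may be integrated first,
  over a fresh copy, with everything measurable at time \<open>s\<close> frozen.\<close>

lemma nn_integral_inc:
  assumes st: "0 \<le> s" "s < t" and f: "f \<in> borel_measurable (F s \<Otimes>\<^sub>M borelH L)"
  shows "(\<integral>\<^sup>+\<omega>. f (\<omega>, inc s t \<omega>) \<partial>M) = (\<integral>\<^sup>+\<omega>. (\<integral>\<^sup>+\<omega>'. f (\<omega>, inc s t \<omega>') \<partial>M) \<partial>M)"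
proof -
  have iv: "random_variable (F s) (\<lambda>\<omega>. \<omega>)" "random_variable (borelH L) (inc s t)"
    by (rule F_measurable_M[of _ s], simp) (rule inc_measurable[OF st])
  interpret D: prob_space "distr M (borelH L) (inc s t)" by (rule prob_space_distr[OF iv(2)])
  have "(\<integral>\<^sup>+\<omega>. f (\<omega>, inc s t \<omega>) \<partial>M) = (\<integral>\<^sup>+p. f p \<partial>distr M (F s \<Otimes>\<^sub>M borelH L) (\<lambda>\<omega>. (\<omega>, inc s t \<omega>)))"
    using iv f by (subst nn_integral_distr) auto
  also have "\<dots> = (\<integral>\<^sup>+\<omega>. (\<integral>\<^sup>+d. f (\<omega>, d) \<partial>distr M (borelH L) (inc s t)) \<partial>distr M (F s) (\<lambda>\<omega>. \<omega>))"
    unfolding inc_joint_distribution[OF st, symmetric] using f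
    by (intro D.nn_integral_fst[symmetric]) (simp cong: measurable_cong_sets)
  also have "\<dots> = (\<integral>\<^sup>+\<omega>. (\<integral>\<^sup>+d. f (\<omega>, d) \<partial>distr M (borelH L) (inc s t)) \<partial>M)"
    using iv(1) f by (subst nn_integral_distr) (auto intro!: D.borel_measurable_nn_integral_fst cong: measurable_cong_sets)
  also have "\<dots> = (\<integral>\<^sup>+\<omega>. (\<integral>\<^sup>+\<omega>'. f (\<omega>, inc s t \<omega>') \<partial>M) \<partial>M)"
  proof (rule nn_integral_cong)
    fix \<omega> assume "\<omega> \<in> space M"
    then have "(\<lambda>d. f (\<omega>, d)) \<in> borel_measurable (borelH L)"
      using measurable_compose[OF measurable_Pair1' f, of \<omega>] by simp
    then show "(\<integral>\<^sup>+d. f (\<omega>, d) \<partial>distr M (borelH L) (inc s t)) = (\<integral>\<^sup>+\<omega>'. f (\<omega>, inc s t \<omega>') \<partial>M)"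
      using iv(2) by (subst nn_integral_distr) auto
  qed
  finally show ?thesis .
qed

lemma coef_inc_measurable:
  assumes "0 \<le> s" "s < t"
  shows "(\<lambda>\<omega>. coef (inc s t \<omega>) k) \<in> borel_measurable (F t)"
proof -
  have ws: "w s \<in> measurable (F t) (borelH L)" "w t \<in> measurable (F t) (borelH L)"
    using assms by (auto intro: w_measurable F_measurable_mono[of "w s" s])
  then have m: "(\<lambda>\<omega>. coef (w t \<omega>) k - coef (w s \<omega>) k) \<in> borel_measurable (F t)"
    by (intro borel_measurable_diff measurable_compose[OF _ coef_measurable_borelH])
  show ?thesis
    by (subst measurable_cong[where g="\<lambda>\<omega>. coef (w t \<omega>) k - coef (w s \<omega>) k"])
       (use ws m in \<open>auto simp: inc_def coef_diff H_subset_L2 H_of_measurable\<close>)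
qed

section \<open>The discrete exponential supermartingale\<close>

text \<open>The linear combination is the inner product of the increment with one finite sum h of
  modes. It is normal with variance (t - s) |Q h|^2, at most (t - s) q^2 |h|^2, and the subtracted
  term is half of this bound.\<close>

lemma exp_inc_le:
  assumes st: "0 \<le> s" "s < t" and K: "finite K" "0 \<notin> K"
  shows "(\<integral>\<^sup>+\<omega>. ennreal (exp ((\<Sum>k\<in>K. \<theta> k * coef (inc s t \<omega>) k) - (t - s) / 2 * q\<^sup>2 * (\<Sum>k\<in>K. (\<theta> k)\<^sup>2))) \<partial>M) \<le> 1"
proof -
  let ?h = "fourier_sum K \<theta>" and ?S = "\<Sum>k\<in>K. (\<theta> k)\<^sup>2"
  let ?v = "(t - s) * (hnorm L (Q ?h))\<^sup>2"
  let ?C = "(t - s) / 2 * q\<^sup>2 * ?S"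
  have hm: "(\<lambda>\<omega>. hinner L (inc s t \<omega>) ?h) \<in> borel_measurable M"
    using inc_normal[OF st fourier_sum_H] by (simp add: centered_normal_def)
  have "(hnorm L (Q ?h))\<^sup>2 \<le> (q * hnorm L ?h)\<^sup>2" by (intro power_mono Q_le fourier_sum_H) simp
  then have "(hnorm L (Q ?h))\<^sup>2 \<le> q\<^sup>2 * ?S" by (simp add: power_mult_distrib hnorm_fourier_sum[OF K])
  then have "(t - s) * (hnorm L (Q ?h))\<^sup>2 \<le> (t - s) * (q\<^sup>2 * ?S)" using st by (intro mult_left_mono) auto
  then have vle: "?v / 2 - ?C \<le> 0" by simp
  have "(\<integral>\<^sup>+\<omega>. ennreal (exp ((\<Sum>k\<in>K. \<theta> k * coef (inc s t \<omega>) k) - ?C)) \<partial>M) =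
      (\<integral>\<^sup>+\<omega>. ennreal (exp (- ?C)) * ennreal (exp (hinner L (inc s t \<omega>) ?h)) \<partial>M)"
    by (intro nn_integral_cong)
       (simp add: hinner_fourier_sum_right H_subset_L2[OF inc_H[OF st]] ennreal_mult[symmetric] exp_add[symmetric])
  also have "\<dots> = ennreal (exp (- ?C)) * ennreal (exp (?v / 2))"
    using hm centered_normal_mgf[OF inc_normal[OF st fourier_sum_H]] st by (subst nn_integral_cmult) auto
  also have "\<dots> = ennreal (exp (?v / 2 - ?C))" by (simp add: ennreal_mult[symmetric] exp_add[symmetric])
  also have "\<dots> \<le> 1" using vle by (simp add: ennreal_le_1)
  finally show ?thesis .
qed

definition sq_inc :: "(nat \<Rightarrow> real) \<Rightarrow> int \<times> int \<Rightarrow> nat \<Rightarrow> 'a \<Rightarrow> real" where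
  "sq_inc t k i \<omega> = (coef (inc (t i) (t (Suc i)) \<omega>) k)\<^sup>2 - (t (Suc i) - t i) * (hnorm L (Q (ek k)))\<^sup>2"

context
  fixes t :: "nat \<Rightarrow> real"
  assumes t0: "0 \<le> t 0" and t_less: "\<And>i. t i < t (Suc i)"
begin

lemma t_nonneg: "0 \<le> t i"
  by (induction i) (use t0 t_less in \<open>auto intro: order_trans less_imp_le\<close>)

text \<open>Peel off the last increment: with the past frozen, \<open>exp_inc_le\<close> bounds its
  factor by 1. Measurability is part of the induction, since freezing requires that the earlier
  factors belong to the past.\<close>

lemma exp_supermartingale:
  assumes K: "finite K" "0 \<notin> K" and \<theta>: "\<And>i k. (\<lambda>\<omega>. \<theta> i k \<omega>) \<in> borel_measurable (F (t i))"
  shows "(\<lambda>\<omega>. \<Sum>i<n. (\<Sum>k\<in>K. \<theta> i k \<omega> * coef (inc (t i) (t (Suc i)) \<omega>) k)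
         - (t (Suc i) - t i) / 2 * q\<^sup>2 * (\<Sum>k\<in>K. (\<theta> i k \<omega>)\<^sup>2)) \<in> borel_measurable (F (t n)) \<and>
    (\<integral>\<^sup>+\<omega>. ennreal (exp (\<Sum>i<n. (\<Sum>k\<in>K. \<theta> i k \<omega> * coef (inc (t i) (t (Suc i)) \<omega>) k)
         - (t (Suc i) - t i) / 2 * q\<^sup>2 * (\<Sum>k\<in>K. (\<theta> i k \<omega>)\<^sup>2))) \<partial>M) \<le> 1"
proof (induction n)
  case 0
  then show ?case by (simp add: emeasure_space_1)
next
  case (Suc n)
  let ?e = "\<lambda>i \<omega>. (\<Sum>k\<in>K. \<theta> i k \<omega> * coef (inc (t i) (t (Suc i)) \<omega>) k)
         - (t (Suc i) - t i) / 2 * q\<^sup>2 * (\<Sum>k\<in>K. (\<theta> i k \<omega>)\<^sup>2)"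
  have \<theta>n [measurable]: "(\<lambda>\<omega>. \<theta> n k \<omega>) \<in> borel_measurable (F (t n))" for k by (rule \<theta>)
  have Sn [measurable]: "(\<lambda>\<omega>. \<Sum>i<n. ?e i \<omega>) \<in> borel_measurable (F (t n))" using Suc by blast
  have mono: "f \<in> borel_measurable (F (t (Suc n)))" if "f \<in> borel_measurable (F (t n))" for f :: "'a \<Rightarrow> real"
    using that t_less[of n] by (auto intro: F_measurable_mono)
  have "(\<lambda>\<omega>. (\<Sum>i<n. ?e i \<omega>) + ?e n \<omega>) \<in> borel_measurable (F (t (Suc n)))"
    by (intro borel_measurable_add borel_measurable_diff borel_measurable_sum borel_measurable_times
        borel_measurable_const borel_measurable_power mono Sn \<theta>n coef_inc_measurable t_nonneg t_less)
  moreover have "(\<integral>\<^sup>+\<omega>. ennreal (exp (\<Sum>i<Suc n. ?e i \<omega>)) \<partial>M) \<le> 1"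
  proof -
    define f where "f = (\<lambda>(\<omega>, d). ennreal (exp (\<Sum>i<n. ?e i \<omega>)) *
      ennreal (exp ((\<Sum>k\<in>K. \<theta> n k \<omega> * coef d k) - (t (Suc n) - t n) / 2 * q\<^sup>2 * (\<Sum>k\<in>K. (\<theta> n k \<omega>)\<^sup>2))))"
    have f: "f \<in> borel_measurable (F (t n) \<Otimes>\<^sub>M borelH L)"
      unfolding f_def by measurable
    have "(\<integral>\<^sup>+\<omega>. ennreal (exp (\<Sum>i<Suc n. ?e i \<omega>)) \<partial>M) = (\<integral>\<^sup>+\<omega>. f (\<omega>, inc (t n) (t (Suc n)) \<omega>) \<partial>M)"
      by (simp add: f_def exp_add ennreal_mult)
    also have "\<dots> = (\<integral>\<^sup>+\<omega>. (\<integral>\<^sup>+\<omega>'. f (\<omega>, inc (t n) (t (Suc n)) \<omega>') \<partial>M) \<partial>M)"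
      by (rule nn_integral_inc[OF t_nonneg t_less f])
    also have "\<dots> \<le> (\<integral>\<^sup>+\<omega>. ennreal (exp (\<Sum>i<n. ?e i \<omega>)) * 1 \<partial>M)"
    proof (rule nn_integral_mono)
      fix \<omega>
      have m: "(\<lambda>\<omega>'. coef (inc (t n) (t (Suc n)) \<omega>') k) \<in> borel_measurable M" for k
        by (rule F_measurable_M[OF coef_inc_measurable[OF t_nonneg t_less]])
      have "(\<integral>\<^sup>+\<omega>'. f (\<omega>, inc (t n) (t (Suc n)) \<omega>') \<partial>M) = ennreal (exp (\<Sum>i<n. ?e i \<omega>)) *
        (\<integral>\<^sup>+\<omega>'. ennreal (exp ((\<Sum>k\<in>K. \<theta> n k \<omega> * coef (inc (t n) (t (Suc n)) \<omega>') k) - (t (Suc n) - t n) / 2 * q\<^sup>2 * (\<Sum>k\<in>K. (\<theta> n k \<omega>)\<^sup>2))) \<partial>M)"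
        unfolding f_def using m by (simp add: nn_integral_cmult)
      also have "\<dots> \<le> ennreal (exp (\<Sum>i<n. ?e i \<omega>)) * 1"
        by (intro mult_left_mono exp_inc_le t_nonneg t_less K) simp
      finally show "(\<integral>\<^sup>+\<omega>'. f (\<omega>, inc (t n) (t (Suc n)) \<omega>') \<partial>M) \<le> ennreal (exp (\<Sum>i<n. ?e i \<omega>)) * 1" .
    qed
    also have "\<dots> \<le> 1" using Suc by simp
    finally show ?thesis .
  qed
  ultimately show ?case by simp
qed

text \<open>The centred squares have mean 0 and are independent of the past, so mixed terms vanish
  and the variances add up. On a grid of \<open>n\<close> steps of length T / n the bound is of
  order 1 / n.\<close>

lemma quadratic_variation:
  assumes a: "\<And>i. \<bar>a i\<bar> \<le> 1" and h: "\<And>i. t (Suc i) - t i = h"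
  shows "(\<lambda>\<omega>. \<Sum>i<n. a i * sq_inc t k i \<omega>) \<in> borel_measurable (F (t n)) \<and>
    integrable M (\<lambda>\<omega>. (\<Sum>i<n. a i * sq_inc t k i \<omega>)\<^sup>2) \<and>
    (LINT \<omega>|M. (\<Sum>i<n. a i * sq_inc t k i \<omega>)\<^sup>2) \<le> real n * (2 * (h * (hnorm L (Q (ek k)))\<^sup>2)\<^sup>2)"
proof (induction n)
  case (Suc n)
  let ?v = "h * (hnorm L (Q (ek k)))\<^sup>2"
  let ?S = "\<lambda>\<omega>. \<Sum>i<n. a i * sq_inc t k i \<omega>" and ?z = "sq_inc t k n"
  have z_eq: "sq_inc t k n = (\<lambda>\<omega>. (coef (inc (t n) (t (Suc n)) \<omega>) k)\<^sup>2 - ?v)"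
    by (simp add: sq_inc_def h fun_eq_iff)
  have "0 \<le> ?v" using t_less[of n] h[of n] by (intro mult_nonneg_nonneg) auto
  then have z: "integrable M ?z" "(LINT \<omega>|M. ?z \<omega>) = 0" "integrable M (\<lambda>\<omega>. (?z \<omega>)\<^sup>2)" "(LINT \<omega>|M. (?z \<omega>)\<^sup>2) = 2 * ?v\<^sup>2"
    using centered_normal_square[of "\<lambda>\<omega>. coef (inc (t n) (t (Suc n)) \<omega>) k" ?v]
      inc_normal[OF t_nonneg t_less ek_H, of n k] by (simp_all add: z_eq coef_def h)
  have Sm: "?S \<in> borel_measurable (F (t n))" and S2: "integrable M (\<lambda>\<omega>. (?S \<omega>)\<^sup>2)"
    and Sb: "(LINT \<omega>|M. (?S \<omega>)\<^sup>2) \<le> real n * (2 * ?v\<^sup>2)" using Suc by auto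
  have [measurable]: "?S \<in> borel_measurable M" by (rule F_measurable_M[OF Sm])
  have S1: "integrable M ?S"
    by (rule square_integrable_imp_integrable[OF _ S2]) measurable
  have zc: "(\<lambda>d. (coef d k)\<^sup>2 - ?v) \<in> borel_measurable (borelH L)" by measurable
  have iv: "indep_var borel ?S borel ?z"
    unfolding z_eq by (rule inc_indep_var[OF t_nonneg t_less Sm zc])
  have Sz: "integrable M (\<lambda>\<omega>. ?S \<omega> * ?z \<omega>)" "(LINT \<omega>|M. ?S \<omega> * ?z \<omega>) = 0"
    using indep_var_integrable[OF iv S1 z(1)] indep_var_lebesgue_integral[OF iv S1 z(1)] z(2) by auto
  have exp: "(\<Sum>i<Suc n. a i * sq_inc t k i \<omega>)\<^sup>2 = ((?S \<omega>)\<^sup>2 + (2 * a n) * (?S \<omega> * ?z \<omega>)) + (a n)\<^sup>2 * (?z \<omega>)\<^sup>2" for \<omega>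
    by (simp add: power2_eq_square algebra_simps)
  have m: "(\<lambda>\<omega>. ?S \<omega> + a n * ?z \<omega>) \<in> borel_measurable (F (t (Suc n)))"
    unfolding z_eq using t_less[of n]
    by (intro borel_measurable_add borel_measurable_times borel_measurable_const borel_measurable_diff
        borel_measurable_power coef_inc_measurable t_nonneg t_less F_measurable_mono[OF Sm]) auto
  have int: "integrable M (\<lambda>\<omega>. (\<Sum>i<Suc n. a i * sq_inc t k i \<omega>)\<^sup>2)"
    unfolding exp by (intro Bochner_Integration.integrable_add integrable_mult_right S2 Sz z)
  have "(LINT \<omega>|M. (\<Sum>i<Suc n. a i * sq_inc t k i \<omega>)\<^sup>2) =
      (LINT \<omega>|M. (?S \<omega>)\<^sup>2) + (2 * a n) * (LINT \<omega>|M. ?S \<omega> * ?z \<omega>) + (a n)\<^sup>2 * (LINT \<omega>|M. (?z \<omega>)\<^sup>2)"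
    unfolding exp
    by (subst Bochner_Integration.integral_add Bochner_Integration.integral_add)
       (auto intro!: Bochner_Integration.integrable_add integrable_mult_right S2 Sz z simp: Bochner_Integration.integral_add S2 Sz)
  also have "\<dots> \<le> real n * (2 * ?v\<^sup>2) + 1 * (2 * ?v\<^sup>2)"
    using Sb a[of n] unfolding Sz(2) z(4) by (intro add_mono mult_right_mono) (auto simp: abs_square_le_1)
  finally have "(LINT \<omega>|M. (\<Sum>i<Suc n. a i * sq_inc t k i \<omega>)\<^sup>2) \<le> real (Suc n) * (2 * ?v\<^sup>2)"
    by (simp add: algebra_simps)
  then show ?case using m int by simp
qed simp

end

end

section \<open>Exponential moments of the solution\<close>

context torus begin

text \<open>Testing the equation with each mode gives a scalar equation with continuous drift, to
  which \<open>discrete_ito\<close> applies. \<open>l1\<close> is the limit of the noise sums and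
  \<open>mu1 * l2\<close> will be the limit of the compensator. The inequality records that
  dissipation pays for that compensator as well.\<close>

lemma pathwise_energy:
  fixes f b :: "real \<Rightarrow> vfield" and T \<epsilon> :: real and n :: nat
  defines "a \<equiv> \<lambda>s. exp (- mu1 * (T - s))"
  assumes T: "T > 0" and x: "x \<in> H L"
    and f: "continuous_map (top_of_set {0..}) (H_topology L) f"
    and b: "continuous_map (top_of_set {0..}) (H_topology L) b" and b0: "b 0 = 0"
    and eq: "\<And>t \<phi>. t \<ge> 0 \<Longrightarrow> \<phi> \<in> stokes_dom L \<Longrightarrow>
       hinner L (f t) \<phi> + (LINT s:{0..t}|lborel. hinner L (f s) (stokes L \<phi>))
         - (LINT s:{0..t}|lborel. tri L (f s) \<phi> (f s)) = hinner L x \<phi> + sqrt \<epsilon> * hinner L (b t) \<phi>"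
  obtains l1 l2 where
    "(\<lambda>N. \<Sum>k\<in>trunc n. \<Sum>i<N. a (real i * T / N) *
        (2 * coef (f (real i * T / N)) k * (sqrt \<epsilon> * coef (b (real (Suc i) * T / N) - b (real i * T / N)) k)
         + (sqrt \<epsilon> * coef (b (real (Suc i) * T / N) - b (real i * T / N)) k)\<^sup>2)) \<longlonglongrightarrow> l1"
    "(\<lambda>N. \<Sum>i<N. T / N * ((a (real i * T / N))\<^sup>2 * (\<Sum>k\<in>trunc n. (coef (f (real i * T / N)) k)\<^sup>2))) \<longlonglongrightarrow> l2"
    "(\<Sum>k\<in>trunc n. (coef (f T) k)\<^sup>2) - exp (- mu1 * T) * (hnorm L x)\<^sup>2
       - 2 * (LINT t:{0..T}|lborel. \<bar>transfer n (f t)\<bar>) \<le> l1 - mu1 * l2"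
proof -
  have fH: "f t \<in> H L" and bH: "b t \<in> H L" if "t \<ge> 0" for t
    using continuous_path_tendsto(1)[OF L_pos f] continuous_path_tendsto(1)[OF L_pos b] that by auto
  have fc: "continuous_on {0..t} (\<lambda>s. coef (f s) k)" and bc: "continuous_on {0..t} (\<lambda>s. coef (b s) k)"
    and tc: "continuous_on {0..t} (\<lambda>s. tri_mode k (f s) (f s))" for t k
    unfolding coef_def
    by (rule continuous_on_subset[OF continuous_on_path_hinner[OF L_pos f ek_L2]], simp)
       (rule continuous_on_subset[OF continuous_on_path_hinner[OF L_pos b ek_L2]], simp,
        rule continuous_on_subset[OF continuous_on_path_tri_mode[OF f]], simp)
  define g where "g k s = tri_mode k (f s) (f s) - mu k * coef (f s) k" for k s
  have gc: "continuous_on {0..t} (g k)" for k t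
    unfolding g_def by (intro continuous_intros fc tc)
  have mode: "coef (f t) k + mu k * integral {0..t} (\<lambda>s. coef (f s) k) - integral {0..t} (\<lambda>s. tri_mode k (f s) (f s))
      = coef x k + sqrt \<epsilon> * coef (b t) k" if "t \<ge> 0" for t k
  proof -
    have "(LINT s:{0..t}|lborel. hinner L (f s) (stokes L (ek k))) = (LINT s:{0..t}|lborel. mu k * coef (f s) k)"
      by (simp add: stokes_ek hinner_scaleR_right coef_def)
    also have "\<dots> = mu k * integral {0..t} (\<lambda>s. coef (f s) k)"
      using set_borel_integral_eq_integral(2)[OF borel_integrable_atLeastAtMost'[OF fc]] by simp
    finally have 1: "(LINT s:{0..t}|lborel. hinner L (f s) (stokes L (ek k))) = mu k * integral {0..t} (\<lambda>s. coef (f s) k)" .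
    have "(LINT s:{0..t}|lborel. tri L (f s) (ek k) (f s)) = (LINT s:{0..t}|lborel. tri_mode k (f s) (f s))"
      using fH by (intro set_lebesgue_integral_cong) (auto intro!: tri_ek H_subset_L2)
    also have "\<dots> = integral {0..t} (\<lambda>s. tri_mode k (f s) (f s))"
      by (rule set_borel_integral_eq_integral(2)[OF borel_integrable_atLeastAtMost'[OF tc]])
    finally show ?thesis using eq[OF that ek_stokes_dom, of k] 1 by (simp add: coef_def)
  qed
  \<comment> \<open>At time 0 both integrals run over a single point, so the tested equation itself
    yields the initial condition.\<close>
  have f0: "coef (f 0) k = coef x k" for k
    using mode[of 0 k] b0 by (simp add: coef_def)
  have Xeq: "coef (f t) k = coef (f 0) k + integral {0..t} (g k) + (sqrt \<epsilon> * coef (b t) k - sqrt \<epsilon> * coef (b 0) k)"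
    if "t \<in> {0..T}" for t k
  proof -
    have "integral {0..t} (g k) = integral {0..t} (\<lambda>s. tri_mode k (f s) (f s)) - mu k * integral {0..t} (\<lambda>s. coef (f s) k)"
      unfolding g_def
      by (subst Henstock_Kurzweil_Integration.integral_diff) (auto intro!: integrable_continuous_real continuous_intros fc tc)
    then show ?thesis using mode[of t k] that f0[of k] b0 by (simp add: coef_def)
  qed
  define G where "G k s = a s * (mu1 * (coef (f s) k)\<^sup>2 + 2 * coef (f s) k * g k s)" for k s
  define S where "S s = (\<Sum>k\<in>trunc n. (coef (f s) k)\<^sup>2)" for s
  have ac: "continuous_on A a" for A unfolding a_def by (intro continuous_intros)
  have Gc: "continuous_on {0..T} (G k)" for k unfolding G_def by (intro continuous_intros ac fc gc)
  have Sc: "continuous_on {0..T} S" unfolding S_def by (intro continuous_intros fc)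
  define l1 where "l1 = (\<Sum>k\<in>trunc n. (coef (f T) k)\<^sup>2 - exp (- mu1 * T) * (coef (f 0) k)\<^sup>2 - integral {0..T} (G k))"
  define l2 where "l2 = integral {0..T} (\<lambda>s. (a s)\<^sup>2 * S s)"
  have cb: "sqrt \<epsilon> * coef (b s - b t) k = sqrt \<epsilon> * coef (b s) k - sqrt \<epsilon> * coef (b t) k" if "s \<ge> 0" "t \<ge> 0" for s t k
    using bH that by (simp add: coef_diff H_subset_L2 right_diff_distrib)
  have "(\<lambda>N. \<Sum>k\<in>trunc n. \<Sum>i<N. a (real i * T / N) *
        (2 * coef (f (real i * T / N)) k * (sqrt \<epsilon> * coef (b (real (Suc i) * T / N) - b (real i * T / N)) k)
         + (sqrt \<epsilon> * coef (b (real (Suc i) * T / N) - b (real i * T / N)) k)\<^sup>2)) \<longlonglongrightarrow> l1"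
    unfolding l1_def
  proof (rule tendsto_sum)
    fix k
    have bk: "continuous_on {0..T} (\<lambda>t. sqrt \<epsilon> * coef (b t) k)"
      by (intro continuous_intros bc)
    have cbk: "sqrt \<epsilon> * coef (b (real (Suc i) * T / N) - b (real i * T / N)) k =
        sqrt \<epsilon> * coef (b (real (Suc i) * T / N)) k - sqrt \<epsilon> * coef (b (real i * T / N)) k" for i N :: nat
      by (rule cb) (use T in auto)
    show "(\<lambda>N. \<Sum>i<N. a (real i * T / N) *
        (2 * coef (f (real i * T / N)) k * (sqrt \<epsilon> * coef (b (real (Suc i) * T / N) - b (real i * T / N)) k)
         + (sqrt \<epsilon> * coef (b (real (Suc i) * T / N) - b (real i * T / N)) k)\<^sup>2))
      \<longlonglongrightarrow> (coef (f T) k)\<^sup>2 - exp (- mu1 * T) * (coef (f 0) k)\<^sup>2 - integral {0..T} (G k)"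
      using discrete_ito[OF T mu1_pos fc gc bk Xeq[where k=k]]
      unfolding a_def G_def cbk by simp
  qed
  moreover have "(\<lambda>N. \<Sum>i<N. T / N * ((a (real i * T / N))\<^sup>2 * S (real i * T / N))) \<longlonglongrightarrow> l2"
    unfolding l2_def by (intro riemann_sum_tendsto T continuous_intros ac Sc)
  moreover have "S T - exp (- mu1 * T) * (hnorm L x)\<^sup>2 - 2 * (LINT t:{0..T}|lborel. \<bar>transfer n (f t)\<bar>) \<le> l1 - mu1 * l2"
  proof -
    have trc: "continuous_on {0..T} (\<lambda>s. \<bar>transfer n (f s)\<bar>)"
      by (rule continuous_on_subset[OF continuous_on_rabs[OF continuous_on_path_transfer[OF f]]]) auto
    have "(\<Sum>k\<in>trunc n. integral {0..T} (G k)) + mu1 * l2 = integral {0..T} (\<lambda>s. (\<Sum>k\<in>trunc n. G k s) + mu1 * ((a s)\<^sup>2 * S s))"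
      unfolding l2_def using Gc Sc ac
      by (subst Henstock_Kurzweil_Integration.integral_add)
         (auto intro!: integrable_continuous_real continuous_intros Henstock_Kurzweil_Integration.integral_sum[symmetric])
    also have "\<dots> \<le> integral {0..T} (\<lambda>s. 2 * \<bar>transfer n (f s)\<bar>)"
    proof (rule integral_le)
      show "(\<lambda>s. (\<Sum>k\<in>trunc n. G k s) + mu1 * ((a s)\<^sup>2 * S s)) integrable_on {0..T}"
        by (intro integrable_continuous_real continuous_intros Gc Sc ac)
      show "(\<lambda>s. 2 * \<bar>transfer n (f s)\<bar>) integrable_on {0..T}"
        by (intro integrable_continuous_real continuous_intros trc)
      fix s assume s: "s \<in> {0..T}"
      have a: "0 < a s" "a s \<le> 1" using s mu1_pos by (auto simp: a_def)
      have S0: "0 \<le> S s" by (simp add: S_def sum_nonneg)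
      define E where "E = (\<Sum>k\<in>trunc n. mu k * (coef (f s) k)\<^sup>2)"
      \<comment> \<open>The dissipation enters below as \<open>2 * E\<close>. One \<open>E\<close>
        absorbs \<open>mu1 * S s\<close> from the derivative of the weight, the other absorbs
        \<open>a s * (mu1 * S s)\<close> from the compensator, where \<open>a s \<le> 1\<close> is
        used.\<close>
      have ES: "mu1 * S s \<le> E" unfolding E_def S_def using poincare[of "trunc n" "coef (f s)"] by (simp add: dirichlet_def)
      have "(\<Sum>k\<in>trunc n. G k s) = a s * (mu1 * S s + 2 * transfer n (f s) - 2 * E)"
        by (simp add: G_def g_def S_def E_def transfer_def sum_distrib_left sum.distrib sum_subtractf
            algebra_simps power2_eq_square)
      then have "(\<Sum>k\<in>trunc n. G k s) + mu1 * ((a s)\<^sup>2 * S s) = a s * (mu1 * S s + a s * (mu1 * S s) - 2 * E + 2 * transfer n (f s))"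
        by (simp add: algebra_simps power2_eq_square)
      also have "\<dots> \<le> a s * (2 * \<bar>transfer n (f s)\<bar>)"
      proof (rule mult_left_mono)
        have "a s * (mu1 * S s) \<le> 1 * (mu1 * S s)" using a S0 mu1_pos by (intro mult_right_mono) auto
        then show "mu1 * S s + a s * (mu1 * S s) - 2 * E + 2 * transfer n (f s) \<le> 2 * \<bar>transfer n (f s)\<bar>"
          using ES by linarith
      qed (use a in simp)
      also have "\<dots> \<le> 1 * (2 * \<bar>transfer n (f s)\<bar>)" using a by (intro mult_right_mono) auto
      finally show "(\<Sum>k\<in>trunc n. G k s) + mu1 * ((a s)\<^sup>2 * S s) \<le> 2 * \<bar>transfer n (f s)\<bar>" by simp
    qed
    also have "\<dots> = 2 * (LINT t:{0..T}|lborel. \<bar>transfer n (f t)\<bar>)"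
      using set_borel_integral_eq_integral(2)[OF borel_integrable_atLeastAtMost'[OF trc]] by simp
    finally have "(\<Sum>k\<in>trunc n. integral {0..T} (G k)) + mu1 * l2 \<le> 2 * (LINT t:{0..T}|lborel. \<bar>transfer n (f t)\<bar>)" .
    moreover have "exp (- mu1 * T) * (\<Sum>k\<in>trunc n. (coef x k)\<^sup>2) \<le> exp (- mu1 * T) * (hnorm L x)\<^sup>2"
      using bessel(2)[OF H_subset_L2[OF x], of "trunc n"] by (intro mult_left_mono) auto
    ultimately show ?thesis
      by (simp add: l1_def S_def f0 sum_subtractf sum_distrib_left)
  qed
  ultimately show ?thesis by (intro that) (auto simp: S_def)
qed

end

context wiener begin

text \<open>Chosen so that 2 q^2 \<open>rate\<close> = \<open>mu1\<close>: then a step of length h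
  has compensator (h / 2) q^2 (2 \<open>rate\<close> a X)^2 / \<epsilon> = (\<open>rate\<close> /
  \<epsilon>) \<open>mu1\<close> h a^2 X^2, exactly the amount that dissipation can pay.\<close>

definition rate :: real where
  "rate = mu1 / (2 * q\<^sup>2)"

lemma rate_pos: "rate > 0"
  using mu1_pos q_pos by (simp add: rate_def)

section \<open>The exponential bound for one initial value and one time T\<close>

context
  fixes \<epsilon> :: real and x :: vfield and u :: "real \<Rightarrow> 'a \<Rightarrow> vfield" and T tr :: real
  assumes \<epsilon>: "\<epsilon> > 0" and x: "x \<in> H L" and u: "navier_stokes_solution L M F w \<epsilon> x u" and T: "T > 0"
    and tr: "\<And>n. (\<Sum>k\<in>trunc n. (hnorm L (Q (ek k)))\<^sup>2) \<le> tr"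
begin

definition wt :: "real \<Rightarrow> real" where "wt s = exp (- mu1 * (T - s))"

abbreviation grid :: "nat \<Rightarrow> nat \<Rightarrow> real" where "grid N i \<equiv> real i * T / real N"

lemma u_measurable: "t \<ge> 0 \<Longrightarrow> u t \<in> measurable (F t) (borelH L)"
  using u by (simp add: navier_stokes_solution_def)

text \<open>The discrete stochastic integral of 2 a X against the scaled noise, times
  \<open>rate / \<epsilon>\<close>, together with its compensator. Coefficients are evaluated at
  left end points, hence belong to the past of the increment.\<close>

definition expo :: "nat \<Rightarrow> nat \<Rightarrow> 'a \<Rightarrow> real" where
  "expo n N \<omega> = (\<Sum>i<N. (\<Sum>k\<in>trunc n. (rate / \<epsilon> * (2 * sqrt \<epsilon> * wt (grid N i) * coef (u (grid N i) \<omega>) k)) *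
       coef (inc (grid N i) (grid N (Suc i)) \<omega>) k)
     - (grid N (Suc i) - grid N i) / 2 * q\<^sup>2 *
       (\<Sum>k\<in>trunc n. (rate / \<epsilon> * (2 * sqrt \<epsilon> * wt (grid N i) * coef (u (grid N i) \<omega>) k))\<^sup>2))"

lemma grid_less: "N > 0 \<Longrightarrow> grid N i < grid N (Suc i)"
  using T by (simp add: divide_strict_right_mono)

lemma grid_diff: "N > 0 \<Longrightarrow> grid N (Suc i) - grid N i = T / N"
  by (simp add: field_simps)

lemma expo_supermartingale:
  assumes N: "N > 0"
  shows "expo n N \<in> borel_measurable M" "(\<integral>\<^sup>+\<omega>. ennreal (exp (expo n N \<omega>)) \<partial>M) \<le> 1"
proof -
  have "(\<lambda>\<omega>. rate / \<epsilon> * (2 * sqrt \<epsilon> * wt (grid N i) * coef (u (grid N i) \<omega>) k)) \<in> borel_measurable (F (grid N i))" for i k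
    using measurable_compose[OF u_measurable coef_measurable_borelH, of "grid N i" k] T
    by (intro borel_measurable_times borel_measurable_const) auto
  note * = exp_supermartingale[where t="grid N" and K="trunc n" and n=N, OF _ grid_less[OF N] finite_trunc zero_notin_trunc this]
  show "expo n N \<in> borel_measurable M"
    using F_measurable_M[OF conjunct1[OF *]] by (simp add: expo_def[abs_def])
  show "(\<integral>\<^sup>+\<omega>. ennreal (exp (expo n N \<omega>)) \<partial>M) \<le> 1"
    using conjunct2[OF *] by (simp add: expo_def)
qed

definition qv_error :: "nat \<Rightarrow> (int \<times> int) \<Rightarrow> 'a \<Rightarrow> real" where
  "qv_error N k \<omega> = (\<Sum>i<N. wt (grid N i) * ((coef (inc (grid N i) (grid N (Suc i)) \<omega>) k)\<^sup>2 - T / N * (hnorm L (Q (ek k)))\<^sup>2))"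

lemma qv_error_props:
  assumes N: "N > 0"
  shows "integrable M (\<lambda>\<omega>. (qv_error N k \<omega>)\<^sup>2)"
    "(LINT \<omega>|M. (qv_error N k \<omega>)\<^sup>2) \<le> 2 * T\<^sup>2 * (hnorm L (Q (ek k))) ^ 4 / N"
proof -
  \<comment> \<open>Set to 0 beyond the grid, so that the bound by 1 holds for every index.\<close>
  define a where "a i = (if i < N then wt (grid N i) else 0)" for i
  have a1: "\<bar>a i\<bar> \<le> 1" for i
    using partition_bounds[OF _ T, of i N] mu1_pos by (auto simp: a_def wt_def)
  have eq: "qv_error N k \<omega> = (\<Sum>i<N. a i * sq_inc (grid N) k i \<omega>)" for \<omega>
    unfolding qv_error_def a_def by (intro sum.cong) (auto simp: sq_inc_def grid_diff[OF N] simp del: of_nat_Suc)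
  note qv = quadratic_variation[where t="grid N" and n=N and k=k, OF _ grid_less[OF N] a1 grid_diff[OF N]]
  show "integrable M (\<lambda>\<omega>. (qv_error N k \<omega>)\<^sup>2)" using qv by (simp add: eq)
  have "(LINT \<omega>|M. (qv_error N k \<omega>)\<^sup>2) \<le> N * (2 * (T / N * (hnorm L (Q (ek k)))\<^sup>2)\<^sup>2)"
    using qv by (simp add: eq)
  also have "\<dots> = 2 * T\<^sup>2 * (hnorm L (Q (ek k))) ^ 4 / N"
    using N by (simp add: power2_eq_square power4_eq_xxxx)
  finally show "(LINT \<omega>|M. (qv_error N k \<omega>)\<^sup>2) \<le> 2 * T\<^sup>2 * (hnorm L (Q (ek k))) ^ 4 / N" .
qed

text \<open>Mean squares of order 1 / N give almost sure convergence along a subsequence. Adding the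
  squared errors of the finitely many modes yields one subsequence for all of them. Grids are
  indexed by \<open>Suc m\<close> because the estimates need at least one step.\<close>

lemma qv_error_AE_subseq:
  obtains r where "strict_mono r" "AE \<omega> in M. \<forall>k\<in>trunc n. (\<lambda>m. qv_error (Suc (r m)) k \<omega>) \<longlonglongrightarrow> 0"
proof -
  define Z where "Z m \<omega> = (\<Sum>k\<in>trunc n. (qv_error (Suc m) k \<omega>)\<^sup>2)" for m \<omega>
  define C where "C = (\<Sum>k\<in>trunc n. 2 * T\<^sup>2 * (hnorm L (Q (ek k))) ^ 4)"
  have Zi: "integrable M (Z m)" for m
    unfolding Z_def by (intro Bochner_Integration.integrable_sum qv_error_props) simp
  have "(\<lambda>m. LINT \<omega>|M. norm (Z m \<omega>)) \<longlonglongrightarrow> 0"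
  proof (rule tendsto_sandwich[OF _ _ tendsto_const])
    show "\<forall>\<^sub>F m in sequentially. 0 \<le> (LINT \<omega>|M. norm (Z m \<omega>))" by simp
    have "(LINT \<omega>|M. norm (Z m \<omega>)) \<le> C / real (Suc m)" for m
    proof -
      have "(LINT \<omega>|M. norm (Z m \<omega>)) = (\<Sum>k\<in>trunc n. LINT \<omega>|M. (qv_error (Suc m) k \<omega>)\<^sup>2)"
        unfolding Z_def by (subst Bochner_Integration.integral_sum[symmetric]) (auto simp: sum_nonneg qv_error_props)
      also have "\<dots> \<le> (\<Sum>k\<in>trunc n. 2 * T\<^sup>2 * (hnorm L (Q (ek k))) ^ 4 / real (Suc m))"
        by (intro sum_mono qv_error_props) simp
      finally show ?thesis by (simp add: C_def sum_divide_distrib)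
    qed
    then show "\<forall>\<^sub>F m in sequentially. (LINT \<omega>|M. norm (Z m \<omega>)) \<le> C / real (Suc m)" by simp
    show "(\<lambda>m. C / real (Suc m)) \<longlonglongrightarrow> 0" by (rule LIMSEQ_Suc[OF lim_const_over_n])
  qed
  from tendsto_L1_AE_subseq[OF Zi this]
  obtain r where r: "strict_mono r" "AE \<omega> in M. (\<lambda>m. Z (r m) \<omega>) \<longlonglongrightarrow> 0" by blast
  from r(2) have "AE \<omega> in M. \<forall>k\<in>trunc n. (\<lambda>m. qv_error (Suc (r m)) k \<omega>) \<longlonglongrightarrow> 0"
  proof eventually_elim
    case (elim \<omega>)
    show ?case
    proof
      fix k assume k: "k \<in> trunc n"
      have "(\<lambda>m. (qv_error (Suc (r m)) k \<omega>)\<^sup>2) \<longlonglongrightarrow> 0"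
      proof (rule Lim_null_comparison[OF _ elim])
        show "\<forall>\<^sub>F m in sequentially. norm ((qv_error (Suc (r m)) k \<omega>)\<^sup>2) \<le> Z (r m) \<omega>"
          unfolding Z_def using member_le_sum[OF k, of "\<lambda>k. (qv_error (Suc (r _)) k \<omega>)\<^sup>2"]
          by (intro always_eventually allI) simp
      qed
      then have "(\<lambda>m. sqrt ((qv_error (Suc (r m)) k \<omega>)\<^sup>2)) \<longlonglongrightarrow> sqrt 0" by (rule tendsto_real_sqrt)
      then show "(\<lambda>m. qv_error (Suc (r m)) k \<omega>) \<longlonglongrightarrow> 0" by (simp add: tendsto_rabs_zero_iff)
    qed
  qed
  with r(1) show ?thesis by (rule that)
qed

text \<open>The decayed initial energy plus the energy fed in by the noise; the latter is \<epsilon>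
  times the trace times the integral of the weight, bounded by \<open>1 / mu1\<close>.\<close>

definition offset :: real where
  "offset = exp (- mu1 * T) * (hnorm L x)\<^sup>2 + \<epsilon> * tr / mu1"

text \<open>\<open>V\<close> is the lower limit of the discrete supermartingales, so Fatou's lemma
  gives its integral. It is kept as a measurable majorant because measurability in \<omega> of the
  time integral of \<open>transfer\<close> is not established, and a second passage to the limit
  follows.\<close>

lemma expo_liminf:
  obtains V where "V \<in> borel_measurable M" "(\<integral>\<^sup>+\<omega>. V \<omega> \<partial>M) \<le> 1"
    "AE \<omega> in M. ennreal (exp (rate / \<epsilon> * ((\<Sum>k\<in>trunc n. (coef (u T \<omega>) k)\<^sup>2) - offset
        - 2 * (LINT t:{0..T}|lborel. \<bar>transfer n (u t \<omega>)\<bar>)))) \<le> V \<omega>"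
proof -
  obtain r where r: "strict_mono r" "AE \<omega> in M. \<forall>k\<in>trunc n. (\<lambda>m. qv_error (Suc (r m)) k \<omega>) \<longlonglongrightarrow> 0"
    using qv_error_AE_subseq by blast
  define V where "V \<omega> = liminf (\<lambda>m. ennreal (exp (expo n (Suc (r m)) \<omega>)))" for \<omega>
  have [measurable]: "expo n (Suc m) \<in> borel_measurable M" for m by (rule expo_supermartingale) simp
  have Vm: "V \<in> borel_measurable M" unfolding V_def by measurable
  have "(\<integral>\<^sup>+\<omega>. V \<omega> \<partial>M) \<le> liminf (\<lambda>m. \<integral>\<^sup>+\<omega>. ennreal (exp (expo n (Suc (r m)) \<omega>)) \<partial>M)"
    unfolding V_def by (rule nn_integral_liminf) measurable
  also have "\<dots> \<le> 1"
  proof (rule Liminf_le)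
    show "\<forall>\<^sub>F m in sequentially. (\<integral>\<^sup>+\<omega>. ennreal (exp (expo n (Suc (r m)) \<omega>)) \<partial>M) \<le> 1"
      by (intro always_eventually allI expo_supermartingale) simp
  qed simp
  finally have V1: "(\<integral>\<^sup>+\<omega>. V \<omega> \<partial>M) \<le> 1" .
  have ae1: "AE \<omega> in M. w 0 \<omega> = 0" and ae2: "AE \<omega> in M. continuous_map (top_of_set {0..}) (H_topology L) (\<lambda>t. w t \<omega>)"
    using wiener by (auto simp: wiener_process_def)
  have ae3: "AE \<omega> in M. continuous_map (top_of_set {0..}) (H_topology L) (\<lambda>t. u t \<omega>) \<and>
        (\<forall>t\<ge>0. \<forall>\<phi>\<in>stokes_dom L.
           hinner L (u t \<omega>) \<phi> + (LINT s:{0..t}|lborel. hinner L (u s \<omega>) (stokes L \<phi>))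
             - (LINT s:{0..t}|lborel. tri L (u s \<omega>) \<phi> (u s \<omega>))
           = hinner L x \<phi> + sqrt \<epsilon> * hinner L (w t \<omega>) \<phi>)"
    using u unfolding navier_stokes_solution_def by (auto elim!: AE_mp)
  have "AE \<omega> in M. ennreal (exp (rate / \<epsilon> * ((\<Sum>k\<in>trunc n. (coef (u T \<omega>) k)\<^sup>2) - offset
        - 2 * (LINT t:{0..T}|lborel. \<bar>transfer n (u t \<omega>)\<bar>)))) \<le> V \<omega>"
    using r(2) ae1 ae2 ae3
  proof eventually_elim
    case (elim \<omega>)
    let ?S = "\<lambda>s. \<Sum>k\<in>trunc n. (coef (u s \<omega>) k)\<^sup>2"
    let ?D = "\<lambda>N i k. coef (inc (grid N i) (grid N (Suc i)) \<omega>) k"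
    let ?v = "\<lambda>k. (hnorm L (Q (ek k)))\<^sup>2"
    obtain l1 l2 where l1: "(\<lambda>N. \<Sum>k\<in>trunc n. \<Sum>i<N. wt (grid N i) *
        (2 * coef (u (grid N i) \<omega>) k * (sqrt \<epsilon> * ?D N i k) + (sqrt \<epsilon> * ?D N i k)\<^sup>2)) \<longlonglongrightarrow> l1"
      and l2: "(\<lambda>N. \<Sum>i<N. T / N * ((wt (grid N i))\<^sup>2 * ?S (grid N i))) \<longlonglongrightarrow> l2"
      and le: "?S T - exp (- mu1 * T) * (hnorm L x)\<^sup>2 - 2 * (LINT t:{0..T}|lborel. \<bar>transfer n (u t \<omega>)\<bar>) \<le> l1 - mu1 * l2"
      using elim unfolding inc_def wt_def
      by (elim conjE pathwise_energy[OF T x, of "\<lambda>t. u t \<omega>" "\<lambda>t. w t \<omega>" \<epsilon> n]) auto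
    \<comment> \<open>Weight against which the trace is integrated; that it stays below
      \<open>1 / mu1\<close> for all T makes the estimate uniform in time.\<close>
    define l3 where "l3 = integral {0..T} wt"
    have l3: "(\<lambda>N. \<Sum>i<N. T / N * wt (grid N i)) \<longlonglongrightarrow> l3"
      unfolding l3_def wt_def by (intro riemann_sum_tendsto T continuous_intros)
    have l3_le: "l3 \<le> 1 / mu1"
    proof -
      have "(wt has_integral (wt T / mu1 - wt 0 / mu1)) {0..T}"
        using T mu1_pos unfolding wt_def
        by (intro fundamental_theorem_of_calculus)
           (auto intro!: derivative_eq_intros simp: has_real_derivative_iff_has_vector_derivative[symmetric])
      then have "l3 = wt T / mu1 - wt 0 / mu1" unfolding l3_def by (rule integral_unique)
      moreover have "0 \<le> wt 0 / mu1" using mu1_pos by (simp add: wt_def)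
      ultimately show ?thesis by (simp add: wt_def)
    qed
    let ?Tr = "\<Sum>k\<in>trunc n. ?v k"
    \<comment> \<open>Adding and subtracting the squared increments brings in the sums of
      \<open>pathwise_energy\<close>. The added squares are then split into their mean, which is a
      Riemann sum times the trace, and \<open>qv_error\<close>. The definition of
      \<open>rate\<close> turns the compensator into \<open>mu1\<close> times the sums converging to
      \<open>l2\<close>.\<close>
    have expo_eq: "expo n N \<omega> = rate / \<epsilon> * ((\<Sum>k\<in>trunc n. \<Sum>i<N. wt (grid N i) *
        (2 * coef (u (grid N i) \<omega>) k * (sqrt \<epsilon> * ?D N i k) + (sqrt \<epsilon> * ?D N i k)\<^sup>2))
        - \<epsilon> * (\<Sum>k\<in>trunc n. qv_error N k \<omega>) - \<epsilon> * (?Tr * (\<Sum>i<N. T / N * wt (grid N i)))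
        - mu1 * (\<Sum>i<N. T / N * ((wt (grid N i))\<^sup>2 * ?S (grid N i))))" if N: "N > 0" for N
    proof -
      have 1: "(\<Sum>k\<in>trunc n. \<Sum>i<N. wt (grid N i) * (2 * coef (u (grid N i) \<omega>) k * (sqrt \<epsilon> * ?D N i k) + (sqrt \<epsilon> * ?D N i k)\<^sup>2))
          - \<epsilon> * (\<Sum>k\<in>trunc n. qv_error N k \<omega>) - \<epsilon> * (?Tr * (\<Sum>i<N. T / N * wt (grid N i))) =
          (\<Sum>k\<in>trunc n. \<Sum>i<N. 2 * sqrt \<epsilon> * wt (grid N i) * coef (u (grid N i) \<omega>) k * ?D N i k)"
      proof -
        have "(sqrt \<epsilon> * d)\<^sup>2 = \<epsilon> * d\<^sup>2" for d using \<epsilon> by (simp add: power_mult_distrib)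
        then show ?thesis
          unfolding qv_error_def sum_product unfolding sum_distrib_left sum_subtractf[symmetric]
          by (intro sum.cong refl) (simp add: algebra_simps)
      qed
      have 2: "(\<Sum>i<N. T / N / 2 * q\<^sup>2 * (\<Sum>k\<in>trunc n. (rate / \<epsilon> * (2 * sqrt \<epsilon> * wt (grid N i) * coef (u (grid N i) \<omega>) k))\<^sup>2)) =
          rate / \<epsilon> * (mu1 * (\<Sum>i<N. T / N * ((wt (grid N i))\<^sup>2 * ?S (grid N i))))"
      proof -
        have "(rate / \<epsilon> * (2 * sqrt \<epsilon> * y * z))\<^sup>2 = 4 * rate\<^sup>2 / \<epsilon> * y\<^sup>2 * z\<^sup>2" for y z
          using \<epsilon> by (simp add: power_mult_distrib power_divide power2_eq_square[of \<epsilon>])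
        moreover have "T / N / 2 * q\<^sup>2 * (4 * rate\<^sup>2 / \<epsilon>) = rate / \<epsilon> * (mu1 * (T / N))"
          using q_pos by (simp add: rate_def power2_eq_square mult_ac)
        ultimately have "T / N / 2 * q\<^sup>2 * (rate / \<epsilon> * (2 * sqrt \<epsilon> * y * z))\<^sup>2 = rate / \<epsilon> * (mu1 * (T / N * (y\<^sup>2 * z\<^sup>2)))" for y z
          by (metis (no_types, opaque_lifting) mult.assoc)
        then show ?thesis
          unfolding sum_distrib_left by (intro sum.cong refl)
      qed
      have "expo n N \<omega> = (\<Sum>i<N. \<Sum>k\<in>trunc n. rate / \<epsilon> * (2 * sqrt \<epsilon> * wt (grid N i) * coef (u (grid N i) \<omega>) k * ?D N i k))
         - (\<Sum>i<N. T / N / 2 * q\<^sup>2 * (\<Sum>k\<in>trunc n. (rate / \<epsilon> * (2 * sqrt \<epsilon> * wt (grid N i) * coef (u (grid N i) \<omega>) k))\<^sup>2))"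
        unfolding expo_def grid_diff[OF N] sum_subtractf by (simp only: mult.assoc)
      also have "(\<Sum>i<N. \<Sum>k\<in>trunc n. rate / \<epsilon> * (2 * sqrt \<epsilon> * wt (grid N i) * coef (u (grid N i) \<omega>) k * ?D N i k)) =
          rate / \<epsilon> * (\<Sum>k\<in>trunc n. \<Sum>i<N. 2 * sqrt \<epsilon> * wt (grid N i) * coef (u (grid N i) \<omega>) k * ?D N i k)"
        unfolding sum_distrib_left by (rule sum.swap)
      finally show ?thesis unfolding 2 1 by (simp only: right_diff_distrib)
    qed
    have sub: "filterlim (\<lambda>m. Suc (r m)) sequentially sequentially"
      using r(1) by (intro filterlim_compose[OF filterlim_Suc filterlim_subseq])
    have "(\<lambda>m. expo n (Suc (r m)) \<omega>) \<longlonglongrightarrow> rate / \<epsilon> * (l1 - \<epsilon> * (\<Sum>k\<in>trunc n. 0) - \<epsilon> * (?Tr * l3) - mu1 * l2)"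
      unfolding expo_eq[OF zero_less_Suc]
      by (intro tendsto_intros filterlim_compose[OF l1 sub] filterlim_compose[OF l2 sub] filterlim_compose[OF l3 sub])
         (use elim in auto)
    then have "(\<lambda>m. ennreal (exp (expo n (Suc (r m)) \<omega>))) \<longlonglongrightarrow> ennreal (exp (rate / \<epsilon> * (l1 - \<epsilon> * (?Tr * l3) - mu1 * l2)))"
      by (intro tendsto_ennrealI tendsto_exp) simp
    then have Vl: "V \<omega> = ennreal (exp (rate / \<epsilon> * (l1 - \<epsilon> * (?Tr * l3) - mu1 * l2)))"
      unfolding V_def by (intro lim_imp_Liminf) auto
    have "?Tr * l3 \<le> tr * (1 / mu1)"
    proof -
      have "?Tr * l3 \<le> ?Tr * (1 / mu1)" using l3_le by (intro mult_left_mono) (auto simp: sum_nonneg)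
      also have "\<dots> \<le> tr * (1 / mu1)" using tr[of n] mu1_pos by (intro mult_right_mono) auto
      finally show ?thesis .
    qed
    from mult_left_mono[OF this, of \<epsilon>] have "\<epsilon> * (?Tr * l3) \<le> \<epsilon> * tr / mu1" using \<epsilon> by simp
    then have "?S T - offset - 2 * (LINT t:{0..T}|lborel. \<bar>transfer n (u t \<omega>)\<bar>) \<le> l1 - \<epsilon> * (?Tr * l3) - mu1 * l2"
      using le unfolding offset_def by linarith
    then have "rate / \<epsilon> * (?S T - offset - 2 * (LINT t:{0..T}|lborel. \<bar>transfer n (u t \<omega>)\<bar>)) \<le> rate / \<epsilon> * (l1 - \<epsilon> * (?Tr * l3) - mu1 * l2)"
      using rate_pos \<epsilon> by (intro mult_left_mono) auto
    then show ?case unfolding Vl by (intro ennreal_leI) simp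
  qed
  with Vm V1 show ?thesis by (rule that)
qed

text \<open>For almost every \<omega>, as the truncation grows, the modal energy tends to the full
  energy by Parseval and the transfer integral tends to 0. Fatou's lemma is applied to the
  majorants, which are measurable.\<close>

lemma exponential_moment:
  "(\<integral>\<^sup>+\<omega>. ennreal (exp (rate / \<epsilon> * ((hnorm L (u T \<omega>))\<^sup>2
      - (exp (- mu1 * T) * (hnorm L x)\<^sup>2 + \<epsilon> * tr / mu1)))) \<partial>M) \<le> 1"
proof -
  let ?X = "\<lambda>n \<omega>. exp (rate / \<epsilon> * ((\<Sum>k\<in>trunc n. (coef (u T \<omega>) k)\<^sup>2) - offset
        - 2 * (LINT t:{0..T}|lborel. \<bar>transfer n (u t \<omega>)\<bar>)))"
  define ok where "ok n V \<longleftrightarrow> V \<in> borel_measurable M \<and> (\<integral>\<^sup>+\<omega>. V \<omega> \<partial>M) \<le> 1 \<and>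
      (AE \<omega> in M. ennreal (?X n \<omega>) \<le> V \<omega>)" for n V
  have "\<exists>V. ok n V" for n
    unfolding ok_def using expo_liminf[of n] by blast
  then obtain V where "\<And>n. ok n (V n)" by metis
  then have V: "\<And>n. V n \<in> borel_measurable M" "\<And>n. (\<integral>\<^sup>+\<omega>. V n \<omega> \<partial>M) \<le> 1"
    "\<And>n. AE \<omega> in M. ennreal (?X n \<omega>) \<le> V n \<omega>" by (auto simp: ok_def)
  have sol: "AE \<omega> in M. continuous_map (top_of_set {0..}) (H_topology L) (\<lambda>t. u t \<omega>) \<and>
     (AE t in lborel. t \<in> {0..T} \<longrightarrow> u t \<omega> \<in> Defs.V L) \<and> set_integrable lborel {0..T} (\<lambda>t. (vnorm (u t \<omega>))\<^sup>2)"
    using u T unfolding navier_stokes_solution_def vnorm_def by (auto elim!: AE_mp)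
  have "AE \<omega> in M. \<forall>n. ennreal (?X n \<omega>) \<le> V n \<omega>" using V(3) by (simp add: AE_all_countable)
  with sol have "AE \<omega> in M. ennreal (exp (rate / \<epsilon> * ((hnorm L (u T \<omega>))\<^sup>2 - offset))) \<le> liminf (\<lambda>n. V n \<omega>)"
  proof eventually_elim
    case (elim \<omega>)
    then have c: "continuous_map (top_of_set {0..}) (H_topology L) (\<lambda>t. u t \<omega>)" by blast
    have uT: "u T \<omega> \<in> H L" using continuous_path_tendsto(1)[OF L_pos c, of T] T by simp
    have "(\<lambda>n. ?X n \<omega>) \<longlonglongrightarrow> exp (rate / \<epsilon> * ((hnorm L (u T \<omega>))\<^sup>2 - offset - 2 * 0))"
      using elim by (intro tendsto_intros parseval uT transfer_tendsto_0) auto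
    then have "(\<lambda>n. ennreal (?X n \<omega>)) \<longlonglongrightarrow> ennreal (exp (rate / \<epsilon> * ((hnorm L (u T \<omega>))\<^sup>2 - offset)))"
      by (intro tendsto_ennrealI) simp
    then have "ennreal (exp (rate / \<epsilon> * ((hnorm L (u T \<omega>))\<^sup>2 - offset))) = liminf (\<lambda>n. ennreal (?X n \<omega>))"
      by (intro lim_imp_Liminf[symmetric]) auto
    also have "\<dots> \<le> liminf (\<lambda>n. V n \<omega>)" using elim by (intro Liminf_mono) auto
    finally show ?case .
  qed
  then have "(\<integral>\<^sup>+\<omega>. ennreal (exp (rate / \<epsilon> * ((hnorm L (u T \<omega>))\<^sup>2 - offset))) \<partial>M) \<le> (\<integral>\<^sup>+\<omega>. liminf (\<lambda>n. V n \<omega>) \<partial>M)"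
    by (rule nn_integral_mono_AE)
  also have "\<dots> \<le> liminf (\<lambda>n. \<integral>\<^sup>+\<omega>. V n \<omega> \<partial>M)"
    by (rule nn_integral_liminf) (rule V(1))
  also have "\<dots> \<le> 1" by (rule Liminf_le) (auto simp: V(2))
  finally show ?thesis by (simp only: offset_def)
qed

end

end

section \<open>The trace of the covariance\<close>

context torus begin

lemma sum_powr_int_bounded:
  fixes \<alpha> :: real
  assumes "\<alpha> > 1"
  shows "\<exists>C. \<forall>n. (\<Sum>a\<in>{- int n..int n}. (1 + \<bar>real_of_int a\<bar>) powr (- \<alpha>)) \<le> C"
proof -
  define F :: "int \<Rightarrow> real" where "F a = (1 + \<bar>real_of_int a\<bar>) powr (- \<alpha>)" for a
  have "summable (\<lambda>m. real m powr (- \<alpha>))" using assms by (simp add: summable_real_powr_iff)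
  then have "summable (\<lambda>m. real (Suc m) powr (- \<alpha>))" by (subst summable_Suc_iff)
  then have sm: "summable (\<lambda>m. F (int m))" by (simp add: F_def)
  have "(\<Sum>a\<in>{- int n..int n}. F a) \<le> 2 * (\<Sum>m. F (int m))" for n
  proof -
    let ?A = "int ` {..n}" and ?B = "(\<lambda>m. - int m) ` {..n}"
    have sub: "{- int n..int n} \<subseteq> ?A \<union> ?B"
    proof
      fix a assume "a \<in> {- int n..int n}"
      then have "a = int (nat a) \<and> nat a \<le> n \<or> a = - int (nat (- a)) \<and> nat (- a) \<le> n" by auto
      then show "a \<in> ?A \<union> ?B" by blast
    qed
    have "(\<Sum>a\<in>{- int n..int n}. F a) \<le> sum F (?A \<union> ?B)"
      using sub by (intro sum_mono2) (auto simp: F_def)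
    also have "\<dots> = sum F ?A + sum F ?B - sum F (?A \<inter> ?B)" by (intro sum_Un) auto
    also have "\<dots> \<le> sum F ?A + sum F ?B" by (simp add: F_def sum_nonneg)
    also have "\<dots> = 2 * (\<Sum>m\<le>n. F (int m))"
      by (subst (1 2) sum.reindex) (auto simp: inj_on_def F_def)
    also have "(\<Sum>m\<le>n. F (int m)) \<le> (\<Sum>m. F (int m))"
      using sm by (intro sum_le_suminf) (auto simp: F_def)
    finally show ?thesis by simp
  qed
  then show ?thesis unfolding F_def by blast
qed

text \<open>For integers not both 0, (1 + |a|) (1 + |b|) \<le> 4 (a^2 + b^2). Hence the summand is
  dominated by a product, and the double sum by the square of a one-dimensional series that
  converges for \<alpha> > 1.\<close>

lemma sum_mu_powr_bounded:
  assumes \<alpha>: "\<alpha> > 1"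
  shows "\<exists>C. \<forall>n. (\<Sum>k\<in>trunc n. mu k powr (- \<alpha>)) \<le> C"
proof -
  define F :: "int \<Rightarrow> real" where "F a = (1 + \<bar>real_of_int a\<bar>) powr (- \<alpha>)" for a
  obtain C where C: "\<And>n. (\<Sum>a\<in>{- int n..int n}. F a) \<le> C"
    using sum_powr_int_bounded[OF \<alpha>] unfolding F_def by blast
  define D where "D = (mu1 / 4) powr (- \<alpha>)"
  have D: "0 \<le> D" by (simp add: D_def)
  have F0: "0 \<le> F a" for a by (simp add: F_def)
  have le: "mu (a, b) powr (- \<alpha>) \<le> D * (F a * F b)" if "(a, b) \<noteq> 0" for a b
  proof -
    define A B where "A = \<bar>a\<bar>" and "B = \<bar>b\<bar>"
    have AB: "0 \<le> A" "0 \<le> B" by (auto simp: A_def B_def)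
    have sq: "c \<le> c * c" if "0 \<le> c" for c :: int
      using that mult_right_mono[of 1 c c] by (cases "c = 0") auto
    have "1 \<le> A * A + B * B"
    proof -
      have "A \<noteq> 0 \<or> B \<noteq> 0" using that by (auto simp: A_def B_def zero_prod_def)
      then have "1 \<le> A + B" using AB by linarith
      then show ?thesis using sq[of A] sq[of B] AB by linarith
    qed
    moreover have "2 * (A * B) \<le> A * A + B * B"
      using zero_le_power2[of "A - B"] by (simp add: power2_eq_square algebra_simps)
    ultimately have "(1 + A) * (1 + B) \<le> 4 * (A * A + B * B)"
      using sq[of A] sq[of B] AB mult_nonneg_nonneg[OF AB] by (simp add: algebra_simps)
    also have "A * A + B * B = a\<^sup>2 + b\<^sup>2" by (simp add: A_def B_def power2_eq_square)
    finally have "real_of_int ((1 + A) * (1 + B)) \<le> real_of_int (4 * (a\<^sup>2 + b\<^sup>2))" by (simp only: of_int_le_iff)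
    then have r: "(1 + \<bar>real_of_int a\<bar>) * (1 + \<bar>real_of_int b\<bar>) \<le> 4 * ((real_of_int a)\<^sup>2 + (real_of_int b)\<^sup>2)"
      by (simp add: A_def B_def)
    have "mu1 / 4 * ((1 + \<bar>real_of_int a\<bar>) * (1 + \<bar>real_of_int b\<bar>)) \<le> mu1 / 4 * (4 * ((real_of_int a)\<^sup>2 + (real_of_int b)\<^sup>2))"
      using r mu1_pos by (intro mult_left_mono) auto
    also have "\<dots> = mu (a, b)" by (simp add: mu_altdef mu1_def)
    finally have "mu (a, b) powr (- \<alpha>) \<le> (mu1 / 4 * ((1 + \<bar>real_of_int a\<bar>) * (1 + \<bar>real_of_int b\<bar>))) powr (- \<alpha>)"
      using mu1_pos \<alpha> by (intro powr_mono2') (auto intro!: mult_pos_pos add_pos_nonneg)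
    also have "\<dots> = D * (F a * F b)"
      by (simp only: D_def F_def powr_mult)
    finally show ?thesis .
  qed
  have "(\<Sum>k\<in>trunc n. mu k powr (- \<alpha>)) \<le> D * (C * C)" for n
  proof -
    have "(\<Sum>k\<in>trunc n. mu k powr (- \<alpha>)) \<le> (\<Sum>k\<in>trunc n. D * (F (fst k) * F (snd k)))"
    proof (rule sum_mono)
      fix k assume "k \<in> trunc n"
      then have "(fst k, snd k) \<noteq> 0" by (auto simp: trunc_def)
      from le[OF this] show "mu k powr (- \<alpha>) \<le> D * (F (fst k) * F (snd k))" by simp
    qed
    also have "\<dots> \<le> (\<Sum>k\<in>{- int n..int n} \<times> {- int n..int n}. D * (F (fst k) * F (snd k)))"
      by (intro sum_mono2) (auto simp: trunc_def D F0)
    also have "\<dots> = D * ((\<Sum>a\<in>{- int n..int n}. F a) * (\<Sum>a\<in>{- int n..int n}. F a))"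
      unfolding sum_product sum.cartesian_product by (simp add: sum_distrib_left split_beta)
    also have "\<dots> \<le> D * (C * C)"
    proof -
      have "0 \<le> C" by (rule order_trans[OF _ C[of 0]]) (simp add: F0)
      then show ?thesis using C[of n] F0 by (intro mult_left_mono mult_mono D) (auto simp: sum_nonneg)
    qed
    finally show ?thesis .
  qed
  then show ?thesis by blast
qed

text \<open>
  By self-adjointness, \<open>|Q e\<^sub>k|\<^sup>2 = \<langle>e\<^sub>k, Q (Q e\<^sub>k)\<rangle>\<close>, and the coefficients of \<open>Q y\<close> decay like \<open>\<mu>\<^sub>k\<close> to the
  power \<open>- \<alpha> / 2\<close> because \<open>Q\<close> maps into the domain of \<open>A\<close> to the power \<open>\<alpha> / 2\<close>.
\<close>

lemma covariance_trace_bounded: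
  assumes \<alpha>: "\<alpha> > 1" and sa: "positive_selfadjoint L Q" and iso: "isomorphism_onto_pow_dom L (\<alpha> / 2) Q"
  shows "\<exists>tr. \<forall>n. (\<Sum>k\<in>trunc n. (hnorm L (Q (ek k)))\<^sup>2) \<le> tr"
proof -
  have QH: "Q x \<in> H L" if "x \<in> H L" for x
    using sa that by (auto simp: positive_selfadjoint_def bounded_in_H_def linear_in_H_def)
  have Qdom: "Q x \<in> stokes_pow_dom L (\<alpha> / 2)" if "x \<in> H L" for x
    using iso that by (auto simp: isomorphism_onto_pow_dom_def bij_betw_def)
  obtain c where c: "c > 0" "\<And>x. x \<in> H L \<Longrightarrow> hnorm L (stokes_pow L (\<alpha> / 2) (Q x)) \<le> c * hnorm L x"
    using iso unfolding isomorphism_onto_pow_dom_def by blast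
  have le: "(hnorm L (Q (ek k)))\<^sup>2 \<le> c\<^sup>2 * mu k powr (- \<alpha>)" if k: "k \<noteq> 0" for k
  proof -
    let ?y = "Q (ek k)" and ?p = "mu k powr (\<alpha> / 2)"
    have y: "?y \<in> H L" by (rule QH[OF ek_H])
    have p: "?p > 0" using mu_pos[OF k] by simp
    have "hnorm L (ek k) = 1" using k by (simp add: hnorm_def hinner_ek_ek)
    have "(hnorm L ?y)\<^sup>2 = hinner L (ek k) (Q ?y)"
      using sa y ek_H by (simp add: positive_selfadjoint_def hnorm_square)
    then have "?p * (hnorm L ?y)\<^sup>2 = coef (stokes_pow L (\<alpha> / 2) (Q ?y)) k"
      by (simp add: stokes_pow_props(2)[OF Qdom[OF y] k]) (simp add: coef_def hinner_commute[of L "ek k"])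
    also have "\<dots> \<le> hnorm L (stokes_pow L (\<alpha> / 2) (Q ?y)) * hnorm L (ek k)"
      unfolding coef_def
      by (rule order_trans[OF abs_ge_self abs_hinner_le]) (auto intro: H_subset_L2 stokes_pow_props(1) Qdom y ek_L2)
    also have "\<dots> \<le> c * hnorm L ?y" using c(2)[OF y] \<open>hnorm L (ek k) = 1\<close> by simp
    \<comment> \<open>The same norm occurs squared on the left and linearly on the right, so one
      factor cancels unless it is 0.\<close>
    finally have "?p * hnorm L ?y \<le> c"
      by (cases "hnorm L ?y = 0") (use c(1) in \<open>auto simp: power2_eq_square mult.assoc[symmetric] less_le\<close>)
    then have "hnorm L ?y \<le> c * mu k powr (- (\<alpha> / 2))"
      using p by (simp add: powr_minus field_simps)
    then have "(hnorm L ?y)\<^sup>2 \<le> (c * mu k powr (- (\<alpha> / 2)))\<^sup>2" by (intro power_mono) auto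
    also have "\<dots> = c\<^sup>2 * mu k powr (- \<alpha>)"
      by (simp add: power_mult_distrib power2_eq_square[of "mu k powr _"] powr_add[symmetric])
    finally show ?thesis .
  qed
  obtain C where C: "\<And>n. (\<Sum>k\<in>trunc n. mu k powr (- \<alpha>)) \<le> C" using sum_mu_powr_bounded[OF \<alpha>] by blast
  have "(\<Sum>k\<in>trunc n. (hnorm L (Q (ek k)))\<^sup>2) \<le> c\<^sup>2 * C" for n
  proof -
    have "(\<Sum>k\<in>trunc n. (hnorm L (Q (ek k)))\<^sup>2) \<le> (\<Sum>k\<in>trunc n. c\<^sup>2 * mu k powr (- \<alpha>))"
      by (intro sum_mono le) (auto simp: trunc_def)
    also have "\<dots> \<le> c\<^sup>2 * C" using C[of n] by (simp add: sum_distrib_left[symmetric] mult_left_mono)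
    finally show ?thesis .
  qed
  then show ?thesis by blast
qed

end

section \<open>The invariant measure\<close>

text \<open>The first part of the squared radius produces the exponent - s / \<epsilon>, the second
  compensates the noise energy. The indicator of the tail lies below a bounded continuous function,
  whose integral is computed at a late time by invariance.\<close>

lemma invariant_measure_tail:
  fixes u :: "vfield \<Rightarrow> real \<Rightarrow> 'a \<Rightarrow> vfield" and \<epsilon> tr s R :: real
  assumes wi: "wiener L M F w Q q" and \<epsilon>: "0 < \<epsilon>" "\<epsilon> \<le> 1"
    and tr: "\<And>n. (\<Sum>k\<in>torus.trunc n. (hnorm L (Q (torus.ek L k)))\<^sup>2) \<le> tr"
    and u: "\<And>x. x \<in> H L \<Longrightarrow> navier_stokes_solution L M F w \<epsilon> x (u x)"
    and inv: "invariant_measure L M u \<nu>"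
    and R: "R\<^sup>2 = s / wiener.rate L q + tr / torus.mu1 L" "R > 0"
  shows "measure \<nu> {x \<in> H L. hnorm L x \<ge> R} \<le> exp (- s / \<epsilon>)"
proof -
  interpret wiener L M F w Q q by (rule wi)
  interpret N: prob_space \<nu> using inv by (simp add: invariant_measure_def)
  have sets: "sets \<nu> = sets (borelH L)" using inv by (simp add: invariant_measure_def)
  have space: "space \<nu> = H L" using sets_eq_imp_space_eq[OF sets] space_borelH[OF L_pos] by simp
  have tr0: "0 \<le> tr" by (rule order_trans[OF _ tr[of 0]]) (simp add: sum_nonneg)
  \<comment> \<open>Invariance is available for bounded continuous functions only, hence the minimum
    with 1; it also makes dominated convergence possible without any moment of the measure.\<close>
  define \<phi> where "\<phi> v = min 1 (exp (rate / \<epsilon> * ((hnorm L v)\<^sup>2 - R\<^sup>2)))" for v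
  have hn: "continuous_map (H_topology L) euclideanreal (hnorm L)" by (rule continuous_map_hnorm[OF L_pos])
  have "continuous_map euclideanreal euclideanreal (\<lambda>r. min 1 (exp (rate / \<epsilon> * (r\<^sup>2 - R\<^sup>2))))"
    using \<epsilon> by (simp, intro continuous_intros) simp
  from continuous_map_compose[OF hn this] have \<phi>c: "continuous_map (H_topology L) euclideanreal \<phi>"
    by (simp add: \<phi>_def[abs_def] o_def)
  have \<phi>01: "0 \<le> \<phi> v" "\<phi> v \<le> 1" for v by (auto simp: \<phi>_def)
  have borelH_\<nu>: "f \<in> borel_measurable \<nu>" if "f \<in> borel_measurable (borelH L)" for f :: "vfield \<Rightarrow> real"
    using that measurable_cong_sets[OF sets refl] by blast
  have \<phi>m: "\<phi> \<in> borel_measurable (borelH L)" by (rule borelH_measurable_continuous[OF L_pos \<phi>c])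
  note [measurable] = borelH_\<nu>[OF \<phi>m] borelH_\<nu>[OF borelH_measurable_continuous[OF L_pos hn]]
  have inv_eq: "(LINT x|\<nu>. LINT \<omega>|M. \<phi> (u x t \<omega>)) = (LINT x|\<nu>. \<phi> x)" if "t \<ge> 0" for t
    using inv \<phi>c \<phi>01 that unfolding invariant_measure_def bounded_iff by (metis abs_of_nonneg imageE real_norm_def)
  \<comment> \<open>The bound from \<open>exponential_moment\<close>, cut off at 1. Its limit for
    large times does not depend on \<open>x\<close>.\<close>
  define h where "h t x = min 1 (exp (rate / \<epsilon> * (exp (- mu1 * t) * (hnorm L x)\<^sup>2 + \<epsilon> * tr / mu1 - R\<^sup>2)))" for t x
  have h01: "0 \<le> h t x" "h t x \<le> 1" for t x by (auto simp: h_def)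
  have [measurable]: "h t \<in> borel_measurable \<nu>" for t unfolding h_def by measurable
  define g where "g t x = (LINT \<omega>|M. \<phi> (u x t \<omega>))" for t x
  have g_le: "g t x \<le> h t x" if x: "x \<in> H L" and t: "t > 0" for t x
  proof -
    let ?o = "exp (- mu1 * t) * (hnorm L x)\<^sup>2 + \<epsilon> * tr / mu1"
    have ut: "u x t \<in> measurable M (borelH L)"
      using u[OF x] t by (intro F_measurable_M[of _ t]) (simp add: navier_stokes_solution_def)
    have um: "(\<lambda>\<omega>. \<phi> (u x t \<omega>)) \<in> borel_measurable M" by (rule measurable_compose[OF ut \<phi>m])
    have hm: "(\<lambda>\<omega>. hnorm L (u x t \<omega>)) \<in> borel_measurable M"
      by (rule measurable_compose[OF ut borelH_measurable_continuous[OF L_pos hn]])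
    have i: "integrable M (\<lambda>\<omega>. \<phi> (u x t \<omega>))"
      by (rule integrable_const_bound[where B=1, OF _ um]) (simp add: \<phi>01)
    have "ennreal (g t x) = (\<integral>\<^sup>+\<omega>. ennreal (\<phi> (u x t \<omega>)) \<partial>M)"
      unfolding g_def by (rule nn_integral_eq_integral[OF i, symmetric]) (simp add: \<phi>01)
    also have "\<dots> \<le> (\<integral>\<^sup>+\<omega>. ennreal (exp (rate / \<epsilon> * (?o - R\<^sup>2))) * ennreal (exp (rate / \<epsilon> * ((hnorm L (u x t \<omega>))\<^sup>2 - ?o))) \<partial>M)"
    proof (rule nn_integral_mono)
      fix \<omega>
      let ?h = "(hnorm L (u x t \<omega>))\<^sup>2"
      have "rate / \<epsilon> * (?h - R\<^sup>2) = rate / \<epsilon> * (?o - R\<^sup>2) + rate / \<epsilon> * (?h - ?o)"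
        by (simp only: distrib_left[symmetric]) simp
      then have "\<phi> (u x t \<omega>) \<le> exp (rate / \<epsilon> * (?o - R\<^sup>2)) * exp (rate / \<epsilon> * (?h - ?o))"
        by (simp only: \<phi>_def exp_add[symmetric] min.cobounded2)
      then show "ennreal (\<phi> (u x t \<omega>)) \<le> ennreal (exp (rate / \<epsilon> * (?o - R\<^sup>2))) * ennreal (exp (rate / \<epsilon> * (?h - ?o)))"
        by (simp only: ennreal_mult[symmetric] exp_ge_zero ennreal_leI)
    qed
    also have "\<dots> = ennreal (exp (rate / \<epsilon> * (?o - R\<^sup>2))) * (\<integral>\<^sup>+\<omega>. ennreal (exp (rate / \<epsilon> * ((hnorm L (u x t \<omega>))\<^sup>2 - ?o))) \<partial>M)"
      by (rule nn_integral_cmult) (use hm in measurable)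
    also have "\<dots> \<le> ennreal (exp (rate / \<epsilon> * (?o - R\<^sup>2))) * 1"
      by (intro mult_left_mono exponential_moment[OF \<epsilon>(1) x u[OF x] t tr]) simp
    finally have "g t x \<le> exp (rate / \<epsilon> * (?o - R\<^sup>2))" by simp
    moreover have "g t x \<le> (LINT \<omega>|M. 1)"
      unfolding g_def by (intro integral_mono i) (auto simp: \<phi>01)
    ultimately show ?thesis by (simp add: h_def prob_space)
  qed
  have g0: "0 \<le> g t x" for t x unfolding g_def by (simp add: \<phi>01)
  have le: "(LINT x|\<nu>. \<phi> x) \<le> exp (- s / \<epsilon>)"
  \<comment> \<open>The solutions are chosen separately for each initial value, so measurability of
    \<open>g\<close> in \<open>x\<close> is not guaranteed; in its absence the invariance identity
    is read with the default value of the integral.\<close>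
  proof (cases "\<forall>n. g (real (Suc n)) \<in> borel_measurable \<nu>")
    case True
    have "(LINT x|\<nu>. \<phi> x) \<le> (LINT x|\<nu>. h (real (Suc n)) x)" for n
    proof -
      have "(LINT x|\<nu>. \<phi> x) = (LINT x|\<nu>. g (real (Suc n)) x)" using inv_eq[of "real (Suc n)"] by (simp add: g_def)
      also have "\<dots> \<le> (LINT x|\<nu>. h (real (Suc n)) x)"
      proof (rule integral_mono_AE)
        have "AE x in \<nu>. norm (g (real (Suc n)) x) \<le> 1"
          using order_trans[OF g_le[of _ "real (Suc n)"] h01(2)] g0 by (intro AE_I2) (simp add: space)
        then show "integrable \<nu> (g (real (Suc n)))" using True by (intro N.integrable_const_bound[where B=1]) auto
        show "integrable \<nu> (h (real (Suc n)))" by (rule N.integrable_const_bound[where B=1]) (auto simp: h01)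
        show "AE x in \<nu>. g (real (Suc n)) x \<le> h (real (Suc n)) x" using g_le by (intro AE_I2) (simp add: space)
      qed
      finally show ?thesis .
    qed
    moreover have "(\<lambda>n. LINT x|\<nu>. h (real (Suc n)) x) \<longlonglongrightarrow> (LINT x|\<nu>. min 1 (exp (rate / \<epsilon> * (0 * (hnorm L x)\<^sup>2 + \<epsilon> * tr / mu1 - R\<^sup>2))))"
    proof (rule integral_dominated_convergence[where w="\<lambda>_. 1"])
      have "filterlim (\<lambda>n. mu1 * real (Suc n)) at_top sequentially"
        by (rule filterlim_tendsto_pos_mult_at_top[OF tendsto_const mu1_pos])
           (rule filterlim_compose[OF filterlim_real_sequentially filterlim_Suc])
      then have "filterlim (\<lambda>n. - (mu1 * real (Suc n))) at_bot sequentially"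
        by (simp add: filterlim_uminus_at_top[symmetric])
      then have "(\<lambda>n. exp (- mu1 * real (Suc n))) \<longlonglongrightarrow> 0"
        using filterlim_compose[OF exp_at_bot] by (simp del: of_nat_Suc)
      then show "AE x in \<nu>. (\<lambda>n. h (real (Suc n)) x) \<longlonglongrightarrow> min 1 (exp (rate / \<epsilon> * (0 * (hnorm L x)\<^sup>2 + \<epsilon> * tr / mu1 - R\<^sup>2)))"
        unfolding h_def by (intro AE_I2 tendsto_intros)
    qed (auto simp: h01)
    ultimately have "(LINT x|\<nu>. \<phi> x) \<le> (LINT x|\<nu>. min 1 (exp (rate / \<epsilon> * (0 * (hnorm L x)\<^sup>2 + \<epsilon> * tr / mu1 - R\<^sup>2))))"
      by (intro LIMSEQ_le_const) auto
    also have "\<dots> \<le> exp (rate / \<epsilon> * (\<epsilon> * tr / mu1 - R\<^sup>2))" by (simp add: N.prob_space)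
    also have "\<dots> \<le> exp (- s / \<epsilon>)"
    proof -
      \<comment> \<open>Here \<epsilon> \<le> 1 enters: the trace term in the squared radius
        outweighs the noise energy, so that exactly - s / \<epsilon> is left as an upper
        bound.\<close>
      have "rate / \<epsilon> * (\<epsilon> * tr / mu1 - R\<^sup>2) = rate * tr / mu1 * (1 - 1 / \<epsilon>) - s / \<epsilon>"
        using \<epsilon> rate_pos mu1_pos unfolding R(1) by (simp add: field_simps)
      moreover have "rate * tr / mu1 * (1 - 1 / \<epsilon>) \<le> 0"
        using \<epsilon> rate_pos mu1_pos tr0 by (intro mult_nonneg_nonpos) auto
      ultimately show ?thesis by simp
    qed
    finally show ?thesis .
  next
    case False \<comment> \<open>the integral of a non-measurable function is \<open>0\<close>\<close>
    then obtain n where "g (real (Suc n)) \<notin> borel_measurable \<nu>" by blast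
    then have "\<not> integrable \<nu> (g (real (Suc n)))" by (auto dest: borel_measurable_integrable)
    then have "(LINT x|\<nu>. g (real (Suc n)) x) = 0" by (rule not_integrable_integral_eq)
    then have "(LINT x|\<nu>. \<phi> x) = 0" using inv_eq[of "real (Suc n)"] by (simp add: g_def)
    then show ?thesis by simp
  qed
  have A: "{x \<in> H L. hnorm L x \<ge> R} \<in> N.events"
  proof -
    have "{x \<in> space \<nu>. R \<le> hnorm L x} \<in> N.events" by measurable
    then show ?thesis by (simp add: space)
  qed
  have "measure \<nu> {x \<in> H L. hnorm L x \<ge> R} = (LINT x|\<nu>. indicat_real {x \<in> H L. hnorm L x \<ge> R} x)"
    using A by simp
  also have "\<dots> \<le> (LINT x|\<nu>. \<phi> x)"
  proof (rule integral_mono)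
    show "integrable \<nu> (indicat_real {x \<in> H L. hnorm L x \<ge> R})"
      using A by (intro N.integrable_const_bound[where B=1]) auto
    show "integrable \<nu> \<phi>" by (rule N.integrable_const_bound[where B=1]) (auto simp: \<phi>01)
    fix x
    have "\<phi> x = 1" if "R \<le> hnorm L x"
      using power_mono[OF that, of 2] R(2) rate_pos \<epsilon> by (simp add: \<phi>_def)
    then show "indicat_real {x \<in> H L. hnorm L x \<ge> R} x \<le> \<phi> x"
      using \<phi>01[of x] by (auto simp: indicator_def)
  qed
  finally show ?thesis using le by simp
qed

theorem theorem5p1:
  fixes L \<alpha> :: real
    and Q :: "vfield \<Rightarrow> vfield"
    and M :: "'a measure"
    and F :: "real \<Rightarrow> 'a measure"
    and w :: "real \<Rightarrow> 'a \<Rightarrow> vfield"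
    and u :: "real \<Rightarrow> vfield \<Rightarrow> real \<Rightarrow> 'a \<Rightarrow> vfield"
    and \<nu> :: "real \<Rightarrow> vfield measure"
  assumes "L > 0" and "\<alpha> > 1"
    and "positive_selfadjoint L Q"
    and "isomorphism_onto_pow_dom L (\<alpha> / 2) Q"
    and "filtered_prob_space M F"
    and "wiener_process L M F (Q \<circ> Q) w"
    and "\<And>\<epsilon> x. \<epsilon> \<in> {0<..1} \<Longrightarrow> x \<in> H L \<Longrightarrow> navier_stokes_solution L M F w \<epsilon> x (u \<epsilon> x)"
    and "\<And>\<epsilon>. \<epsilon> \<in> {0<..1} \<Longrightarrow> unique_invariant_measure L M (u \<epsilon>) (\<nu> \<epsilon>)"
  shows "\<forall>s>0. \<exists>\<epsilon>\<^sub>s>0. \<exists>R\<^sub>s>0. \<forall>\<epsilon>\<in>{0<..1}. \<epsilon> \<le> \<epsilon>\<^sub>s \<longrightarrow>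
           measure (\<nu> \<epsilon>) {x \<in> H L. hnorm L x \<ge> R\<^sub>s} \<le> exp (- s / \<epsilon>)"
proof -
  interpret torus L by unfold_locales (rule assms(1))
  obtain K where K: "\<And>x. x \<in> H L \<Longrightarrow> hnorm L (Q x) \<le> K * hnorm L x"
    using assms(3) by (auto simp: positive_selfadjoint_def bounded_in_H_def)
  \<comment> \<open>The bound \<open>K\<close> may be 0 or negative; this choice is positive and not
    smaller.\<close>
  define q where "q = \<bar>K\<bar> + 1"
  have q: "hnorm L (Q x) \<le> q * hnorm L x" if "x \<in> H L" for x
    using K[OF that] mult_right_mono[of K q "hnorm L x"] abs_ge_self[of K] by (simp add: q_def)
  have wi: "wiener L M F w Q q"
    using assms(5,6,3) q
    by (intro wiener.intro torus_axioms wiener_axioms.intro) (auto simp: filtered_prob_space_def q_def)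
  interpret wiener L M F w Q q by (rule wi)
  obtain tr where tr: "\<And>n. (\<Sum>k\<in>trunc n. (hnorm L (Q (ek k)))\<^sup>2) \<le> tr"
    using covariance_trace_bounded[OF assms(2-4)] by blast
  have tr0: "0 \<le> tr" by (rule order_trans[OF _ tr[of 0]]) (simp add: sum_nonneg)
  show ?thesis
  proof (intro allI impI)
    fix s :: real assume s: "s > 0"
    \<comment> \<open>The radius does not depend on \<epsilon>, and the tail bound holds for every
      \<epsilon> up to 1; therefore 1 can serve as the threshold.\<close>
    define R where "R = sqrt (s / rate + tr / mu1)"
    have pos: "s / rate + tr / mu1 > 0"
      using s rate_pos mu1_pos tr0 by (intro add_pos_nonneg) auto
    have R: "R\<^sup>2 = s / rate + tr / mu1" "R > 0" using pos by (auto simp: R_def)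
    have "measure (\<nu> \<epsilon>) {x \<in> H L. hnorm L x \<ge> R} \<le> exp (- s / \<epsilon>)" if "\<epsilon> \<in> {0<..1}" for \<epsilon>
      using that assms(7)[OF that] assms(8)[OF that]
      by (intro invariant_measure_tail[OF wi _ _ tr _ _ R, where u="u \<epsilon>"]) (auto simp: unique_invariant_measure_def)
    then show "\<exists>\<epsilon>\<^sub>s>0. \<exists>R\<^sub>s>0. \<forall>\<epsilon>\<in>{0<..1}. \<epsilon> \<le> \<epsilon>\<^sub>s \<longrightarrow>
           measure (\<nu> \<epsilon>) {x \<in> H L. hnorm L x \<ge> R\<^sub>s} \<le> exp (- s / \<epsilon>)"
      using R(2) by (intro exI[of _ 1] conjI exI[of _ R]) auto
  qed
qed

end
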